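(* Let $\chi\in\mathcal R^\infty(\mathbf C^d)$, $\sigma\in(0,\frac12)$ and $\sigma_0=\frac{\sigma}{1-2\sigma}$. Then the following is true: (i) For $F\in A(\mathbf C^d)$ the following conditions are equivalent: (1) $F\in\mathcal A_{\flat_\sigma}(\mathbf C^d)$ (respectively $F\in\mathcal A_{0,\flat_\sigma}(\mathbf C^d)$); (2) the estimate $|F(z)|\lesssim e^{r_1|z_1|^{2\sigma/(\sigma+1)}+\cdots+r_d|z_d|^{2\sigma/(\sigma+1)}}$, $z\in\mathbf C^d$, holds for some (respectively for every) $r\in\mathbf R_+^d$; (3) there exists $F_0\in\mathcal A_{\flat_{\sigma_0}}(\mathbf C^d)$ (respectively $F_0\in\mathcal A_{0,\flat_{\sigma_0}}(\mathbf C^d)$) such that $F=\Pi_A(F_0\cdot\chi)$. (ii) The mappings $F\mapsto\Pi_A(F\cdot\chi)$ from $\mathcal A_{\flat_{\sigma_0}}(\mathbf C^d)$ to $\mathcal A_{\flat_\sigma}(\mathbf C^d)$ and from $\mathcal A_{0,\flat_{\sigma_0}}(\mathbf C^d)$ to $\mathcal A_{0,\flat_\sigma}(\mathbf C^d)$ are homeomorphisms.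
   Context: Notation: $\mathbf R_+=(0,\infty)$, $\mathbf N=\{0,1,2,\dots\}$. Inequalities between vectors in $\mathbf R_+^d$ are coordinatewise. $D_r(0)=\{z\in\mathbf C^d: |z_j|<r_j,\ j=1,\dots,d\}$. $A(\mathbf C^d)$ is the set of entire functions. $g\lesssim h$ means $g\le Ch$ for a constant $C>0$ independent of the variable ($z$ or $\alpha$). Power series are written $F(z)=\sum_{\alpha\in\mathbf N^d}c(F,\alpha)e_\alpha(z)$ with $e_\alpha(z)=z^\alpha/\sqrt{\alpha!}$. For $\sigma>0$, $\mathcal A_{\flat_\sigma}(\mathbf C^d)$ (respectively $\mathcal A_{0,\flat_\sigma}(\mathbf C^d)$) is the set of $F$ with $|c(F,\alpha)|\lesssim r^\alpha\alpha!^{-1/(2\sigma)}$ for some (respectively every) $r\in\mathbf R_+^d$; all such $F$ are entire. Topologies: consider the Banach spaces of power series with finite norm $\sup_\alpha|c(F,\alpha)|r^{-\alpha}\alpha!^{1/(2\sigma)}$; $\mathcal A_{\flat_\sigma}$ carries the (locally convex) inductive limit topology, and $\mathcal A_{0,\flat_\sigma}$ the projective limit topology, of these spaces with respect to $r\in\mathbf R_+^d$. For $t_1\le t_2$ in $\mathbf R_+^d$, $\mathcal R^\infty_{t_1,t_2}(\mathbf C^d)$ is the set of non-negative $\chi\in L^\infty(\mathbf C^d)$ with support in $\overline{D_{t_2}(0)}$, of the form $\chi(z)=\chi_0(|z_1|,\dots,|z_d|)$ for some function $\chi_0$, and such that $\chi\ge c$ on $D_{t_1}(0)$ for some constant $c>0$.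 $\mathcal R^\infty(\mathbf C^d)=\bigcup_{t_1\le t_2}\mathcal R^\infty_{t_1,t_2}(\mathbf C^d)$. For compactly supported $F\in L^\infty(\mathbf C^d)$, $(\Pi_AF)(z)=\pi^{-d}\int_{\mathbf C^d}F(w)e^{(z,w)-|w|^2}\,d\lambda(w)$, where $(z,w)=\sum_jz_j\overline{w_j}$ and $d\lambda$ is the Lebesgue measure. *)

theory Defs
  imports "HOL-Analysis.Analysis"
begin

definition pos_vecs :: "(real ^ 'd) set"
  where "pos_vecs = {r. \<forall>j. 0 < r $ j}"

definition polydisc :: "real ^ 'd \<Rightarrow> (complex ^ 'd) set"
  where "polydisc r = {z. \<forall>j. norm (z $ j) < r $ j}"

definition entire :: "(complex ^ 'd \<Rightarrow> complex) \<Rightarrow> bool"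
  where "entire F \<longleftrightarrow>
    (\<forall>z. \<exists>F'. (F has_derivative F') (at z) \<and> (\<forall>c v. F' (c *s v) = c * F' v))"

definition mpow :: "'a::comm_monoid_mult ^ 'd \<Rightarrow> nat ^ 'd \<Rightarrow> 'a"
  where "mpow x \<alpha> = (\<Prod>j\<in>UNIV. x $ j ^ (\<alpha> $ j))"

definition mfact :: "nat ^ 'd \<Rightarrow> real"
  where "mfact \<alpha> = (\<Prod>j\<in>UNIV. fact (\<alpha> $ j))"

definition e_basis :: "nat ^ 'd \<Rightarrow> complex ^ 'd \<Rightarrow> complex"
  where "e_basis \<alpha> z = mpow z \<alpha> / of_real (sqrt (mfact \<alpha>))"

text \<open>
  A power series that converges on all of the space is identified with its sum. Every family of
  coefficients occurring below (in particular every one satisfying the growth bounds) defines such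
  a series.
\<close>

definition has_coeffs :: "(complex ^ 'd \<Rightarrow> complex) \<Rightarrow> (nat ^ 'd \<Rightarrow> complex) \<Rightarrow> bool"
  where "has_coeffs F c \<longleftrightarrow> (\<forall>z. ((\<lambda>\<alpha>. c \<alpha> * e_basis \<alpha> z) has_sum F z) UNIV)"

text \<open>The coefficients of an everywhere convergent power series are unique; for a function that is
  not the sum of such a series the value is irrelevant.\<close>

definition coeff_of :: "(complex ^ 'd \<Rightarrow> complex) \<Rightarrow> nat ^ 'd \<Rightarrow> complex"
  where "coeff_of F = (THE c. has_coeffs F c)"

definition power_series :: "(complex ^ 'd \<Rightarrow> complex) \<Rightarrow> bool"
  where "power_series F \<longleftrightarrow> has_coeffs F (coeff_of F)"

definition flat_bound :: "real \<Rightarrow> real ^ 'd \<Rightarrow> (complex ^ 'd \<Rightarrow> complex) \<Rightarrow> bool"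
  where "flat_bound \<sigma> r F \<longleftrightarrow>
    (\<exists>C>0. \<forall>\<alpha>. norm (coeff_of F \<alpha>) \<le> C * (mpow r \<alpha> * mfact \<alpha> powr (- 1 / (2 * \<sigma>))))"

definition A_flat :: "real \<Rightarrow> (complex ^ 'd \<Rightarrow> complex) set"
  where "A_flat \<sigma> = {F. power_series F \<and> (\<exists>r\<in>pos_vecs. flat_bound \<sigma> r F)}"

definition A0_flat :: "real \<Rightarrow> (complex ^ 'd \<Rightarrow> complex) set"
  where "A0_flat \<sigma> = {F. power_series F \<and> (\<forall>r\<in>pos_vecs. flat_bound \<sigma> r F)}"

definition coeff_norm :: "real \<Rightarrow> real ^ 'd \<Rightarrow> (nat ^ 'd \<Rightarrow> complex) \<Rightarrow> ennreal"
  where "coeff_norm \<sigma> r c =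
    (SUP \<alpha>. ennreal (norm (c \<alpha>) * inverse (mpow r \<alpha>) * mfact \<alpha> powr (1 / (2 * \<sigma>))))"

definition flat_banach :: "real \<Rightarrow> real ^ 'd \<Rightarrow> (complex ^ 'd \<Rightarrow> complex) set"
  where "flat_banach \<sigma> r = {F. power_series F \<and> coeff_norm \<sigma> r (coeff_of F) < \<infinity>}"

definition flat_dist ::
    "real \<Rightarrow> real ^ 'd \<Rightarrow> (complex ^ 'd \<Rightarrow> complex) \<Rightarrow> (complex ^ 'd \<Rightarrow> complex) \<Rightarrow> real"
  where "flat_dist \<sigma> r F G = enn2real (coeff_norm \<sigma> r (\<lambda>\<alpha>. coeff_of F \<alpha> - coeff_of G \<alpha>))"

definition flat_banach_topology :: "real \<Rightarrow> real ^ 'd \<Rightarrow> (complex ^ 'd \<Rightarrow> complex) topology"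
  where "flat_banach_topology \<sigma> r = Metric_space.mtopology (flat_banach \<sigma> r) (flat_dist \<sigma> r)"

definition locally_convex_topology :: "('a \<Rightarrow> complex) topology \<Rightarrow> bool"
  where "locally_convex_topology T \<longleftrightarrow>
    (\<lambda>x. 0) \<in> topspace T \<and>
    continuous_map (prod_topology T T) T (\<lambda>(F, G). \<lambda>x. F x + G x) \<and>
    continuous_map (prod_topology euclidean T) T (\<lambda>(c, F). \<lambda>x. c * F x) \<and>
    (\<forall>U. openin T U \<and> (\<lambda>x. 0) \<in> U \<longrightarrow>
      (\<exists>V. openin T V \<and> (\<lambda>x. 0) \<in> V \<and> V \<subseteq> U \<and>
        (\<forall>F\<in>V. \<forall>G\<in>V. \<forall>u\<in>{0..1}. (\<lambda>x. of_real u * F x + of_real (1 - u) * G x) \<in> V)))"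

text \<open>
  The locally convex inductive limit topology is the finest locally convex topology for which all
  inclusions of the Banach spaces are continuous. It is given here as the supremum of all locally
  convex topologies with this property; a supremum of such topologies is again one of them.
\<close>

definition A_flat_topology :: "real \<Rightarrow> (complex ^ 'd \<Rightarrow> complex) topology"
  where "A_flat_topology \<sigma> = topology_generated_by
    {U. \<exists>T. openin T U \<and> topspace T = A_flat \<sigma> \<and> locally_convex_topology T \<and>
      (\<forall>r\<in>pos_vecs. continuous_map (flat_banach_topology \<sigma> r) T (\<lambda>F. F))}"

text \<open>The coarsest topology for which the inclusions into all the Banach spaces are continuous.\<close>

definition A0_flat_topology :: "real \<Rightarrow> (complex ^ 'd \<Rightarrow> complex) topology"
  where "A0_flat_topology \<sigma> = topology_generated_by
    {A0_flat \<sigma> \<inter> W | r W. r \<in> pos_vecs \<and> openin (flat_banach_topology \<sigma> r) W}"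

text \<open>
  Elements of \<open>L\<^sup>\<infinity>\<close> are represented by functions, and all conditions on them are understood up to
  null sets; in particular the support is contained in a closed set iff the function vanishes
  almost everywhere on the complement of this set.
\<close>

definition R_inf_between :: "real ^ 'd \<Rightarrow> real ^ 'd \<Rightarrow> (complex ^ 'd \<Rightarrow> real) set"
  where "R_inf_between t1 t2 = {f.
    f \<in> borel_measurable lebesgue \<and>
    (\<exists>C. AE z in lebesgue. \<bar>f z\<bar> \<le> C) \<and>
    (AE z in lebesgue. 0 \<le> f z) \<and>
    (AE z in lebesgue. z \<notin> closure (polydisc t2) \<longrightarrow> f z = 0) \<and>
    (\<exists>f0 :: real ^ 'd \<Rightarrow> real. AE z in lebesgue. f z = f0 (\<chi> j. norm (z $ j))) \<and>
    (\<exists>c>0. AE z in lebesgue. z \<in> polydisc t1 \<longrightarrow> c \<le> f z)}"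

definition R_inf :: "(complex ^ 'd \<Rightarrow> real) set"
  where "R_inf = (\<Union>t1\<in>pos_vecs. \<Union>t2\<in>{t2\<in>pos_vecs. t1 \<le> t2}. R_inf_between t1 t2)"

definition herm :: "complex ^ 'd \<Rightarrow> complex ^ 'd \<Rightarrow> complex"
  where "herm z w = (\<Sum>j\<in>UNIV. z $ j * cnj (w $ j))"

definition Pi_A :: "(complex ^ 'd \<Rightarrow> complex) \<Rightarrow> complex ^ 'd \<Rightarrow> complex"
  where "Pi_A F z = of_real (inverse (pi ^ CARD('d))) *
    (LINT w|lebesgue. F w * exp (herm z w - of_real ((norm w)\<^sup>2)))"

end

theory Submission
  imports Defs "HOL-Complex_Analysis.Cauchy_Integral_Formula"
begin

text \<open>
  Integration against the radial weight \<open>\<chi>(w) exp (- |w|\<^sup>2)\<close> makes the \<open>e\<^sub>\<alpha>\<close> orthogonal, because the weight is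
  invariant under rotation of each coordinate. Hence \<open>F \<mapsto> \<Pi>\<^sub>A(F \<chi>)\<close> multiplies the coefficient of \<open>e\<^sub>\<alpha>\<close> by the
  moment \<open>\<pi>\<^sup>-\<^sup>d \<integral> |e\<^sub>\<alpha>|\<^sup>2 \<chi> exp (- |w|\<^sup>2)\<close>, which lies between \<open>c s\<^sup>\<alpha> / \<alpha>!\<close> and \<open>C t\<^sup>\<alpha> / \<alpha>!\<close>. Since
  \<open>1 / (2 \<sigma>\<^sub>0) = 1 / (2 \<sigma>) - 1\<close>, this multiplier and its inverse map the Banach spaces defining the two
  scales continuously into each other with a changed \<open>r\<close>, which gives the homeomorphisms. Growth
  and coefficient decay are compared by
  \<open>\<Sum>\<^sub>n x\<^sup>n n!\<^sup>-\<^sup>p \<le> (\<Sum>\<^sub>n x\<^sup>n\<^sup>/\<^sup>p / n!)\<^sup>p\<close> for \<open>p \<ge> 1\<close> in one direction and by Cauchy's estimates on the polydisc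
  of radii \<open>\<rho>\<^sub>j = ((\<alpha>\<^sub>j + 1) / r\<^sub>j)\<^sup>1\<^sup>/\<^sup>s\<close>, \<open>s = 2 \<sigma> / (\<sigma> + 1)\<close>, in the other.
\<close>

section \<open>Series indexed by multi-indices and Taylor coefficients\<close>

text \<open>The exponents come from two counts of factorials. The normalisation of
  \<open>e_basis\<close> contributes 1/2, so coefficient decay with exponent 1 / (2 \<sigma>) means
  1 / s = 1 / (2 \<sigma>) + 1 / 2 for plain monomials. The moments behave like 1 / \<alpha>! up to
  geometric factors, which shifts the exponent by exactly 1; \<sigma> < 1 / 2 is what keeps the
  shifted exponent positive. Geometric factors are absorbed by \<open>r\<close>, but for the
  versions with every \<open>r\<close> each change of radius has to be explicit and invertible. The
  weight is only Lebesgue measurable, its symmetry holds almost everywhere, and its radial profile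
  is an arbitrary function. Instead of polar coordinates, orthogonality therefore uses a single
  rotation that flips the sign of the integral. It also yields uniqueness of coefficients, on which
  \<open>coeff_of\<close> rests. The inductive limit topology is a supremum, so continuity into it
  is tested on one admissible topology at a time, by pulling that topology back along the linear
  map.\<close>

lemma finite_vec_le: "finite {\<alpha> :: nat ^ 'd. \<forall>j. \<alpha> $ j \<le> N}"
proof -
  have "{\<alpha> :: nat ^ 'd. \<forall>j. \<alpha> $ j \<le> N} \<subseteq> vec_lambda ` (UNIV \<rightarrow>\<^sub>E {..N})"
  proof
    fix \<alpha> :: "nat ^ 'd" assume "\<alpha> \<in> {\<alpha>. \<forall>j. \<alpha> $ j \<le> N}"
    then have "vec_nth \<alpha> \<in> UNIV \<rightarrow>\<^sub>E {..N}" by auto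
    then show "\<alpha> \<in> vec_lambda ` (UNIV \<rightarrow>\<^sub>E {..N})"
      by (metis image_iff vec_nth_inverse)
  qed
  then show ?thesis
    by (rule finite_subset) (auto intro!: finite_imageI finite_PiE)
qed

lemma sum_prod_vec_le:
  fixes f :: "'d::finite \<Rightarrow> nat \<Rightarrow> 'c::comm_semiring_1"
  shows "(\<Sum>\<alpha> | \<forall>j. \<alpha> $ j \<le> N. \<Prod>j\<in>UNIV. f j (\<alpha> $ j)) = (\<Prod>j\<in>UNIV. \<Sum>n\<le>N. f j n)"
proof -
  have "(\<Prod>j\<in>UNIV. \<Sum>n\<le>N. f j n) = (\<Sum>g\<in>UNIV \<rightarrow>\<^sub>E {..N}. \<Prod>j\<in>UNIV. f j (g j))"
    by (rule prod_sum_PiE) auto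
  also have "\<dots> = (\<Sum>\<alpha> | \<forall>j. \<alpha> $ j \<le> N. \<Prod>j\<in>UNIV. f j (\<alpha> $ j))"
    by (rule sum.reindex_bij_witness[of _ vec_nth vec_lambda]) auto
  finally show ?thesis ..
qed

text \<open>A finite set of multi-indices lies in a box, and over a box the sum of products factors
  into one-variable partial sums, each at most the full series.\<close>

lemma summable_prod_vec:
  fixes f :: "'d::finite \<Rightarrow> nat \<Rightarrow> real"
  assumes nn: "\<And>j n. 0 \<le> f j n" and sm: "\<And>j. summable (f j)"
  shows "(\<lambda>\<alpha> :: nat ^ 'd. \<Prod>j\<in>UNIV. f j (\<alpha> $ j)) summable_on UNIV"
proof (rule nonneg_bdd_above_summable_on)
  show "bdd_above (sum (\<lambda>\<alpha>. \<Prod>j\<in>UNIV. f j (\<alpha> $ j)) ` {A :: (nat ^ 'd) set. A \<subseteq> UNIV \<and> finite A})"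
  proof (rule bdd_aboveI2)
    fix A :: "(nat ^ 'd) set" assume "A \<in> {A. A \<subseteq> UNIV \<and> finite A}"
    then have A: "finite A" by auto
    \<comment> \<open>Inserting 0 keeps the maximum meaningful when \<open>A\<close> is
      empty.\<close>
    define N where "N = Max (insert 0 ((\<lambda>(\<alpha>, j). \<alpha> $ j) ` (A \<times> UNIV)))"
    have "\<alpha> $ j \<le> N" if "\<alpha> \<in> A" for \<alpha> j
      unfolding N_def using A that by (intro Max_ge) force+
    then have "(\<Sum>\<alpha>\<in>A. \<Prod>j\<in>UNIV. f j (\<alpha> $ j)) \<le> (\<Sum>\<alpha> | \<forall>j. \<alpha> $ j \<le> N. \<Prod>j\<in>UNIV. f j (\<alpha> $ j))"
      by (intro sum_mono2) (auto simp: finite_vec_le intro!: prod_nonneg nn)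
    also have "\<dots> = (\<Prod>j\<in>UNIV. \<Sum>n\<le>N. f j n)"
      by (rule sum_prod_vec_le)
    also have "\<dots> \<le> (\<Prod>j\<in>UNIV. suminf (f j))"
      by (intro prod_mono conjI sum_nonneg sum_le_suminf sm) (auto simp: nn)
    finally show "(\<Sum>\<alpha>\<in>A. \<Prod>j\<in>UNIV. f j (\<alpha> $ j)) \<le> (\<Prod>j\<in>UNIV. suminf (f j))" .
  qed
qed (auto intro: prod_nonneg nn)

text \<open>Distributivity of a finite product over absolutely convergent series, transported along
  \<open>vec_nth\<close> from extensional functions to vectors.\<close>

lemma has_sum_prod_vec:
  fixes f :: "'d::finite \<Rightarrow> nat \<Rightarrow> 'c::{banach, real_normed_field}"
  assumes sm: "\<And>j. summable (\<lambda>n. norm (f j n))" and S: "\<And>j. f j sums S j"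
  shows "((\<lambda>\<alpha> :: nat ^ 'd. \<Prod>j\<in>UNIV. f j (\<alpha> $ j)) has_sum (\<Prod>j\<in>UNIV. S j)) UNIV"
proof -
  have fs: "f j summable_on UNIV" "(\<lambda>n. norm (f j n)) summable_on UNIV" for j
    using norm_summable_imp_summable_on[OF sm[of j]] norm_summable_imp_summable_on[of "\<lambda>n. norm (f j n)"] sm[of j]
    by auto
  have "(\<lambda>\<alpha> :: nat ^ 'd. norm (\<Prod>j\<in>UNIV. f j (\<alpha> $ j))) summable_on UNIV"
    unfolding prod_norm[symmetric] by (rule summable_prod_vec) (auto simp: sm)
  moreover have bij: "bij_betw vec_nth (UNIV :: (nat ^ 'd) set) (UNIV \<rightarrow>\<^sub>E UNIV)"
    by (rule bij_betwI[where g = vec_lambda]) auto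
  ultimately have "((\<lambda>\<alpha> :: nat ^ 'd. \<Prod>j\<in>UNIV. f j (\<alpha> $ j)) has_sum
      (\<Sum>\<^sub>\<infinity>\<alpha>. \<Prod>j\<in>UNIV. f j (\<alpha> $ j))) UNIV"
    by (simp add: has_sum_infsum abs_summable_summable)
  also have "(\<Sum>\<^sub>\<infinity>\<alpha> :: nat ^ 'd. \<Prod>j\<in>UNIV. f j (\<alpha> $ j))
      = infsum (\<lambda>g. \<Prod>j\<in>UNIV. f j (g j)) (UNIV \<rightarrow>\<^sub>E UNIV)"
    using infsum_reindex_bij_betw[OF bij, of "\<lambda>g. \<Prod>j\<in>UNIV. f j (g j)"] by simp
  also have "\<dots> = (\<Prod>j\<in>UNIV. infsum (f j) UNIV)"
    using infsum_prod_PiE_abs[of UNIV f "\<lambda>_. UNIV"] fs by simp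
  also have "\<dots> = (\<Prod>j\<in>UNIV. S j)"
    using norm_summable_imp_has_sum[OF sm S] by (auto simp: infsumI intro!: prod.cong)
  finally show ?thesis .
qed

text \<open>The slices \<open>\<lambda>t. F (vupd z j t)\<close> give access to one-variable
  function theory. On multi-indices the same operation with value 0 erases an exponent.\<close>

definition vupd :: "'a ^ 'd \<Rightarrow> 'd \<Rightarrow> 'a \<Rightarrow> 'a ^ 'd"
  where "vupd z j t = (\<chi> i. if i = j then t else z $ i)"

lemma vupd_nth [simp]: "vupd z j t $ i = (if i = j then t else z $ i)"
  by (simp add: vupd_def)

lemma vupd_same [simp]: "vupd z j (z $ j) = z"
  by (simp add: vec_eq_iff)

lemma vupd_vupd [simp]: "vupd (vupd z j s) j t = vupd z j t"
  by (simp add: vec_eq_iff)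

lemma vupd_commute: "i \<noteq> j \<Longrightarrow> vupd (vupd z i s) j t = vupd (vupd z j t) i s"
  by (simp add: vec_eq_iff)

section \<open>Taylor coefficients in one variable and their dependence on a parameter\<close>

definition taylor_coeff :: "(complex \<Rightarrow> complex) \<Rightarrow> nat \<Rightarrow> complex"
  where "taylor_coeff f n = (deriv ^^ n) f 0 / fact n"

lemma taylor_coeff_sums:
  assumes "f holomorphic_on UNIV"
  shows "(\<lambda>n. taylor_coeff f n * z ^ n) sums f z"
proof -
  have "f holomorphic_on ball 0 (norm z + 1)"
    by (rule holomorphic_on_subset[OF assms]) simp
  from holomorphic_power_series[OF this, of z] show ?thesis
    by (simp add: taylor_coeff_def)
qed

lemma norm_taylor_coeff_le:
  assumes "f holomorphic_on UNIV" "0 < \<rho>" "\<And>t. norm t = \<rho> \<Longrightarrow> norm (f t) \<le> B"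
  shows "norm (taylor_coeff f n) \<le> B / \<rho> ^ n"
proof -
  have "norm ((deriv ^^ n) f 0) \<le> fact n * B / \<rho> ^ n"
    using assms by (intro Cauchy_inequality)
      (auto intro: holomorphic_on_subset holomorphic_on_imp_continuous_on)
  then show ?thesis
    by (simp add: taylor_coeff_def norm_divide field_simps)
qed

text \<open>Cauchy's estimate on the unit circle bounds all coefficients by \<open>B\<close>. The
  tail beyond index \<open>n\<close>, divided by \<open>t ^ n\<close>, is then dominated by
  \<open>B * norm t\<close> times a geometric series of ratio 1/2, whose sum is the factor 2. The
  rate depends on \<open>f\<close> through \<open>B\<close> only, hence is uniform over a bounded
  family.\<close>

lemma taylor_coeff_remainder:
  assumes f: "f holomorphic_on UNIV" and B: "\<And>t. norm t = 1 \<Longrightarrow> norm (f t) \<le> B"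
    and t: "0 < norm t" "norm t \<le> 1 / 2"
  shows "norm ((f t - (\<Sum>m<n. taylor_coeff f m * t ^ m)) / t ^ n - taylor_coeff f n) \<le> 2 * B * norm t"
proof -
  let ?a = "taylor_coeff f"
  have a: "norm (?a m) \<le> B" for m
    using norm_taylor_coeff_le[OF f, of 1 B] B by auto
  have B0: "0 \<le> B"
    using a[of 0] norm_ge_zero order_trans by blast
  have "(\<lambda>m. ?a (m + Suc n) * t ^ (m + Suc n)) sums (f t - (\<Sum>m<Suc n. ?a m * t ^ m))"
    using taylor_coeff_sums[OF f, of t] by (rule sums_split_initial_segment)
  then have s: "(\<lambda>m. ?a (m + Suc n) * t ^ (m + Suc n) / t ^ n) sums ((f t - (\<Sum>m<Suc n. ?a m * t ^ m)) / t ^ n)"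
    by (rule sums_divide)
  have g: "(\<lambda>m. B * norm t * (1/2) ^ m) sums (B * norm t * (1 / (1 - 1/2)))"
    by (intro sums_mult geometric_sums) auto
  have le: "norm (?a (m + Suc n) * t ^ (m + Suc n) / t ^ n) \<le> B * norm t * (1/2) ^ m" for m
  proof -
    have "norm (?a (m + Suc n) * t ^ (m + Suc n) / t ^ n) = norm (?a (m + Suc n)) * (norm t * norm t ^ m)"
      using t by (simp add: norm_mult norm_divide norm_power power_add)
    also have "\<dots> \<le> B * (norm t * (1/2) ^ m)"
      using t B0 by (intro mult_mono a power_mono) auto
    finally show ?thesis by simp
  qed
  have "norm ((f t - (\<Sum>m<Suc n. ?a m * t ^ m)) / t ^ n) \<le> B * norm t * (1 / (1 - 1/2))"
    using norm_suminf_le[OF le sums_summable[OF g]] sums_unique[OF s] sums_unique[OF g] by simp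
  moreover have "(f t - (\<Sum>m<Suc n. ?a m * t ^ m)) / t ^ n = (f t - (\<Sum>m<n. ?a m * t ^ m)) / t ^ n - ?a n"
    using t by (simp add: field_simps)
  ultimately show ?thesis
    by simp
qed

text \<open>By induction on \<open>n\<close>: the coefficient is the locally uniform limit, as \<open>t \<rightarrow> 0\<close>, of
  \<open>(g s t - \<Sum>m<n. a\<^sub>m(s) t\<^sup>m) / t\<^sup>n\<close>, which is holomorphic in \<open>s\<close>.\<close>

lemma holomorphic_taylor_coeff:
  fixes g :: "complex \<Rightarrow> complex \<Rightarrow> complex"
  assumes hs: "\<And>t. (\<lambda>s. g s t) holomorphic_on UNIV"
    and ht: "\<And>s. g s holomorphic_on UNIV"
    and bd: "\<And>R. \<exists>B. \<forall>s t. norm s \<le> R \<longrightarrow> norm t \<le> R \<longrightarrow> norm (g s t) \<le> B"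
  shows "(\<lambda>s. taylor_coeff (g s) n) holomorphic_on UNIV"
proof (induction n rule: less_induct)
  case (less n)
  \<comment> \<open>The points 1 / (k + 2) tend to 0 and start at 1/2, the largest modulus that the
    remainder estimate admits.\<close>
  define t :: "nat \<Rightarrow> complex" where "t k = of_real (inverse (real (Suc (Suc k))))" for k
  define h where "h k s = (g s (t k) - (\<Sum>m<n. taylor_coeff (g s) m * t k ^ m)) / t k ^ n" for k s
  have t: "0 < norm (t k)" "norm (t k) \<le> 1 / 2" for k
    unfolding t_def norm_of_real by (auto simp: field_simps)
  have "norm (t k) = inverse (real (Suc (Suc k)))" for k
    unfolding t_def norm_of_real by simp
  then have t0: "(\<lambda>k. norm (t k)) \<longlonglongrightarrow> 0"
    using LIMSEQ_Suc[OF LIMSEQ_inverse_real_of_nat] by simp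
  have hol: "h k holomorphic_on UNIV" for k
    unfolding h_def using t[of k] by (intro holomorphic_intros hs less.IH) auto
  show ?case
  proof (rule holomorphic_uniform_sequence[OF _ hol])
    fix x :: complex
    \<comment> \<open>One radius serves both variables: it covers the unit disc around
      \<open>x\<close> for the parameter and the unit circle for the Taylor variable.\<close>
    obtain B where B: "\<And>s t. norm s \<le> norm x + 1 \<Longrightarrow> norm t \<le> norm x + 1 \<Longrightarrow> norm (g s t) \<le> B"
      using bd by blast
    have "uniform_limit (cball x 1) h (\<lambda>s. taylor_coeff (g s) n) sequentially"
    proof (rule uniform_limitI)
      fix e :: real assume "0 < e"
      have "(\<lambda>k. 2 * B * norm (t k)) \<longlonglongrightarrow> 2 * B * 0"
        by (intro tendsto_intros t0)
      then have "\<forall>\<^sub>F k in sequentially. 2 * B * norm (t k) < e"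
        using \<open>0 < e\<close> by (auto intro: order_tendstoD)
      then show "\<forall>\<^sub>F k in sequentially. \<forall>s\<in>cball x 1. dist (h k s) (taylor_coeff (g s) n) < e"
      proof eventually_elim
        case (elim k)
        show ?case
        proof
          fix s assume "s \<in> cball x 1"
          then have "norm s \<le> norm x + 1"
            by (smt (verit, ccfv_threshold) dist_norm mem_cball norm_minus_commute norm_triangle_ineq2)
          then have "dist (h k s) (taylor_coeff (g s) n) \<le> 2 * B * norm (t k)"
            unfolding h_def dist_norm by (intro taylor_coeff_remainder ht B t) auto
          then show "dist (h k s) (taylor_coeff (g s) n) < e"
            using elim by simp
        qed
      qed
    qed
    then show "\<exists>d>0. cball x d \<subseteq> UNIV \<and> uniform_limit (cball x d) h (\<lambda>s. taylor_coeff (g s) n) sequentially"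
      by (intro exI[of _ 1]) auto
  qed auto
qed

section \<open>Taylor expansion in several variables, one coordinate at a time\<close>

text \<open>Supplies the local boundedness that makes Taylor coefficients holomorphic in a
  parameter: the majorant of a partially expanded coefficient increases with each modulus, so its
  value at the corner of a box bounds the whole box.\<close>

lemma ex_local_bound:
  fixes m :: "'d::finite \<Rightarrow> real \<Rightarrow> real" and G :: "complex ^ 'd \<Rightarrow> complex"
  assumes mono: "\<And>j x y. 0 \<le> x \<Longrightarrow> x \<le> y \<Longrightarrow> m j x \<le> m j y" and nn: "\<And>j x. 0 \<le> x \<Longrightarrow> 0 \<le> m j x"
    and "0 \<le> C"
    and bd: "\<And>z. norm (G z) \<le> C * (\<Prod>j\<in>UNIV. if j \<in> S then c j else m j (norm (z $ j)))"
    and c: "\<And>j. 0 \<le> c j"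
  shows "\<exists>B. \<forall>z. (\<forall>j. norm (z $ j) \<le> R j) \<longrightarrow> norm (G z) \<le> B"
proof (intro exI allI impI)
  fix z :: "complex ^ 'd" assume R: "\<forall>j. norm (z $ j) \<le> R j"
  have "norm (G z) \<le> C * (\<Prod>j\<in>UNIV. if j \<in> S then c j else m j (norm (z $ j)))"
    by (rule bd)
  also have "\<dots> \<le> C * (\<Prod>j\<in>UNIV. if j \<in> S then c j else m j (R j))"
    by (intro mult_left_mono prod_mono \<open>0 \<le> C\<close>) (auto simp: c nn R intro!: mono)
  finally show "norm (G z) \<le> C * (\<Prod>j\<in>UNIV. if j \<in> S then c j else m j (R j))" .
qed

text \<open>Expansion in the coordinates of \<open>S\<close> only; the coefficients remain functions of the other
  coordinates. The bounds \<open>b j n\<close> are what Cauchy's estimate yields from \<open>m j\<close>.\<close>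

lemma taylor_expansion_subset:
  fixes F :: "complex ^ 'd \<Rightarrow> complex" and m :: "'d \<Rightarrow> real \<Rightarrow> real" and b :: "'d \<Rightarrow> nat \<Rightarrow> real"
  assumes hol: "\<And>z j. (\<lambda>t. F (vupd z j t)) holomorphic_on UNIV"
    and bound: "\<And>z. norm (F z) \<le> C * (\<Prod>j\<in>UNIV. m j (norm (z $ j)))"
    and C: "0 \<le> C"
    and mono: "\<And>j x y. 0 \<le> x \<Longrightarrow> x \<le> y \<Longrightarrow> m j x \<le> m j y" and nn: "\<And>j x. 0 \<le> x \<Longrightarrow> 0 \<le> m j x"
    and b: "\<And>j n. \<exists>\<rho>>0. m j \<rho> \<le> b j n * \<rho> ^ n"
    and sm: "\<And>j x. 0 \<le> x \<Longrightarrow> summable (\<lambda>n. b j n * x ^ n)"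
    and "finite S"
  shows "\<exists>a :: nat ^ 'd \<Rightarrow> complex ^ 'd \<Rightarrow> complex.
    (\<forall>\<alpha> z j. (\<lambda>t. a \<alpha> (vupd z j t)) holomorphic_on UNIV) \<and>
    (\<forall>\<alpha> z z'. (\<forall>j. j \<notin> S \<longrightarrow> z $ j = z' $ j) \<longrightarrow> a \<alpha> z = a \<alpha> z') \<and>
    (\<forall>\<alpha> z. norm (a \<alpha> z) \<le> C * (\<Prod>j\<in>UNIV. if j \<in> S then b j (\<alpha> $ j) else m j (norm (z $ j)))) \<and>
    (\<forall>z. ((\<lambda>\<alpha>. a \<alpha> z * (\<Prod>j\<in>S. z $ j ^ (\<alpha> $ j))) has_sum F z) {\<alpha>. \<forall>j. j \<notin> S \<longrightarrow> \<alpha> $ j = 0})"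
  using \<open>finite S\<close>
proof (induction S)
  case empty
  have "{\<alpha> :: nat ^ 'd. \<forall>j. \<alpha> $ j = 0} = {0}"
    by (auto simp: vec_eq_iff)
  then show ?case
    using hol bound by (intro exI[of _ "\<lambda>_. F"]) (auto simp: has_sum_finite_iff simp flip: vec_eq_iff)
next
  case (insert k S)
  have b0: "0 \<le> b j n" for j n
    using b[of j n] nn[of _ j] by (metis less_le_not_le order_trans zero_le_mult_iff zero_le_power zero_less_power)
  from insert.IH obtain a :: "nat ^ 'd \<Rightarrow> complex ^ 'd \<Rightarrow> complex" where
    a1: "\<forall>\<alpha> z j. (\<lambda>t. a \<alpha> (vupd z j t)) holomorphic_on UNIV" and
    a2: "\<forall>\<alpha> z z'. (\<forall>j. j \<notin> S \<longrightarrow> z $ j = z' $ j) \<longrightarrow> a \<alpha> z = a \<alpha> z'" and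
    a3: "\<forall>\<alpha> z. norm (a \<alpha> z) \<le> C * (\<Prod>j\<in>UNIV. if j \<in> S then b j (\<alpha> $ j) else m j (norm (z $ j)))" and
    a4: "\<forall>z. ((\<lambda>\<alpha>. a \<alpha> z * (\<Prod>j\<in>S. z $ j ^ (\<alpha> $ j))) has_sum F z) {\<alpha>. \<forall>j. j \<notin> S \<longrightarrow> \<alpha> $ j = 0}"
    by (elim exE conjE) (rule that)
  note a_hol = a1[rule_format] and a_cong = a2[rule_format] and a_bd = a3[rule_format] and a_sum = a4[rule_format]
  \<comment> \<open>Erasing entry \<open>k\<close> first brings the index back to the set over which
    the induction hypothesis sums; the erased exponent then selects the coefficient of the slice in
    direction \<open>k\<close>.\<close>
  define a' where "a' \<alpha> z = taylor_coeff (\<lambda>t. a (vupd \<alpha> k 0) (vupd z k t)) (\<alpha> $ k)" for \<alpha> z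
  have hol': "(\<lambda>t. a' \<alpha> (vupd z j t)) holomorphic_on UNIV" for \<alpha> z j
  proof (cases "j = k")
    case True
    then show ?thesis by (simp add: a'_def)
  next
    case False
    show ?thesis unfolding a'_def
    proof (rule holomorphic_taylor_coeff)
      show "(\<lambda>s. a (vupd \<alpha> k 0) (vupd (vupd z j s) k t)) holomorphic_on UNIV" for t
        using a_hol[of "vupd \<alpha> k 0" "vupd z k t" j] False by (simp add: vupd_commute[of j k])
      show "(\<lambda>t. a (vupd \<alpha> k 0) (vupd (vupd z j s) k t)) holomorphic_on UNIV" for s
        by (rule a_hol)
      fix R :: real
      \<comment> \<open>Coordinates \<open>j\<close> and \<open>k\<close> move within radius
        \<open>R\<close> while the others stay at those of \<open>z\<close>; the maximum gives one
        box for both.\<close>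
      obtain B where B: "\<And>w. (\<forall>i. norm (w $ i) \<le> max R (norm (z $ i))) \<Longrightarrow> norm (a (vupd \<alpha> k 0) w) \<le> B"
        using ex_local_bound[where m = m and G = "a (vupd \<alpha> k 0)" and C = C and S = S
          and c = "\<lambda>i. b i (vupd \<alpha> k 0 $ i)" and R = "\<lambda>i. max R (norm (z $ i))", OF mono nn C a_bd b0]
        by auto
      have "norm (a (vupd \<alpha> k 0) (vupd (vupd z j s) k t)) \<le> B" if "norm s \<le> R" "norm t \<le> R" for s t
        using that by (intro B) auto
      then show "\<exists>B. \<forall>s t. norm s \<le> R \<longrightarrow> norm t \<le> R \<longrightarrow> norm (a (vupd \<alpha> k 0) (vupd (vupd z j s) k t)) \<le> B"
        by blast
    qed
  qed
  have cong': "a' \<alpha> z = a' \<alpha> z'" if "\<And>j. j \<notin> insert k S \<Longrightarrow> z $ j = z' $ j" for \<alpha> z z'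
  proof -
    have "(\<lambda>t. a (vupd \<alpha> k 0) (vupd z k t)) = (\<lambda>t. a (vupd \<alpha> k 0) (vupd z' k t))"
      by (intro ext a_cong) (use that in auto)
    then show ?thesis by (simp add: a'_def)
  qed
  have split: "(\<Prod>j\<in>UNIV. f j) = f k * (\<Prod>j\<in>UNIV - {k}. f j)" for f :: "'d \<Rightarrow> real"
    by (rule prod.remove) auto
  have bd': "norm (a' \<alpha> z) \<le> C * (\<Prod>j\<in>UNIV. if j \<in> insert k S then b j (\<alpha> $ j) else m j (norm (z $ j)))"
    (is "_ \<le> C * ?P") for \<alpha> z
  proof -
    define Q where "Q = (\<Prod>j\<in>UNIV - {k}. if j \<in> S then b j (\<alpha> $ j) else m j (norm (z $ j)))"
    have Q0: "0 \<le> Q"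
      unfolding Q_def by (intro prod_nonneg) (auto simp: b0 nn)
    \<comment> \<open>The radius may depend on the exponent. This freedom is what later turns
      exponential growth into factorial decay.\<close>
    obtain \<rho> where \<rho>: "0 < \<rho>" "m k \<rho> \<le> b k (\<alpha> $ k) * \<rho> ^ (\<alpha> $ k)"
      using b by blast
    have "norm (a' \<alpha> z) \<le> (C * (m k \<rho> * Q)) / \<rho> ^ (\<alpha> $ k)"
      unfolding a'_def
    proof (rule norm_taylor_coeff_le[OF a_hol \<rho>(1)])
      fix t :: complex assume t: "norm t = \<rho>"
      have "(\<Prod>j\<in>UNIV. if j \<in> S then b j (vupd \<alpha> k 0 $ j) else m j (norm (vupd z k t $ j))) = m k \<rho> * Q"
        unfolding split[of "\<lambda>j. if j \<in> S then _ j else _ j"] Q_def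
        using insert.hyps t by (intro arg_cong2[where f = times] prod.cong) auto
      then show "norm (a (vupd \<alpha> k 0) (vupd z k t)) \<le> C * (m k \<rho> * Q)"
        using a_bd[of "vupd \<alpha> k 0" "vupd z k t"] by simp
    qed
    also have "\<dots> = C * Q * (m k \<rho> / \<rho> ^ (\<alpha> $ k))"
      by simp
    also have "\<dots> \<le> C * Q * b k (\<alpha> $ k)"
      using \<rho> C Q0 by (intro mult_left_mono) (auto simp: divide_le_eq)
    also have "b k (\<alpha> $ k) * Q = ?P"
      unfolding split[of "\<lambda>j. if j \<in> insert k S then _ j else _ j"] Q_def
      by (intro arg_cong2[where f = times] prod.cong) auto
    then have "C * Q * b k (\<alpha> $ k) = C * ?P"
      by (simp add: mult_ac)
    finally show ?thesis .
  qed
  have sum': "((\<lambda>\<alpha>. a' \<alpha> z * (\<Prod>j\<in>insert k S. z $ j ^ (\<alpha> $ j))) has_sum F z)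
      {\<alpha>. \<forall>j. j \<notin> insert k S \<longrightarrow> \<alpha> $ j = 0}" for z
  proof -
    define A where "A = {\<alpha> :: nat ^ 'd. \<forall>j. j \<notin> S \<longrightarrow> \<alpha> $ j = 0}"
    define A' where "A' = {\<alpha> :: nat ^ 'd. \<forall>j. j \<notin> insert k S \<longrightarrow> \<alpha> $ j = 0}"
    define f where "f \<alpha> = a' \<alpha> z * (\<Prod>j\<in>insert k S. z $ j ^ (\<alpha> $ j))" for \<alpha>
    define M where "M = C * (\<Prod>j\<in>UNIV - insert k S. m j (norm (z $ j)))"
    \<comment> \<open>Outside \<open>insert k S\<close> the factor is the indicator of exponent 0.
      The product over all coordinates is thus summable over all multi-indices and reduces on
      \<open>A'\<close> to the product over \<open>insert k S\<close>.\<close>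
    define g where "g j n = (if j \<in> insert k S then b j n * norm (z $ j) ^ n else if n = 0 then 1 else 0)" for j n
    have "(\<lambda>\<alpha> :: nat ^ 'd. \<Prod>j\<in>UNIV. g j (\<alpha> $ j)) summable_on UNIV"
    proof (rule summable_prod_vec)
      show "0 \<le> g j n" for j n
        by (auto simp: g_def b0)
      show "summable (g j)" for j
        unfolding g_def using sm[of "norm (z $ j)" j] by (cases "j \<in> insert k S") (auto simp del: insert_iff)
    qed
    then have "(\<lambda>\<alpha> :: nat ^ 'd. M * (\<Prod>j\<in>UNIV. g j (\<alpha> $ j))) summable_on UNIV"
      by (rule summable_on_cmult_right)
    then have gs: "(\<lambda>\<alpha> :: nat ^ 'd. M * (\<Prod>j\<in>UNIV. g j (\<alpha> $ j))) summable_on A'"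
      by (rule summable_on_subset_banach) auto
    have "norm (f \<alpha>) \<le> M * (\<Prod>j\<in>UNIV. g j (\<alpha> $ j))" if \<alpha>: "\<alpha> \<in> A'" for \<alpha>
    proof -
      have U: "UNIV = insert k S \<union> (UNIV - insert k S)" by auto
      have un: "(\<Prod>j\<in>UNIV. h j) = (\<Prod>j\<in>insert k S. h j) * (\<Prod>j\<in>UNIV - insert k S. h j)" for h :: "'d \<Rightarrow> real"
        by (subst U, rule prod.union_disjoint) (auto simp: insert.hyps)
      have "norm (f \<alpha>) \<le> C * (\<Prod>j\<in>UNIV. if j \<in> insert k S then b j (\<alpha> $ j) else m j (norm (z $ j)))
          * (\<Prod>j\<in>insert k S. norm (z $ j) ^ (\<alpha> $ j))"
        unfolding f_def norm_mult prod_norm[symmetric] norm_power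
        by (intro mult_right_mono bd' prod_nonneg) auto
      also have "(\<Prod>j\<in>UNIV. if j \<in> insert k S then b j (\<alpha> $ j) else m j (norm (z $ j)))
          = (\<Prod>j\<in>insert k S. b j (\<alpha> $ j)) * (\<Prod>j\<in>UNIV - insert k S. m j (norm (z $ j)))"
        unfolding un by (intro arg_cong2[where f = times] prod.cong) auto
      also have "C * ((\<Prod>j\<in>insert k S. b j (\<alpha> $ j)) * (\<Prod>j\<in>UNIV - insert k S. m j (norm (z $ j))))
          * (\<Prod>j\<in>insert k S. norm (z $ j) ^ (\<alpha> $ j))
          = M * (\<Prod>j\<in>insert k S. b j (\<alpha> $ j) * norm (z $ j) ^ (\<alpha> $ j))"
        by (simp only: M_def prod.distrib mult_ac)
      also have "(\<Prod>j\<in>insert k S. b j (\<alpha> $ j) * norm (z $ j) ^ (\<alpha> $ j)) = (\<Prod>j\<in>UNIV. g j (\<alpha> $ j))"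
      proof -
        have "(\<Prod>j\<in>insert k S. g j (\<alpha> $ j)) = (\<Prod>j\<in>insert k S. b j (\<alpha> $ j) * norm (z $ j) ^ (\<alpha> $ j))"
          by (rule prod.cong) (auto simp: g_def)
        moreover have "(\<Prod>j\<in>UNIV - insert k S. g j (\<alpha> $ j)) = 1"
          using \<alpha> by (intro prod.neutral) (auto simp: g_def A'_def)
        ultimately show ?thesis unfolding un[of "\<lambda>j. g j (\<alpha> $ j)"] by simp
      qed
      finally show ?thesis .
    qed
    then have fs: "f summable_on A'"
      using Infinite_Sum.abs_summable_on_comparison_test'[OF gs] abs_summable_summable by blast
    define \<phi> where "\<phi> p = vupd (fst p) k (snd p)" for p :: "(nat ^ 'd) \<times> nat"
    have bij: "bij_betw \<phi> (Sigma A (\<lambda>_. UNIV)) A'"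
    proof (rule bij_betwI[where g = "\<lambda>\<alpha>. (vupd \<alpha> k 0, \<alpha> $ k)"])
      show "\<phi> \<in> Sigma A (\<lambda>_. UNIV) \<rightarrow> A'"
        by (auto simp: A_def A'_def \<phi>_def)
      show "(\<lambda>\<alpha>. (vupd \<alpha> k 0, \<alpha> $ k)) \<in> A' \<rightarrow> Sigma A (\<lambda>_. UNIV)"
        by (auto simp: A_def A'_def)
      show "(vupd (\<phi> p) k 0, \<phi> p $ k) = p" if "p \<in> Sigma A (\<lambda>_. UNIV)" for p
      proof -
        have "vupd (fst p) k 0 = fst p"
          using that insert.hyps by (auto simp: A_def vec_eq_iff)
        then show ?thesis by (simp add: \<phi>_def prod_eq_iff)
      qed
      show "\<phi> (vupd \<alpha> k 0, \<alpha> $ k) = \<alpha>" for \<alpha>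
        by (simp add: \<phi>_def)
    qed
    have inner: "((\<lambda>n. f (\<phi> (\<alpha>, n))) has_sum (a \<alpha> z * (\<Prod>j\<in>S. z $ j ^ (\<alpha> $ j)))) UNIV" if \<alpha>: "\<alpha> \<in> A" for \<alpha>
    proof -
      have [simp]: "vupd \<alpha> k 0 = \<alpha>"
        using \<alpha> insert.hyps by (auto simp: A_def vec_eq_iff)
      have eq: "f (\<phi> (\<alpha>, n)) = (\<Prod>j\<in>S. z $ j ^ (\<alpha> $ j)) * (taylor_coeff (\<lambda>t. a \<alpha> (vupd z k t)) n * (z $ k) ^ n)" for n
      proof -
        have "(\<Prod>j\<in>S. z $ j ^ (vupd \<alpha> k n $ j)) = (\<Prod>j\<in>S. z $ j ^ (\<alpha> $ j))"
          using insert.hyps by (intro prod.cong) auto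
        then show ?thesis
          using insert.hyps by (simp add: f_def \<phi>_def a'_def del: vupd_nth) simp
      qed
      have "(\<lambda>n. f (\<phi> (\<alpha>, n))) sums ((\<Prod>j\<in>S. z $ j ^ (\<alpha> $ j)) * a \<alpha> (vupd z k (z $ k)))"
        unfolding eq by (intro sums_mult taylor_coeff_sums a_hol)
      moreover have "(\<lambda>n. f (\<phi> (\<alpha>, n))) summable_on UNIV"
      proof -
        have "f summable_on (\<lambda>n. \<phi> (\<alpha>, n)) ` UNIV"
          using bij \<alpha> by (intro summable_on_subset_banach[OF fs]) (auto simp: bij_betw_def)
        moreover have "inj (\<lambda>n. \<phi> (\<alpha>, n))"
          by (rule injI) (metis \<phi>_def snd_conv vupd_nth)
        ultimately show ?thesis
          by (simp add: summable_on_reindex o_def)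
      qed
      ultimately show ?thesis
        using has_sum_imp_sums sums_unique2 has_sum_infsum by (metis mult.commute vupd_same)
    qed
    \<comment> \<open>The iterated sum is known from the induction hypothesis and
      \<open>inner\<close>; the summability \<open>fs\<close> allows it to be read as one sum over
      pairs.\<close>
    have "((\<lambda>p. f (\<phi> p)) has_sum F z) (Sigma A (\<lambda>_. UNIV))"
      using a_sum[of z] inner fs
      by (intro has_sum_SigmaI[where g = "\<lambda>\<alpha>. a \<alpha> z * (\<Prod>j\<in>S. z $ j ^ (\<alpha> $ j))"])
        (auto simp: A_def[symmetric] summable_on_reindex_bij_betw[OF bij])
    then have "(f has_sum F z) A'"
      by (simp only: has_sum_reindex_bij_betw[OF bij])
    then show ?thesis
      by (simp only: f_def[abs_def] A'_def)
  qed
  show ?case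
    using hol' cong' bd' sum' by (intro exI[of _ a']) blast
qed

text \<open>For \<open>S = UNIV\<close> the premise of the congruence clause is vacuous, so the
  coefficient functions are constants and may be read off at 0.\<close>

theorem taylor_expansion:
  fixes F :: "complex ^ 'd \<Rightarrow> complex" and m :: "'d \<Rightarrow> real \<Rightarrow> real" and b :: "'d \<Rightarrow> nat \<Rightarrow> real"
  assumes "\<And>z j. (\<lambda>t. F (vupd z j t)) holomorphic_on UNIV"
    and "\<And>z. norm (F z) \<le> C * (\<Prod>j\<in>UNIV. m j (norm (z $ j)))"
    and "0 \<le> C"
    and "\<And>j x y. 0 \<le> x \<Longrightarrow> x \<le> y \<Longrightarrow> m j x \<le> m j y" and "\<And>j x. 0 \<le> x \<Longrightarrow> 0 \<le> m j x"
    and "\<And>j n. \<exists>\<rho>>0. m j \<rho> \<le> b j n * \<rho> ^ n"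
    and "\<And>j x. 0 \<le> x \<Longrightarrow> summable (\<lambda>n. b j n * x ^ n)"
  obtains a :: "nat ^ 'd \<Rightarrow> complex" where
    "\<And>\<alpha>. norm (a \<alpha>) \<le> C * (\<Prod>j\<in>UNIV. b j (\<alpha> $ j))"
    "\<And>z. ((\<lambda>\<alpha>. a \<alpha> * mpow z \<alpha>) has_sum F z) UNIV"
proof -
  obtain a :: "nat ^ 'd \<Rightarrow> complex ^ 'd \<Rightarrow> complex" where
    "\<And>\<alpha> z z'. a \<alpha> z = a \<alpha> z'" and
    "\<And>\<alpha> z. norm (a \<alpha> z) \<le> C * (\<Prod>j\<in>UNIV. b j (\<alpha> $ j))" and
    "\<And>z. ((\<lambda>\<alpha>. a \<alpha> z * (\<Prod>j\<in>UNIV. z $ j ^ (\<alpha> $ j))) has_sum F z) UNIV"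
    using taylor_expansion_subset[OF assms, of UNIV] by auto
  then have a: "\<And>\<alpha> z. a \<alpha> z = a \<alpha> 0"
      "\<And>\<alpha>. norm (a \<alpha> 0) \<le> C * (\<Prod>j\<in>UNIV. b j (\<alpha> $ j))"
      "\<And>z. ((\<lambda>\<alpha>. a \<alpha> z * mpow z \<alpha>) has_sum F z) UNIV"
    by (simp_all add: mpow_def)
  show thesis
  proof (rule that[of "\<lambda>\<alpha>. a \<alpha> 0"])
    show "((\<lambda>\<alpha>. a \<alpha> 0 * mpow z \<alpha>) has_sum F z) UNIV" for z
      using a(3)[of z] by (subst (asm) a(1))
  qed (rule a(2))
qed

section \<open>Coefficient decay and growth\<close>

lemma exp_sums_real: "(\<lambda>n. x ^ n / fact n) sums exp (x :: real)"
  using exp_converges[of x] by (simp only: real_scaleR_def divide_inverse_commute)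

lemma mult_le_sum_squares:
  fixes a b :: real
  assumes "0 \<le> a" "0 \<le> b"
  shows "a * b \<le> a\<^sup>2 + b\<^sup>2"
  using sum_squares_bound[of a b] mult_nonneg_nonneg[OF assms] by simp

lemma norm_has_sum_le:
  fixes f :: "'b \<Rightarrow> 'a::banach"
  assumes "(f has_sum a) A" "(g has_sum b) A" "\<And>x. x \<in> A \<Longrightarrow> norm (f x) \<le> g x"
  shows "norm a \<le> b"
proof -
  have "(\<lambda>x. norm (f x)) summable_on A"
    using assms by (intro Infinite_Sum.abs_summable_on_comparison_test'[of g]) (auto simp: summable_on_def)
  then have n: "((\<lambda>x. norm (f x)) has_sum (\<Sum>\<^sub>\<infinity>x\<in>A. norm (f x))) A"
    by (rule has_sum_infsum)
  show ?thesis
    using norm_has_sum_bound[OF n assms(1)] has_sum_mono[OF n assms(2)] assms(3) by auto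
qed

text \<open>With u = x^(1/p) and y_n = u^n / n!, each term is y_n^p. As y_n is at most the full sum
  exp u, y_n^p is at most y_n (exp u)^(p - 1), where p \<ge> 1 enters; summing gives exp (p
  u).\<close>

lemma fact_powr_le_exp:
  fixes x p :: real
  assumes "1 \<le> p" "0 \<le> x"
  shows "summable (\<lambda>n. x ^ n * fact n powr (- p))"
    and "(\<Sum>n. x ^ n * fact n powr (- p)) \<le> exp (p * x powr (1 / p))"
proof -
  define u where "u = x powr (1 / p)"
  define y where "y n = u ^ n / fact n" for n
  have y: "y sums exp u"
    unfolding y_def by (rule exp_sums_real)
  have y0: "0 \<le> y n" for n
    by (simp add: y_def u_def)
  \<comment> \<open>The base 0 is separated because \<open>powr_realpow\<close> asks for a positive
    base.\<close>
  have up: "(u ^ n) powr p = x ^ n" for n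
  proof (cases "x = 0")
    case True
    then show ?thesis by (cases n) (auto simp: u_def)
  next
    case False
    then have "(u ^ n) powr p = (x powr (1 / p)) powr (real n * p)"
      using assms by (simp add: u_def powr_powr flip: powr_realpow)
    also have "\<dots> = x powr real n"
      using assms by (simp add: powr_powr)
    finally show ?thesis
      using False assms by (simp add: powr_realpow)
  qed
  have eq: "x ^ n * fact n powr (- p) = y n powr p" for n
  proof -
    have "y n powr p = (u ^ n) powr p / fact n powr p"
      unfolding y_def u_def by (rule powr_divide)
    then show ?thesis
      by (simp only: up powr_minus divide_inverse)
  qed
  have le: "x ^ n * fact n powr (- p) \<le> y n * exp u powr (p - 1)" for n
  proof (cases "y n = 0")
    case False
    have "y n \<le> suminf y"
      using sum_le_suminf[OF sums_summable[OF y], of "{n}"] y0 by auto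
    then have "y n \<le> exp u"
      using y by (simp add: sums_iff)
    then have "y n * y n powr (p - 1) \<le> y n * exp u powr (p - 1)"
      using assms y0 by (intro mult_left_mono powr_mono2) auto
    moreover have "y n powr p = y n * y n powr (p - 1)"
      using y0[of n] False powr_add[of "y n" 1 "p - 1"] by simp
    ultimately show ?thesis unfolding eq by linarith
  qed (simp add: eq)
  have s: "(\<lambda>n. y n * exp u powr (p - 1)) sums (exp u * exp u powr (p - 1))"
    by (intro sums_mult2 y)
  have nn: "0 \<le> x ^ n * fact n powr (- p)" for n
    using assms by simp
  show sm: "summable (\<lambda>n. x ^ n * fact n powr (- p))"
    by (rule summable_comparison_test'[OF sums_summable[OF s], of 0]) (use le nn assms in auto)
  have "(\<Sum>n. x ^ n * fact n powr (- p)) \<le> exp u * exp u powr (p - 1)"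
    using suminf_le[OF le sm sums_summable[OF s]] s by (simp add: sums_iff)
  also have "\<dots> = exp (p * u)"
    by (simp add: powr_def flip: exp_add) (simp add: algebra_simps)
  finally show "(\<Sum>n. x ^ n * fact n powr (- p)) \<le> exp (p * x powr (1 / p))"
    by (simp add: u_def)
qed

text \<open>Covers exponents below 1, which occur because \<sigma> / (1 - 2 \<sigma>) can exceed 1.
  The term is split as (1/2)^n times (2 x)^n n!^(-1/2), and a product is at most the sum of the
  squares: a geometric and an exponential series.\<close>

lemma summable_fact_powr:
  fixes x q :: real
  assumes "1 / 2 \<le> q" "0 \<le> x"
  shows "summable (\<lambda>n. x ^ n * fact n powr (- q))"
proof (rule summable_comparison_test'[of _ 0])
  have "(\<lambda>n. (4 * x\<^sup>2) ^ n / fact n) sums exp (4 * x\<^sup>2)"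
    by (rule exp_sums_real)
  then show "summable (\<lambda>n. (1 / 4) ^ n + (4 * x\<^sup>2) ^ n / fact n)"
    by (intro summable_add summable_geometric) (auto simp: sums_iff)
  fix n
  let ?a = "(1 / 2 :: real) ^ n" and ?b = "(2 * x) ^ n * fact n powr (- 1 / 2)"
  have "fact n powr (- q) \<le> (fact n powr (- 1 / 2) :: real)"
    using assms by (intro powr_mono) auto
  then have "x ^ n * fact n powr (- q) \<le> x ^ n * fact n powr (- 1 / 2)"
    using assms by (intro mult_left_mono) auto
  also have "\<dots> = ?a * ?b"
    by (simp add: power_mult_distrib field_simps)
  also have "\<dots> \<le> ?a\<^sup>2 + ?b\<^sup>2"
    using assms by (intro mult_le_sum_squares) auto
  also have "?a\<^sup>2 = (1 / 4) ^ n"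
  proof -
    have "?a\<^sup>2 = ((1 / 2)\<^sup>2) ^ n"
      by (metis power_mult mult.commute)
    then show ?thesis by (simp add: power2_eq_square)
  qed
  also have "?b\<^sup>2 = (4 * x\<^sup>2) ^ n / fact n"
  proof -
    have "(fact n powr (- 1 / 2))\<^sup>2 = (fact n powr (- 1 / 2 + - 1 / 2) :: real)"
      by (simp only: powr_add power2_eq_square)
    also have "\<dots> = fact n powr - 1"
      by (rule arg_cong2[where f = "(powr)"]) auto
    also have "\<dots> = 1 / fact n"
      by (rule powr_neg_one) simp
    finally have "(fact n powr (- 1 / 2))\<^sup>2 = (1 / fact n :: real)" .
    moreover have "((2 * x) ^ n)\<^sup>2 = ((2 * x)\<^sup>2) ^ n"
      by (metis power_mult mult.commute)
    moreover have "(2 * x)\<^sup>2 = 4 * x\<^sup>2"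
      by (simp add: power2_eq_square)
    ultimately show ?thesis by (simp only: power_mult_distrib[of "(2 * x) ^ n"]) simp
  qed
  finally show "norm (x ^ n * fact n powr (- q)) \<le> (1 / 4) ^ n + (4 * x\<^sup>2) ^ n / fact n"
    using assms by simp
qed

lemma mfact_pos: "0 < mfact \<alpha>"
  by (simp add: mfact_def prod_pos)

lemma mfact_powr: "mfact \<alpha> powr p = (\<Prod>j\<in>UNIV. fact (\<alpha> $ j) powr p)"
  unfolding mfact_def by (simp add: prod_powr_distrib)

lemma mpow_pos: "r \<in> pos_vecs \<Longrightarrow> 0 < mpow r \<alpha>"
  by (auto simp: mpow_def pos_vecs_def intro!: prod_pos)

lemma norm_mpow: "norm (mpow z \<alpha>) = (\<Prod>j\<in>UNIV. norm (z $ j) ^ (\<alpha> $ j))"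
  for z :: "complex ^ 'd"
  unfolding mpow_def prod_norm[symmetric] norm_power ..

lemma norm_e_basis: "norm (e_basis \<alpha> z) = (\<Prod>j\<in>UNIV. norm (z $ j) ^ (\<alpha> $ j)) * mfact \<alpha> powr (- 1 / 2)"
proof -
  have "mfact \<alpha> powr (- 1 / 2) = inverse (mfact \<alpha> powr (1 / 2))"
    by (metis minus_divide_left powr_minus)
  also have "\<dots> = inverse (sqrt (mfact \<alpha>))"
    using mfact_pos[of \<alpha>] by (simp add: powr_half_sqrt)
  finally show ?thesis
    using mfact_pos[of \<alpha>] unfolding e_basis_def norm_divide norm_mpow norm_of_real
    by (simp only: divide_inverse abs_of_nonneg real_sqrt_ge_zero less_imp_le)
qed

text \<open>The square root of \<alpha>! in \<open>e_basis\<close> raises the decay exponent by 1/2,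
  and the resulting majorant factors over the coordinates.\<close>

lemma norm_coeff_term_le:
  fixes z :: "complex ^ 'd"
  assumes "norm c \<le> C * (mpow r \<alpha> * mfact \<alpha> powr (- 1 / (2 * \<sigma>)))"
  shows "norm (c * e_basis \<alpha> z) \<le>
    C * (\<Prod>j\<in>UNIV. (r $ j * norm (z $ j)) ^ (\<alpha> $ j) * fact (\<alpha> $ j) powr (- (1 / (2 * \<sigma>) + 1 / 2)))"
proof -
  have "norm (c * e_basis \<alpha> z) \<le> C * (mpow r \<alpha> * mfact \<alpha> powr (- 1 / (2 * \<sigma>))) *
      ((\<Prod>j\<in>UNIV. norm (z $ j) ^ (\<alpha> $ j)) * mfact \<alpha> powr (- 1 / 2))"
    unfolding norm_mult norm_e_basis by (intro mult_right_mono assms mult_nonneg_nonneg prod_nonneg) auto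
  also have "\<dots> = C * (mpow r \<alpha> * (\<Prod>j\<in>UNIV. norm (z $ j) ^ (\<alpha> $ j)) * 
      (mfact \<alpha> powr (- 1 / (2 * \<sigma>)) * mfact \<alpha> powr (- 1 / 2)))"
    by (simp only: mult_ac)
  also have "\<dots> = C * (mpow r \<alpha> * (\<Prod>j\<in>UNIV. norm (z $ j) ^ (\<alpha> $ j)) * mfact \<alpha> powr (- (1 / (2 * \<sigma>) + 1 / 2)))"
    by (simp add: powr_add[symmetric])
  finally show ?thesis
    by (simp add: mpow_def mfact_powr power_mult_distrib prod.distrib)
qed

text \<open>Turns a family of coefficients into a function. The inverse of the projection map is
  known by its coefficients only and is built this way.\<close>

lemma has_coeffs_of_bound:
  fixes c :: "nat ^ 'd \<Rightarrow> complex"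
  assumes "r \<in> pos_vecs" "0 < \<sigma>"
    and c: "\<And>\<alpha>. norm (c \<alpha>) \<le> C * (mpow r \<alpha> * mfact \<alpha> powr (- 1 / (2 * \<sigma>)))"
  shows "has_coeffs (\<lambda>z. \<Sum>\<^sub>\<infinity>\<alpha>. c \<alpha> * e_basis \<alpha> z) c"
  unfolding has_coeffs_def
proof
  fix z :: "complex ^ 'd"
  have "(\<lambda>\<alpha> :: nat ^ 'd. C * (\<Prod>j\<in>UNIV. (r $ j * norm (z $ j)) ^ (\<alpha> $ j) * fact (\<alpha> $ j) powr (- (1 / (2 * \<sigma>) + 1 / 2)))) summable_on UNIV"
    using assms by (intro summable_on_cmult_right summable_prod_vec summable_fact_powr)
      (auto simp: pos_vecs_def less_imp_le)
  then have "(\<lambda>\<alpha>. norm (c \<alpha> * e_basis \<alpha> z)) summable_on UNIV"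
    by (rule Infinite_Sum.abs_summable_on_comparison_test') (rule norm_coeff_term_le[OF c])
  then show "((\<lambda>\<alpha>. c \<alpha> * e_basis \<alpha> z) has_sum (\<Sum>\<^sub>\<infinity>\<alpha>. c \<alpha> * e_basis \<alpha> z)) UNIV"
    by (simp add: has_sum_infsum abs_summable_summable)
qed

text \<open>The majorant factors into one-variable series with p = 1 / s, and \<sigma> \<le> 1
  ensures p \<ge> 1. The exponent p u^(1/p) at u = r |z| is (r^s / s) |z|^s; the radius is kept
  explicit so that it can be inverted.\<close>

lemma growth_of_coeffs:
  fixes F :: "complex ^ 'd \<Rightarrow> complex"
  assumes F: "has_coeffs F c" and r: "r \<in> pos_vecs" and \<sigma>: "0 < \<sigma>" "\<sigma> \<le> 1" and "0 \<le> C"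
    and c: "\<And>\<alpha>. norm (c \<alpha>) \<le> C * (mpow r \<alpha> * mfact \<alpha> powr (- 1 / (2 * \<sigma>)))"
  defines "s \<equiv> 2 * \<sigma> / (\<sigma> + 1)"
  shows "norm (F z) \<le> C * exp (\<Sum>j\<in>UNIV. (r $ j powr s / s) * norm (z $ j) powr s)"
proof -
  define p where "p = 1 / (2 * \<sigma>) + 1 / 2"
  have ps: "p = 1 / s" "1 / p = s"
    using \<sigma> by (auto simp: p_def s_def field_simps)
  have p1: "1 \<le> p"
    using \<sigma> by (simp add: p_def field_simps)
  define u where "u j = r $ j * norm (z $ j)" for j
  have u0: "0 \<le> u j" for j
    using r by (simp add: u_def pos_vecs_def less_imp_le)
  let ?g = "\<lambda>\<alpha> :: nat ^ 'd. \<Prod>j\<in>UNIV. u j ^ (\<alpha> $ j) * fact (\<alpha> $ j) powr (- p)"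
  have g: "(?g has_sum (\<Prod>j\<in>UNIV. \<Sum>n. u j ^ n * fact n powr (- p))) UNIV"
    using fact_powr_le_exp(1)[OF p1 u0] u0 by (intro has_sum_prod_vec) (auto simp: sums_iff)
  have le: "norm (c \<alpha> * e_basis \<alpha> z) \<le> C * ?g \<alpha>" for \<alpha>
    unfolding u_def p_def by (rule norm_coeff_term_le[OF c])
  have 1: "((\<lambda>\<alpha>. C * ?g \<alpha>) has_sum (C * (\<Prod>j\<in>UNIV. \<Sum>n. u j ^ n * fact n powr (- p)))) UNIV"
    by (intro has_sum_cmult_right g)
  have 2: "((\<lambda>\<alpha>. c \<alpha> * e_basis \<alpha> z) has_sum F z) UNIV"
    using F by (simp add: has_coeffs_def)
  have "norm (F z) \<le> C * (\<Prod>j\<in>UNIV. \<Sum>n. u j ^ n * fact n powr (- p))"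
    by (rule norm_has_sum_le[OF 2 1]) (rule le)
  also have "\<dots> \<le> C * (\<Prod>j\<in>UNIV. exp (p * u j powr (1 / p)))"
    using fact_powr_le_exp[OF p1 u0] u0
    by (intro mult_left_mono prod_mono \<open>0 \<le> C\<close>) (auto intro!: suminf_nonneg)
  also have "(\<Prod>j\<in>UNIV. exp (p * u j powr (1 / p))) = exp (\<Sum>j\<in>UNIV. p * u j powr (1 / p))"
    by (simp add: exp_sum)
  also have "(\<Sum>j\<in>UNIV. p * u j powr (1 / p)) = (\<Sum>j\<in>UNIV. (r $ j powr s / s) * norm (z $ j) powr s)"
    using r unfolding ps u_def by (intro sum.cong) (auto simp: pos_vecs_def less_imp_le powr_mult)
  finally show ?thesis .
qed

section \<open>From growth to coefficient decay\<close>

text \<open>Chain rule along an affine complex line: complex homogeneity of \<open>F'\<close> makes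
  the derivative of the slice multiplication by \<open>F' (axis j 1)\<close>.\<close>

lemma entire_imp_holomorphic_slice:
  assumes "entire F"
  shows "(\<lambda>t. F (vupd z j t)) holomorphic_on UNIV"
proof -
  have "\<exists>D. ((\<lambda>t. F (vupd z j t)) has_field_derivative D) (at t)" for t
  proof -
    obtain F' where F': "(F has_derivative F') (at (vupd z j t))" "\<And>c v. F' (c *s v) = c * F' v"
      using assms unfolding entire_def by blast
    have "linear (axis j :: complex \<Rightarrow> complex ^ 'a)"
      by (rule linearI) (auto simp: axis_def vec_eq_iff)
    then have "bounded_linear (axis j :: complex \<Rightarrow> complex ^ 'a)"
      by (simp add: linear_conv_bounded_linear)
    then have "((\<lambda>t. vupd z j 0 + axis j t) has_derivative (\<lambda>h. 0 + axis j h)) (at t)"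
      by (intro has_derivative_add has_derivative_const bounded_linear_imp_has_derivative)
    moreover have "(\<lambda>t. vupd z j 0 + axis j t) = vupd z j"
      by (auto simp: vec_eq_iff axis_def)
    ultimately have "(vupd z j has_derivative axis j) (at t)"
      by simp
    then have "((\<lambda>t. F (vupd z j t)) has_derivative (\<lambda>h. F' (axis j h))) (at t)"
      using diff_chain_at[of "vupd z j" "axis j" t F F'] F'(1) by (simp add: o_def)
    moreover have lin: "F' (axis j h) = F' (axis j 1) * h" for h
    proof -
      have "axis j h = h *s axis j (1 :: complex)"
        by (simp add: vec_eq_iff axis_def)
      then show ?thesis by (simp add: F'(2))
    qed
    moreover have "(\<lambda>h. F' (axis j h)) = (*) (F' (axis j 1))"
      by (rule ext) (rule lin)
    ultimately show ?thesis
      unfolding has_field_derivative_def by metis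
  qed
  then show ?thesis
    unfolding holomorphic_on_open[OF open_UNIV] by blast
qed

lemma fact_le_power_Suc: "fact n \<le> (real n + 1) ^ n"
proof -
  have "fact n \<le> (of_nat (n ^ n) :: real)"
    by (rule fact_le_power)
  also have "\<dots> \<le> (real n + 1) ^ n"
    by (simp add: power_mono)
  finally show ?thesis .
qed

text \<open>The radius is chosen so that r \<rho>^s = n + 1. Then the exponential is e * e^n, a
  constant times a geometric factor, and n! \<le> (n + 1)^n shows that \<open>\<rho> ^ n\<close>
  carries the required power of the factorial. Using n + 1 instead of n keeps the radius positive
  for n = 0 and loses only geometric factors.\<close>

lemma cauchy_radius:
  fixes r s :: real
  assumes "0 < r" "0 < s"
  shows "\<exists>\<rho>>0. exp (r * \<rho> powr s) \<le> exp 1 * ((exp 1 * r powr (1 / s)) ^ n * fact n powr (- (1 / s))) * \<rho> ^ n"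
proof (intro exI conjI)
  define \<rho> where "\<rho> = ((real n + 1) / r) powr (1 / s)"
  show "0 < \<rho>"
    using assms by (simp add: \<rho>_def)
  have \<rho>s: "r * \<rho> powr s = real n + 1"
    using assms by (simp add: \<rho>_def powr_powr)
  have "r powr (1 / s) * \<rho> = (r * ((real n + 1) / r)) powr (1 / s)"
    unfolding \<rho>_def using assms by (subst powr_mult) auto
  then have "r powr (1 / s) * \<rho> = (real n + 1) powr (1 / s)"
    using assms by simp
  then have "(r powr (1 / s)) ^ n * \<rho> ^ n = ((real n + 1) powr (1 / s)) ^ n"
    by (simp only: flip: power_mult_distrib)
  also have "\<dots> = ((real n + 1) ^ n) powr (1 / s)"
    by (simp add: powr_powr mult.commute flip: powr_realpow)
  also have "\<dots> \<ge> fact n powr (1 / s)"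
    using assms by (intro powr_mono2 fact_le_power_Suc) auto
  finally have "fact n powr (1 / s) * fact n powr (- (1 / s)) \<le>
      (r powr (1 / s)) ^ n * \<rho> ^ n * fact n powr (- (1 / s))"
    by (intro mult_right_mono) auto
  then have le: "1 \<le> (r powr (1 / s)) ^ n * \<rho> ^ n * fact n powr (- (1 / s))"
    by (simp only: powr_add[symmetric]) simp
  have "exp (r * \<rho> powr s) = exp 1 * exp 1 ^ n"
    unfolding \<rho>s by (simp add: exp_add flip: exp_of_nat_mult)
  also have "\<dots> \<le> exp 1 * exp 1 ^ n * ((r powr (1 / s)) ^ n * \<rho> ^ n * fact n powr (- (1 / s)))"
    using mult_left_mono[OF le, of "exp 1 * exp 1 ^ n"] by simp
  also have "\<dots> = exp 1 * ((exp 1 * r powr (1 / s)) ^ n * fact n powr (- (1 / s))) * \<rho> ^ n"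
    unfolding power_mult_distrib by (simp only: mult_ac)
  finally show "exp (r * \<rho> powr s) \<le> exp 1 * ((exp 1 * r powr (1 / s)) ^ n * fact n powr (- (1 / s))) * \<rho> ^ n" .
qed

text \<open>Expansion with majorants exp (r x^s) and the Cauchy radii above. Each coordinate
  contributes one constant factor e, hence the power \<open>CARD('d)\<close>; the new radius e
  r^(1/s) is stated explicitly because it has to be inverted for the projective limit.\<close>

lemma coeffs_of_growth:
  fixes F :: "complex ^ 'd \<Rightarrow> complex"
  assumes F: "entire F" and r: "r \<in> pos_vecs" and \<sigma>: "0 < \<sigma>" and "0 < C"
    and bd: "\<And>z. norm (F z) \<le> C * exp (\<Sum>j\<in>UNIV. r $ j * norm (z $ j) powr s)"
    and s: "s = 2 * \<sigma> / (\<sigma> + 1)"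
  obtains c where "has_coeffs F c"
    "\<And>\<alpha>. norm (c \<alpha>) \<le> C * exp 1 ^ CARD('d) *
      (mpow (\<chi> j. exp 1 * r $ j powr (1 / s)) \<alpha> * mfact \<alpha> powr (- 1 / (2 * \<sigma>)))"
proof -
  have s0: "0 < s" and inv: "1 / s = 1 / (2 * \<sigma>) + 1 / 2"
    using \<sigma> by (auto simp: s field_simps)
  have r0: "0 < r $ j" for j
    using r by (simp add: pos_vecs_def)
  define R where "R = (\<chi> j. exp 1 * r $ j powr (1 / s))"
  have R0: "0 < R $ j" for j
    by (simp add: R_def r0 less_imp_neq[THEN not_sym])
  define b where "b j n = exp 1 * (R $ j ^ n * fact n powr (- (1 / s)))" for j n
  obtain a :: "nat ^ 'd \<Rightarrow> complex" where
    a: "\<And>\<alpha>. norm (a \<alpha>) \<le> C * (\<Prod>j\<in>UNIV. b j (\<alpha> $ j))" and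
    aF: "\<And>z. ((\<lambda>\<alpha>. a \<alpha> * mpow z \<alpha>) has_sum F z) UNIV"
  proof (rule taylor_expansion[of F C "\<lambda>j x. exp (r $ j * x powr s)" b])
    show "(\<lambda>t. F (vupd z j t)) holomorphic_on UNIV" for z j
      by (rule entire_imp_holomorphic_slice[OF F])
    show "norm (F z) \<le> C * (\<Prod>j\<in>UNIV. exp (r $ j * norm (z $ j) powr s))" for z
      using bd[of z] by (simp add: exp_sum)
    show "\<exists>\<rho>>0. exp (r $ j * \<rho> powr s) \<le> b j n * \<rho> ^ n" for j n
      unfolding b_def R_def vec_lambda_beta by (rule cauchy_radius[OF r0 s0])
    show "summable (\<lambda>n. b j n * x ^ n)" if "0 \<le> x" for j x
    proof -
      have "summable (\<lambda>n. exp 1 * ((R $ j * x) ^ n * fact n powr (- (1 / s))))"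
        using that R0[of j] \<sigma> by (intro summable_mult summable_fact_powr) (auto simp: inv)
      then show ?thesis
        by (simp add: b_def power_mult_distrib mult_ac)
    qed
    show "exp (r $ j * x powr s) \<le> exp (r $ j * y powr s)" if "0 \<le> x" "x \<le> y" for j x y
      using that s0 r0[of j] by (simp add: powr_mono2)
  qed (use \<open>0 < C\<close> in auto)
  \<comment> \<open>Passing from monomials to \<open>e_basis\<close> costs the square root of
    \<alpha>!, which lowers the decay exponent from 1 / s to 1 / (2 \<sigma>).\<close>
  define c where "c \<alpha> = a \<alpha> * of_real (sqrt (mfact \<alpha>))" for \<alpha>
  have "c \<alpha> * e_basis \<alpha> z = a \<alpha> * mpow z \<alpha>" for \<alpha> z
    using mfact_pos[of \<alpha>] by (simp add: c_def e_basis_def)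
  then have "has_coeffs F c"
    using aF by (simp add: has_coeffs_def)
  moreover have "norm (c \<alpha>) \<le> C * exp 1 ^ CARD('d) * (mpow R \<alpha> * mfact \<alpha> powr (- 1 / (2 * \<sigma>)))" for \<alpha>
  proof -
    have "norm (c \<alpha>) = norm (a \<alpha>) * mfact \<alpha> powr (1 / 2)"
      using mfact_pos[of \<alpha>] by (simp add: c_def norm_mult powr_half_sqrt)
    also have "\<dots> \<le> C * (\<Prod>j\<in>UNIV. b j (\<alpha> $ j)) * mfact \<alpha> powr (1 / 2)"
      by (intro mult_right_mono a) auto
    also have "(\<Prod>j\<in>UNIV. b j (\<alpha> $ j)) = exp 1 ^ CARD('d) * (mpow R \<alpha> * mfact \<alpha> powr (- (1 / s)))"
      by (simp add: b_def prod.distrib mpow_def mfact_powr)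
    also have "C * (exp 1 ^ CARD('d) * (mpow R \<alpha> * mfact \<alpha> powr (- (1 / s)))) * mfact \<alpha> powr (1 / 2) =
        C * exp 1 ^ CARD('d) * (mpow R \<alpha> * (mfact \<alpha> powr (- (1 / s)) * mfact \<alpha> powr (1 / 2)))"
      by (simp only: mult_ac)
    also have "mfact \<alpha> powr (- (1 / s)) * mfact \<alpha> powr (1 / 2) = mfact \<alpha> powr (- 1 / (2 * \<sigma>))"
      unfolding powr_add[symmetric] inv by simp
    finally show ?thesis .
  qed
  ultimately show thesis
    unfolding R_def by (rule that)
qed

section \<open>Invariance of Lebesgue measure under rotations\<close>

lemma nn_integral_lborel_translate:
  fixes f :: "'a::euclidean_space \<Rightarrow> ennreal"
  assumes [measurable]: "f \<in> borel_measurable borel"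
  shows "(\<integral>\<^sup>+x. f (x + c) \<partial>lborel) = (\<integral>\<^sup>+x. f x \<partial>lborel)"
proof -
  have "(\<integral>\<^sup>+x. f x \<partial>lborel) = (\<integral>\<^sup>+x. f x \<partial>distr lborel borel ((+) c))"
    by (simp add: lborel_distr_plus)
  also have "\<dots> = (\<integral>\<^sup>+x. f (x + c) \<partial>lborel)"
    by (subst nn_integral_distr) (auto simp: add.commute)
  finally show ?thesis ..
qed

lemma nn_integral_lborel_reflect:
  fixes f :: "'a::euclidean_space \<Rightarrow> ennreal"
  assumes [measurable]: "f \<in> borel_measurable borel"
  shows "(\<integral>\<^sup>+x. f (c - x) \<partial>lborel) = (\<integral>\<^sup>+x. f x \<partial>lborel)"
proof -
  have "(\<integral>\<^sup>+x. f x \<partial>lborel) = (\<integral>\<^sup>+x. f x \<partial>distr lborel borel (\<lambda>x. c + (- 1) *\<^sub>R x))"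
    by (subst lborel_affine[of "- 1" c]) (auto simp: nn_integral_density density_1)
  also have "\<dots> = (\<integral>\<^sup>+x. f (c - x) \<partial>lborel)"
    by (subst nn_integral_distr) auto
  finally show ?thesis ..
qed

text \<open>Uniqueness of Haar measure, made explicit: both \<open>\<mu>(A) \<lambda>(B)\<close> and \<open>\<lambda>(A) \<mu>(B)\<close> equal
  \<open>\<integral>\<integral> 1\<^sub>A(R x) 1\<^sub>B(y + R x)\<close>, where \<open>\<mu>\<close> is the image of Lebesgue measure \<open>\<lambda>\<close> under \<open>R\<close>,
  and the two measures agree on the unit ball \<open>B\<close>.\<close>

lemma lborel_distr_linear_isometry:
  fixes R :: "'a::euclidean_space \<Rightarrow> 'a"
  assumes R: "linear R" "\<And>x. norm (R x) = norm x" "\<And>x. R (R' x) = x"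
  shows "distr lborel borel R = lborel"
proof (rule measure_eqI)
  have [measurable]: "R \<in> borel_measurable borel"
    using R(1) by (intro borel_measurable_continuous_onI linear_continuous_on linear_conv_bounded_linear[THEN iffD1])
  fix A assume "A \<in> sets (distr lborel borel R)"
  then have [measurable]: "A \<in> sets borel" by simp
  define B where "B = (ball 0 1 :: 'a set)"
  have [measurable]: "B \<in> sets borel" by (simp add: B_def)
  have RB: "indicator B (R x) = (indicator B x :: ennreal)" for x
    by (simp add: B_def indicator_def R(2))
  have B: "emeasure lborel B \<noteq> 0" "emeasure lborel B \<noteq> \<infinity>"
  proof -
    show "emeasure lborel B \<noteq> \<infinity>"
      using emeasure_bounded_finite[of "ball (0 :: 'a) 1"] by (simp add: B_def top.not_eq_extremum)
    have "\<not> negligible B"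
      unfolding B_def by (rule open_not_negligible) auto
    then show "emeasure lborel B \<noteq> 0"
      by (auto simp: negligible_iff_null_sets null_sets_def)
  qed
  have "emeasure (distr lborel borel R) A * emeasure lborel B
      = (\<integral>\<^sup>+x. indicator A (R x) * (\<integral>\<^sup>+y. indicator B y \<partial>lborel) \<partial>lborel)"
    by (simp add: nn_integral_multc emeasure_distr nn_integral_indicator[symmetric] nn_integral_distr
        del: nn_integral_indicator)
  also have "\<dots> = (\<integral>\<^sup>+x. indicator A (R x) * (\<integral>\<^sup>+y. indicator B (y + R x) \<partial>lborel) \<partial>lborel)"
    by (subst nn_integral_lborel_translate) auto
  also have "\<dots> = (\<integral>\<^sup>+x. \<integral>\<^sup>+y. indicator A (R x) * indicator B (y + R x) \<partial>lborel \<partial>lborel)"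
    by (simp add: nn_integral_cmult)
  also have "\<dots> = (\<integral>\<^sup>+y. \<integral>\<^sup>+x. indicator A (R x) * indicator B (y + R x) \<partial>lborel \<partial>lborel)"
    by (rule lborel_pair.Fubini') measurable
  also have "\<dots> = (\<integral>\<^sup>+y. \<integral>\<^sup>+x. indicator A (R x - y) * indicator B (R x) \<partial>lborel \<partial>lborel)"
  proof (rule nn_integral_cong)
    fix y
    \<comment> \<open>Translating \<open>x\<close> by the preimage \<open>R' (- y)\<close> of
      \<open>- y\<close> moves \<open>R x\<close> to \<open>R x - y\<close>, so the shift passes
      from \<open>B\<close> to \<open>A\<close>.\<close>
    have "(\<integral>\<^sup>+x. indicator A (R x) * indicator B (y + R x) \<partial>lborel)
        = (\<integral>\<^sup>+x. indicator A (R (x + R' (- y))) * indicator B (y + R (x + R' (- y))) \<partial>lborel)"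
      by (rule nn_integral_lborel_translate[symmetric]) measurable
    then show "(\<integral>\<^sup>+x. indicator A (R x) * indicator B (y + R x) \<partial>lborel)
        = (\<integral>\<^sup>+x. indicator A (R x - y) * (indicator B (R x) :: ennreal) \<partial>lborel)"
      by (simp add: linear_add[OF R(1)] R(3))
  qed
  also have "\<dots> = (\<integral>\<^sup>+x. \<integral>\<^sup>+y. indicator A (R x - y) * indicator B (R x) \<partial>lborel \<partial>lborel)"
    by (rule lborel_pair.Fubini') measurable
  also have "\<dots> = (\<integral>\<^sup>+x. (\<integral>\<^sup>+y. indicator A (R x - y) \<partial>lborel) * indicator B x \<partial>lborel)"
    by (simp add: nn_integral_multc RB)
  also have "\<dots> = (\<integral>\<^sup>+x. (\<integral>\<^sup>+y. indicator A y \<partial>lborel) * indicator B x \<partial>lborel)"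
    by (subst nn_integral_lborel_reflect) auto
  also have "\<dots> = emeasure lborel A * emeasure lborel B"
    by (simp add: nn_integral_cmult)
  finally show "emeasure (distr lborel borel R) A = emeasure lborel A"
    using B by (simp add: ennreal_mult_cancel_left mult.commute[of _ "emeasure lborel B"] flip: infinity_ennreal_def)
qed simp

definition rot :: "'d \<Rightarrow> complex \<Rightarrow> complex ^ 'd \<Rightarrow> complex ^ 'd"
  where "rot j u z = (\<chi> i. if i = j then u * z $ i else z $ i)"

lemma norm_rot_nth: "norm u = 1 \<Longrightarrow> norm (rot j u z $ i) = norm (z $ i)"
  by (simp add: rot_def norm_mult)

lemma norm_cong_nth: "(\<And>i. norm (z $ i) = norm (w $ i)) \<Longrightarrow> norm z = norm w"
  by (simp add: norm_vec_def)

lemma linear_rot: "linear (rot j u)"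
  by (rule linearI) (auto simp: rot_def vec_eq_iff algebra_simps)

lemma lborel_distr_rot:
  assumes "norm u = 1"
  shows "distr lborel borel (rot j u) = lborel"
proof (rule lborel_distr_linear_isometry[where R' = "rot j (inverse u)"])
  show "norm (rot j u x) = norm x" for x
    by (rule norm_cong_nth) (rule norm_rot_nth[OF assms])
  show "rot j u (rot j (inverse u) x) = x" for x
  proof -
    have "u \<noteq> 0" using assms by auto
    then show ?thesis by (auto simp: rot_def vec_eq_iff)
  qed
qed (rule linear_rot)

section \<open>Integration against a radial weight\<close>

text \<open>A compact set that contains the closure of \<open>polydisc r\<close>; this inclusion
  takes the place of computing that closure.\<close>

definition polycyl :: "real ^ 'd \<Rightarrow> (complex ^ 'd) set"
  where "polycyl r = {z. \<forall>j. norm (z $ j) \<le> r $ j}"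

lemma closed_polycyl: "closed (polycyl r)"
  unfolding polycyl_def Collect_all_eq
  by (intro closed_INT ballI closed_Collect_le continuous_intros)

lemma open_polydisc: "open (polydisc r)"
proof -
  have "polydisc r = (\<Inter>j\<in>UNIV. {z. norm (z $ j) < r $ j})"
    by (auto simp: polydisc_def)
  also have "open \<dots>"
    by (intro open_INT finite ballI open_Collect_less continuous_intros)
  finally show ?thesis .
qed

lemma bounded_polycyl: "bounded (polycyl r)"
proof -
  have "norm z \<le> (\<Sum>j\<in>UNIV. \<bar>r $ j\<bar>)" if "z \<in> polycyl r" for z
  proof -
    have "norm z \<le> (\<Sum>j\<in>UNIV. \<bar>norm (z $ j)\<bar>)"
      unfolding norm_vec_def by (rule L2_set_le_sum_abs)
    also have "\<dots> \<le> (\<Sum>j\<in>UNIV. \<bar>r $ j\<bar>)"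
      using that by (intro sum_mono) (fastforce simp: polycyl_def intro: order_trans)
    finally show ?thesis .
  qed
  then show ?thesis unfolding bounded_iff by blast
qed

lemma compact_polycyl: "compact (polycyl r)"
  by (simp add: compact_eq_bounded_closed bounded_polycyl closed_polycyl)

lemma polydisc_subset_polycyl: "closure (polydisc r) \<subseteq> polycyl r"
  by (rule closure_minimal[OF _ closed_polycyl]) (auto simp: polydisc_def polycyl_def less_imp_le)

lemma continuous_on_e_basis: "continuous_on A (e_basis \<alpha>)"
  unfolding e_basis_def mpow_def using mfact_pos[of \<alpha>]
  by (intro continuous_intros) auto

text \<open>The corner of the polydisc, at which the modulus of each \<open>e_basis \<alpha>\<close>
  bounds its values on \<open>polycyl r\<close>.\<close>

definition of_real_vec :: "real ^ 'd \<Rightarrow> complex ^ 'd"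
  where "of_real_vec r = (\<chi> j. of_real (r $ j))"

lemma norm_e_basis_le:
  assumes "z \<in> polycyl r"
  shows "norm (e_basis \<alpha> z) \<le> norm (e_basis \<alpha> (of_real_vec r))"
proof -
  have "norm (z $ j) \<le> norm (of_real_vec r $ j)" for j
    using assms by (auto simp: polycyl_def of_real_vec_def intro: order_trans)
  then show ?thesis
    unfolding norm_e_basis by (intro mult_right_mono prod_mono conjI power_mono) auto
qed

text \<open>Weierstrass M-test whose majorant is the series itself at the corner: unconditional
  convergence there is absolute convergence, since the terms are complex numbers.\<close>

lemma has_coeffs_uniform_limit:
  assumes "has_coeffs F c"
  shows "uniform_limit (polycyl r) (\<lambda>A z. \<Sum>\<alpha>\<in>A. c \<alpha> * e_basis \<alpha> z) F (finite_subsets_at_top UNIV)"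
proof (rule Weierstrass_m_test_general')
  show "((\<lambda>\<alpha>. c \<alpha> * e_basis \<alpha> z) has_sum F z) UNIV" for z
    using assms by (simp add: has_coeffs_def)
  have "(\<lambda>\<alpha>. c \<alpha> * e_basis \<alpha> (of_real_vec r)) summable_on UNIV"
    using assms by (auto simp: has_coeffs_def summable_on_def)
  then show "(\<lambda>\<alpha>. norm (c \<alpha> * e_basis \<alpha> (of_real_vec r))) summable_on UNIV"
    by (rule summable_on_iff_abs_summable_on_complex[THEN iffD1])
  show "norm (c \<alpha> * e_basis \<alpha> z) \<le> norm (c \<alpha> * e_basis \<alpha> (of_real_vec r))" if "z \<in> polycyl r" for \<alpha> z
    unfolding norm_mult by (intro mult_left_mono norm_e_basis_le that) auto
qed

lemma has_coeffs_continuous: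
  assumes "has_coeffs F c"
  shows "continuous_on UNIV F"
  unfolding continuous_on_eq_continuous_at[OF open_UNIV]
proof
  fix z :: "complex ^ 'a"
  define r :: "real ^ 'a" where "r = (\<chi> j. norm (z $ j) + 1)"
  have "continuous_on (polycyl r) F"
    by (rule uniform_limit_theorem[OF _ has_coeffs_uniform_limit[OF assms]])
      (auto intro!: always_eventually continuous_intros continuous_on_e_basis)
  then have "continuous_on (polydisc r) F"
    by (rule continuous_on_subset) (use polydisc_subset_polycyl[of r] closure_subset[of "polydisc r"] in blast)
  moreover have "z \<in> polydisc r"
    by (auto simp: polydisc_def r_def)
  ultimately show "isCont F z"
    using open_polydisc continuous_on_eq_continuous_at by blast
qed

text \<open>Wide enough to contain both a cutoff times the Gaussian and the indicator of a closed
  polydisc; the latter is the test weight that proves uniqueness of coefficients.\<close>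

definition radial_weight :: "real ^ 'd \<Rightarrow> real ^ 'd \<Rightarrow> (complex ^ 'd \<Rightarrow> real) \<Rightarrow> bool"
  where "radial_weight t1 t2 \<omega> \<longleftrightarrow> t1 \<in> pos_vecs \<and> t2 \<in> pos_vecs \<and>
    \<omega> \<in> borel_measurable lebesgue \<and>
    (\<exists>C. AE z in lebesgue. \<bar>\<omega> z\<bar> \<le> C) \<and>
    (AE z in lebesgue. 0 \<le> \<omega> z) \<and>
    (AE z in lebesgue. z \<notin> polycyl t2 \<longrightarrow> \<omega> z = 0) \<and>
    (\<exists>f0. AE z in lebesgue. \<omega> z = f0 (\<chi> j. norm (z $ j))) \<and>
    (\<exists>c>0. AE z in lebesgue. z \<in> polydisc t1 \<longrightarrow> c \<le> \<omega> z)"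

text \<open>The squared norm of \<open>e_basis \<alpha>\<close> in the weighted space; up to the
  normalisation by a power of pi it is the eigenvalue of the projection map on
  \<open>e_basis \<alpha>\<close>.\<close>

definition moment :: "(complex ^ 'd \<Rightarrow> real) \<Rightarrow> nat ^ 'd \<Rightarrow> real"
  where "moment \<omega> \<alpha> = (LINT w|lebesgue. (norm (e_basis \<alpha> w))\<^sup>2 * \<omega> w)"

lemma continuous_borel_lebesgue:
  fixes f :: "'a::euclidean_space \<Rightarrow> 'b::{second_countable_topology, metric_space}"
  assumes "continuous_on UNIV f"
  shows "f \<in> borel_measurable lebesgue"
  by (rule measurable_completion) (simp add: borel_measurable_continuous_onI[OF assms])

lemma borel_measurable_complex_of_real:
  assumes [measurable]: "f \<in> borel_measurable M"
  shows "(\<lambda>x. complex_of_real (f x)) \<in> borel_measurable M"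
  by measurable

lemma integrable_weighted:
  fixes f :: "complex ^ 'd \<Rightarrow> complex"
  assumes \<omega>: "radial_weight t1 t2 \<omega>" and f: "continuous_on UNIV f"
  shows "integrable lebesgue (\<lambda>w. f w * of_real (\<omega> w))"
proof -
  obtain C where C: "AE z in lebesgue. \<bar>\<omega> z\<bar> \<le> C"
    using \<omega> unfolding radial_weight_def by blast
  have "compact (f ` polycyl t2)"
    by (intro compact_continuous_image compact_polycyl continuous_on_subset[OF f]) auto
  then obtain B where B: "\<And>w. w \<in> polycyl t2 \<Longrightarrow> norm (f w) \<le> B"
    by (metis bounded_iff compact_imp_bounded image_eqI)
  have fm: "f \<in> borel_measurable lebesgue"
    by (rule continuous_borel_lebesgue[OF f])
  have om: "\<omega> \<in> borel_measurable lebesgue"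
    using \<omega> by (simp add: radial_weight_def)
  show ?thesis
  proof (rule integrableI_bounded_set[where A = "polycyl t2" and B = "B * C"])
    show "polycyl t2 \<in> sets lebesgue"
      using borel_closed[OF closed_polycyl[of t2]] by simp
    show "(\<lambda>w. f w * complex_of_real (\<omega> w)) \<in> borel_measurable lebesgue"
      using fm om by (intro borel_measurable_times borel_measurable_complex_of_real)
    show "emeasure lebesgue (polycyl t2) < \<infinity>"
      using emeasure_bounded_finite[OF bounded_polycyl[of t2]] closed_polycyl[of t2]
      by (simp add: borel_closed)
    show "AE x in lebesgue. x \<in> polycyl t2 \<longrightarrow> norm (f x * complex_of_real (\<omega> x)) \<le> B * C"
      using C
    proof eventually_elim
      case (elim x)
      then show ?case
        by (auto simp: norm_mult intro!: mult_mono B order_trans[OF norm_ge_zero B])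
    qed
    show "AE x in lebesgue. x \<notin> polycyl t2 \<longrightarrow> f x * complex_of_real (\<omega> x) = 0"
      using \<omega> unfolding radial_weight_def by auto
  qed
qed

text \<open>Sum and integral may be exchanged because the partial sums converge uniformly on the
  compact set that carries the weight, and \<open>g\<close> times the weight is integrable.\<close>

lemma has_sum_weighted:
  fixes F g :: "complex ^ 'd \<Rightarrow> complex"
  assumes \<omega>: "radial_weight t1 t2 \<omega>" and F: "has_coeffs F c" and g: "continuous_on UNIV g"
  shows "((\<lambda>\<alpha>. c \<alpha> * (LINT w|lebesgue. e_basis \<alpha> w * g w * of_real (\<omega> w))) has_sum
    (LINT w|lebesgue. F w * g w * of_real (\<omega> w))) UNIV"
proof -
  have Fc: "continuous_on UNIV F"
    by (rule has_coeffs_continuous[OF F])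
  have int: "integrable lebesgue (\<lambda>w. h w * g w * of_real (\<omega> w))" if "continuous_on UNIV h" for h
    by (intro integrable_weighted[OF \<omega>] continuous_intros that g)
  define N where "N = (LINT w|lebesgue. norm (g w * of_real (\<omega> w)))"
  have gi: "integrable lebesgue (\<lambda>w. norm (g w * of_real (\<omega> w)))"
    by (intro integrable_norm integrable_weighted[OF \<omega> g])
  have N0: "0 \<le> N"
    unfolding N_def by (intro integral_nonneg_AE) auto
  have supp: "AE w in lebesgue. w \<notin> polycyl t2 \<longrightarrow> \<omega> w = 0"
    using \<omega> by (simp add: radial_weight_def)
  have "((\<lambda>A. \<Sum>\<alpha>\<in>A. c \<alpha> * (LINT w|lebesgue. e_basis \<alpha> w * g w * of_real (\<omega> w))) \<longlongrightarrow>
    (LINT w|lebesgue. F w * g w * of_real (\<omega> w))) (finite_subsets_at_top UNIV)"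
  proof (rule tendstoI)
    fix \<epsilon> :: real assume "0 < \<epsilon>"
    \<comment> \<open>The denominator N + 1 stays positive even when the integral \<open>N\<close>
      vanishes.\<close>
    define \<delta> where "\<delta> = \<epsilon> / (N + 1)"
    have \<delta>: "0 < \<delta>" "\<delta> * N < \<epsilon>"
      using N0 \<open>0 < \<epsilon>\<close> by (auto simp: \<delta>_def field_simps)
    have "\<forall>\<^sub>F A in finite_subsets_at_top UNIV. \<forall>w\<in>polycyl t2. dist (\<Sum>\<alpha>\<in>A. c \<alpha> * e_basis \<alpha> w) (F w) < \<delta>"
      using has_coeffs_uniform_limit[OF F] \<delta>(1) by (rule uniform_limitD)
    moreover have "\<forall>\<^sub>F A in finite_subsets_at_top UNIV. finite (A :: (nat ^ 'd) set)"
      by (rule eventually_finite_subsets_at_top_weakI)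
    ultimately show "\<forall>\<^sub>F A in finite_subsets_at_top UNIV.
        dist (\<Sum>\<alpha>\<in>A. c \<alpha> * (LINT w|lebesgue. e_basis \<alpha> w * g w * of_real (\<omega> w)))
          (LINT w|lebesgue. F w * g w * of_real (\<omega> w)) < \<epsilon>"
    proof eventually_elim
      case (elim A)
      define P where "P w = (\<Sum>\<alpha>\<in>A. c \<alpha> * e_basis \<alpha> w)" for w
      have Pc: "continuous_on UNIV P"
        unfolding P_def by (intro continuous_intros continuous_on_e_basis)
      have "(\<Sum>\<alpha>\<in>A. c \<alpha> * (LINT w|lebesgue. e_basis \<alpha> w * g w * of_real (\<omega> w)))
          = (\<Sum>\<alpha>\<in>A. (LINT w|lebesgue. c \<alpha> * (e_basis \<alpha> w * g w * of_real (\<omega> w))))"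
        by simp
      also have "\<dots> = (LINT w|lebesgue. (\<Sum>\<alpha>\<in>A. c \<alpha> * (e_basis \<alpha> w * g w * of_real (\<omega> w))))"
        by (intro Bochner_Integration.integral_sum[symmetric] integrable_mult_right int continuous_on_e_basis)
      also have "\<dots> = (LINT w|lebesgue. P w * g w * of_real (\<omega> w))"
        by (simp add: P_def sum_distrib_right mult.assoc)
      finally have "(\<Sum>\<alpha>\<in>A. c \<alpha> * (LINT w|lebesgue. e_basis \<alpha> w * g w * of_real (\<omega> w)))
          - (LINT w|lebesgue. F w * g w * of_real (\<omega> w))
          = (LINT w|lebesgue. P w * g w * of_real (\<omega> w) - F w * g w * of_real (\<omega> w))"
        using int[OF Pc] int[OF Fc] by simp
      moreover have "norm (LINT w|lebesgue. P w * g w * of_real (\<omega> w) - F w * g w * of_real (\<omega> w)) \<le>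
          (LINT w|lebesgue. \<delta> * norm (g w * of_real (\<omega> w)))"
      proof (rule order_trans[OF integral_norm_bound integral_mono_AE])
        show "integrable lebesgue (\<lambda>w. norm (P w * g w * of_real (\<omega> w) - F w * g w * of_real (\<omega> w)))"
          using int[OF Pc] int[OF Fc] by (intro integrable_norm Bochner_Integration.integrable_diff)
        show "integrable lebesgue (\<lambda>w. \<delta> * norm (g w * of_real (\<omega> w)))"
          by (intro integrable_mult_right gi)
        show "AE w in lebesgue. norm (P w * g w * of_real (\<omega> w) - F w * g w * of_real (\<omega> w))
            \<le> \<delta> * norm (g w * of_real (\<omega> w))"
          using supp
        proof eventually_elim
          case (elim w)
          show ?case
          proof (cases "w \<in> polycyl t2")
            case True
            then have "norm (P w - F w) \<le> \<delta>"
              using \<open>\<forall>w\<in>polycyl t2. _ w\<close> by (auto simp: P_def dist_norm intro: less_imp_le)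
            moreover have "P w * g w * of_real (\<omega> w) - F w * g w * of_real (\<omega> w) = (P w - F w) * (g w * of_real (\<omega> w))"
              by (simp add: algebra_simps)
            ultimately show ?thesis
              by (simp only: norm_mult[of "P w - F w"] mult_right_mono norm_ge_zero)
          qed (use elim in simp)
        qed
      qed
      moreover have "(LINT w|lebesgue. \<delta> * norm (g w * of_real (\<omega> w))) = \<delta> * N"
        unfolding N_def by (rule integral_mult_right_zero)
      ultimately show ?case
        using \<delta>(2) by (simp only: dist_norm)
    qed
  qed
  then show ?thesis
    by (simp add: has_sum_def)
qed

lemma e_basis_rot: "e_basis \<alpha> (rot j u w) = u ^ (\<alpha> $ j) * e_basis \<alpha> w"
proof -
  have "mpow (rot j u w) \<alpha> = (\<Prod>i\<in>UNIV. (if i = j then u ^ (\<alpha> $ j) else 1) * w $ i ^ (\<alpha> $ i))"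
    unfolding mpow_def by (intro prod.cong) (auto simp: rot_def power_mult_distrib)
  also have "\<dots> = u ^ (\<alpha> $ j) * mpow w \<alpha>"
    by (simp add: prod.distrib mpow_def)
  finally show ?thesis by (simp add: e_basis_def)
qed

text \<open>Rotating a coordinate \<open>j\<close> with distinct exponents by the angle pi /
  (\<alpha>_j - \<beta>_j) multiplies the integrand by -1 and preserves measure and weight, so the
  integral equals its own negative.\<close>

lemma e_basis_orthogonal:
  fixes \<omega> :: "complex ^ 'd \<Rightarrow> real"
  assumes \<omega>: "radial_weight t1 t2 \<omega>" and "\<alpha> \<noteq> \<beta>"
  shows "(LINT w|lebesgue. e_basis \<alpha> w * cnj (e_basis \<beta> w) * of_real (\<omega> w)) = 0"
proof -
  from \<open>\<alpha> \<noteq> \<beta>\<close> obtain j where j: "\<alpha> $ j \<noteq> \<beta> $ j"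
    by (auto simp: vec_eq_iff)
  define \<theta> where "\<theta> = pi / (real (\<alpha> $ j) - real (\<beta> $ j))"
  define u where "u = cis \<theta>"
  have u1: "norm u = 1"
    by (simp add: u_def)
  have "u ^ (\<alpha> $ j) * cnj (u ^ (\<beta> $ j)) = cis (real (\<alpha> $ j) * \<theta> + real (\<beta> $ j) * (- \<theta>))"
    by (simp only: u_def complex_cnj_power cis_cnj Complex.DeMoivre cis_mult mult_minus_right)
  also have "real (\<alpha> $ j) * \<theta> + real (\<beta> $ j) * (- \<theta>) = (real (\<alpha> $ j) - real (\<beta> $ j)) * \<theta>"
    by (simp add: algebra_simps)
  also have "cis \<dots> = - 1"
    using j by (simp add: \<theta>_def)
  finally have um: "u ^ (\<alpha> $ j) * cnj (u ^ (\<beta> $ j)) = - 1" .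
  define h where "h w = e_basis \<alpha> w * cnj (e_basis \<beta> w)" for w
  have hc: "continuous_on UNIV h"
    unfolding h_def by (intro continuous_intros continuous_on_e_basis)
  have hm: "h \<in> borel_measurable borel"
    by (rule borel_measurable_continuous_onI[OF hc])
  have hR: "h (rot j u w) = - h w" for w
  proof -
    have "h (rot j u w) = (u ^ (\<alpha> $ j) * cnj (u ^ (\<beta> $ j))) * h w"
      unfolding h_def e_basis_rot complex_cnj_mult by (simp only: mult_ac)
    then show ?thesis unfolding um by simp
  qed
  have om: "\<omega> \<in> borel_measurable lebesgue"
    using \<omega> by (simp add: radial_weight_def)
  \<comment> \<open>Rotation invariance is available for \<open>lborel\<close>, whereas the weight
    is only Lebesgue measurable; a Borel representative bridges the two.\<close>
  then obtain \<omega>' where \<omega>': "\<omega>' \<in> borel_measurable lborel" "AE w in lborel. \<omega> w = \<omega>' w"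
    using completion_ex_borel_measurable_real by blast
  have om': "\<omega>' \<in> borel_measurable lebesgue"
    by (rule measurable_completion) (rule \<omega>'(1))
  obtain f0 where "AE w in lebesgue. \<omega> w = f0 (\<chi> i. norm (w $ i))"
    using \<omega> unfolding radial_weight_def by blast
  then have "AE w in lborel. \<omega> w = f0 (\<chi> i. norm (w $ i))"
    by (simp add: AE_completion_iff)
  with \<omega>'(2) have f0: "AE w in lborel. \<omega>' w = f0 (\<chi> i. norm (w $ i))"
    by eventually_elim simp
  have Rm: "rot j u \<in> borel_measurable borel"
    by (intro borel_measurable_continuous_onI linear_continuous_on linear_conv_bounded_linear[THEN iffD1] linear_rot)
  \<comment> \<open>The radial identity is pulled back along the rotation and compared with itself.
    Only almost-everywhere identities occur, so the arbitrary function \<open>f0\<close> is never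
    integrated.\<close>
  have "AE w in distr lborel borel (rot j u). \<omega>' w = f0 (\<chi> i. norm (w $ i))"
    unfolding lborel_distr_rot[OF u1] by (rule f0)
  then have "AE w in lborel. \<omega>' (rot j u w) = f0 (\<chi> i. norm (rot j u w $ i))"
    by (rule AE_distrD[rotated]) (simp add: Rm)
  with f0 have inv: "AE w in lborel. \<omega>' (rot j u w) = \<omega>' w"
    by eventually_elim (simp add: norm_rot_nth[OF u1])
  have [measurable]: "h \<in> borel_measurable borel" "\<omega>' \<in> borel_measurable borel" "rot j u \<in> borel_measurable borel"
    using hm \<omega>'(1) Rm by auto
  define I where "I = (LINT w|lborel. h w * complex_of_real (\<omega>' w))"
  have "I = (LINT w|distr lborel borel (rot j u). h w * complex_of_real (\<omega>' w))"
    unfolding lborel_distr_rot[OF u1] I_def ..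
  also have "\<dots> = (LINT w|lborel. h (rot j u w) * complex_of_real (\<omega>' (rot j u w)))"
    by (rule integral_distr) auto
  also have "\<dots> = (LINT w|lborel. - (h w * complex_of_real (\<omega>' w)))"
  proof (rule integral_cong_AE)
    show "AE w in lborel. h (rot j u w) * complex_of_real (\<omega>' (rot j u w)) = - (h w * complex_of_real (\<omega>' w))"
      using inv by eventually_elim (simp add: hR)
  qed measurable
  also have "\<dots> = - I"
    by (simp add: I_def)
  finally have "I = 0"
    by (simp add: equation_minus_iff eq_neg_iff_add_eq_0)
  have hl: "h \<in> borel_measurable lebesgue"
    by (rule continuous_borel_lebesgue[OF hc])
  have "(LINT w|lebesgue. h w * of_real (\<omega> w)) = (LINT w|lebesgue. h w * of_real (\<omega>' w))"
  proof (rule integral_cong_AE)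
    show "AE w in lebesgue. h w * complex_of_real (\<omega> w) = h w * complex_of_real (\<omega>' w)"
      using AE_completion[OF \<omega>'(2)] by eventually_elim simp
  qed (use hl om om' in \<open>auto intro!: borel_measurable_times borel_measurable_complex_of_real\<close>)
  also have "\<dots> = I"
    unfolding I_def by (rule integral_completion) measurable
  finally show ?thesis
    using \<open>I = 0\<close> by (simp add: h_def)
qed

lemma moment_complex:
  "(LINT w|lebesgue. e_basis \<alpha> w * cnj (e_basis \<alpha> w) * complex_of_real (\<omega> w)) = of_real (moment \<omega> \<alpha>)"
  unfolding moment_def integral_complex_of_real[symmetric]
  by (rule Bochner_Integration.integral_cong) (simp_all only: of_real_mult complex_norm_square)

lemma integrable_moment:
  fixes \<omega> :: "complex ^ 'd \<Rightarrow> real"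
  assumes "radial_weight t1 t2 \<omega>"
  shows "integrable lebesgue (\<lambda>w. (norm (e_basis \<alpha> w))\<^sup>2 * \<omega> w)"
proof -
  have "integrable lebesgue (\<lambda>w. Re (e_basis \<alpha> w * cnj (e_basis \<alpha> w) * complex_of_real (\<omega> w)))"
    by (intro integrable_Re integrable_weighted[OF assms] continuous_intros continuous_on_e_basis)
  then show ?thesis
    by (simp only: complex_norm_square[symmetric] of_real_mult[symmetric] Re_complex_of_real)
qed

lemma integrable_radial_weight:
  assumes "radial_weight t1 t2 \<omega>"
  shows "integrable lebesgue \<omega>"
  using integrable_Re[OF integrable_weighted[OF assms, of "\<lambda>_. 1"]] by simp

lemma norm_e_basis_sq:
  "(norm (e_basis \<alpha> z))\<^sup>2 = (\<Prod>j\<in>UNIV. ((norm (z $ j))\<^sup>2) ^ (\<alpha> $ j)) / mfact \<alpha>"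
proof -
  have "(mfact \<alpha> powr (- 1 / 2))\<^sup>2 = mfact \<alpha> powr (- 1 / 2 + - 1 / 2)"
    by (simp only: powr_add power2_eq_square)
  also have "\<dots> = 1 / mfact \<alpha>"
    using mfact_pos[of \<alpha>] powr_neg_one[of "mfact \<alpha>"] by simp
  finally show ?thesis
    unfolding norm_e_basis power_mult_distrib prod_power_distrib
    by (simp flip: power_mult add: mult.commute)
qed

text \<open>On the support each squared modulus is at most the square of the outer radius; the rest
  is the total mass of the weight, enlarged by 1 so that the constant is visibly positive.\<close>

lemma moment_le:
  fixes \<omega> :: "complex ^ 'd \<Rightarrow> real"
  assumes \<omega>: "radial_weight t1 t2 \<omega>"
  shows "\<exists>C>0. \<forall>\<alpha>. moment \<omega> \<alpha> \<le> C * (mpow (\<chi> j. (t2 $ j)\<^sup>2) \<alpha> / mfact \<alpha>)"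
proof (intro exI conjI allI)
  let ?C = "(LINT w|lebesgue. \<omega> w) + 1"
  have nn: "AE w in lebesgue. 0 \<le> \<omega> w"
    using \<omega> by (simp add: radial_weight_def)
  then have "0 \<le> (LINT w|lebesgue. \<omega> w)"
    by (rule integral_nonneg_AE)
  then show "0 < ?C" by simp
  fix \<alpha>
  let ?M = "mpow (\<chi> j. (t2 $ j)\<^sup>2) \<alpha> / mfact \<alpha>"
  have M: "0 \<le> ?M"
    using mfact_pos[of \<alpha>] by (auto simp: mpow_def intro!: divide_nonneg_pos prod_nonneg)
  have "moment \<omega> \<alpha> \<le> (LINT w|lebesgue. ?M * \<omega> w)"
    unfolding moment_def
  proof (rule integral_mono_AE)
    have "AE w in lebesgue. w \<notin> polycyl t2 \<longrightarrow> \<omega> w = 0"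
      using \<omega> by (simp add: radial_weight_def)
    with nn show "AE w in lebesgue. (norm (e_basis \<alpha> w))\<^sup>2 * \<omega> w \<le> ?M * \<omega> w"
    proof eventually_elim
      case (elim w)
      show ?case
      proof (cases "w \<in> polycyl t2")
        case True
        then have "(norm (e_basis \<alpha> w))\<^sup>2 \<le> ?M"
          unfolding norm_e_basis_sq mpow_def using mfact_pos[of \<alpha>]
          by (auto simp: polycyl_def intro!: divide_right_mono prod_mono power_mono)
        then show ?thesis
          using elim by (intro mult_right_mono)
      qed (use elim in simp)
    qed
  qed (use integrable_moment[OF \<omega>] integrable_radial_weight[OF \<omega>] in auto)
  also have "\<dots> = ?M * (LINT w|lebesgue. \<omega> w)"
    by (rule integral_mult_right_zero)
  also have "\<dots> \<le> ?C * ?M"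
  proof -
    have "x * y \<le> (y + 1) * x" if "0 \<le> x" for x y :: real
      using that by (simp add: algebra_simps)
    then show ?thesis using M .
  qed
  finally show "moment \<omega> \<alpha> \<le> ?C * ?M" .
qed

text \<open>Only the shell where every modulus lies between half the inner radius and the inner
  radius is kept. There the weight is at least \<open>c\<close> and the squared moduli are bounded
  below, so the positive measure of the shell gives the constant.\<close>

lemma moment_ge:
  fixes \<omega> :: "complex ^ 'd \<Rightarrow> real"
  assumes \<omega>: "radial_weight t1 t2 \<omega>"
  shows "\<exists>C>0. \<forall>\<alpha>. C * (mpow (\<chi> j. (t1 $ j / 2)\<^sup>2) \<alpha> / mfact \<alpha>) \<le> moment \<omega> \<alpha>"
proof -
  have t1: "0 < t1 $ j" for j
    using \<omega> by (simp add: radial_weight_def pos_vecs_def)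
  obtain c where c: "0 < c" "AE w in lebesgue. w \<in> polydisc t1 \<longrightarrow> c \<le> \<omega> w"
    using \<omega> by (auto simp: radial_weight_def)
  have nn: "AE w in lebesgue. 0 \<le> \<omega> w"
    using \<omega> by (simp add: radial_weight_def)
  define A where "A = {w :: complex ^ 'd. \<forall>j. t1 $ j / 2 < norm (w $ j)} \<inter> polydisc t1"
  have "{w :: complex ^ 'd. \<forall>j. t1 $ j / 2 < norm (w $ j)} = (\<Inter>j\<in>UNIV. {w. t1 $ j / 2 < norm (w $ j)})"
    by auto
  also have "open \<dots>"
    by (intro open_INT finite ballI open_Collect_less continuous_intros)
  finally have "open A"
    unfolding A_def using open_polydisc by (intro open_Int)
  then have Am: "A \<in> sets lebesgue"
    by (simp add: borel_open)
  \<comment> \<open>A point of the open shell, which therefore has positive measure.\<close>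
  have "of_real_vec (\<chi> j. 3 / 4 * t1 $ j) \<in> A"
    using t1 by (auto simp: A_def of_real_vec_def polydisc_def norm_mult abs_of_pos)
  then have "\<not> negligible A"
    using open_not_negligible[OF \<open>open A\<close>] by blast
  then have ne: "emeasure lebesgue A \<noteq> 0"
    using Am by (auto simp: negligible_iff_null_sets null_sets_def)
  have bA: "bounded A"
    by (rule bounded_subset[OF bounded_polycyl[of t1]]) (auto simp: A_def polydisc_def polycyl_def less_imp_le)
  then have fin: "emeasure lebesgue A < \<infinity>"
    using emeasure_bounded_finite[OF bA] \<open>open A\<close> by (simp add: borel_open)
  have pos: "0 < measure lebesgue A"
    using ne fin by (simp add: measure_def enn2real_positive_iff zero_less_iff_neq_zero)
  show ?thesis
  proof (intro exI conjI allI)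
    show "0 < c * measure lebesgue A"
      using c pos by simp
    fix \<alpha>
    let ?M = "mpow (\<chi> j. (t1 $ j / 2)\<^sup>2) \<alpha> / mfact \<alpha>"
    have M: "0 \<le> ?M"
      using mfact_pos[of \<alpha>] by (auto simp: mpow_def intro!: divide_nonneg_pos prod_nonneg)
    have ii: "integrable lebesgue (\<lambda>w. indicator A w :: real)"
      using Am fin by (intro integrable_real_indicator)
    have "c * measure lebesgue A * ?M = (LINT w|lebesgue. (c * ?M) * indicator A w)"
      using Am by (simp add: mult_ac)
    also have "\<dots> \<le> moment \<omega> \<alpha>"
      unfolding moment_def
    proof (rule integral_mono_AE)
      show "AE w in lebesgue. c * ?M * indicator A w \<le> (norm (e_basis \<alpha> w))\<^sup>2 * \<omega> w"
        using c(2) nn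
      proof eventually_elim
        case (elim w)
        show ?case
        proof (cases "w \<in> A")
          case True
          then have "?M \<le> (norm (e_basis \<alpha> w))\<^sup>2"
            unfolding norm_e_basis_sq mpow_def using mfact_pos[of \<alpha>] t1
            by (auto simp: A_def less_imp_le intro!: divide_right_mono prod_mono power_mono)
          moreover have "c \<le> \<omega> w"
            using True elim by (simp add: A_def)
          ultimately have "?M * c \<le> (norm (e_basis \<alpha> w))\<^sup>2 * \<omega> w"
            using c(1) by (intro mult_mono) auto
          then show ?thesis using True by (simp add: mult.commute)
        qed (use elim in simp)
      qed
    qed (use integrable_moment[OF \<omega>] ii in \<open>auto intro: integrable_mult_right\<close>)
    finally show "c * measure lebesgue A * ?M \<le> moment \<omega> \<alpha>" .
  qed
qed

lemma moment_pos:
  assumes "radial_weight t1 t2 \<omega>"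
  shows "0 < moment \<omega> \<alpha>"
proof -
  obtain C where "C > 0" and C: "C * (mpow (\<chi> j. (t1 $ j / 2)\<^sup>2) \<alpha> / mfact \<alpha>) \<le> moment \<omega> \<alpha>"
    using moment_ge[OF assms] by blast
  have "(\<chi> j. (t1 $ j / 2)\<^sup>2) \<in> pos_vecs"
    using assms by (simp add: radial_weight_def pos_vecs_def) (metis less_irrefl)
  from mpow_pos[OF this, of \<alpha>] have "0 < C * (mpow (\<chi> j. (t1 $ j / 2)\<^sup>2) \<alpha> / mfact \<alpha>)"
    using \<open>C > 0\<close> mfact_pos[of \<alpha>] by simp
  then show ?thesis using C by linarith
qed

section \<open>Recovering coefficients from integrals\<close>

lemma coeff_integral:
  fixes F :: "complex ^ 'd \<Rightarrow> complex"
  assumes \<omega>: "radial_weight t1 t2 \<omega>" and F: "has_coeffs F c"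
  shows "(LINT w|lebesgue. F w * cnj (e_basis \<beta> w) * of_real (\<omega> w)) = c \<beta> * of_real (moment \<omega> \<beta>)"
proof -
  have "continuous_on UNIV (\<lambda>w. cnj (e_basis \<beta> w))"
    by (intro continuous_intros continuous_on_e_basis)
  from has_sum_weighted[OF \<omega> F this]
  have "((\<lambda>\<alpha>. c \<alpha> * (LINT w|lebesgue. e_basis \<alpha> w * cnj (e_basis \<beta> w) * of_real (\<omega> w))) has_sum
      (LINT w|lebesgue. F w * cnj (e_basis \<beta> w) * of_real (\<omega> w))) UNIV" .
  also have "?this \<longleftrightarrow> ((\<lambda>\<alpha>. c \<alpha> * of_real (moment \<omega> \<beta>)) has_sum
      (LINT w|lebesgue. F w * cnj (e_basis \<beta> w) * of_real (\<omega> w))) {\<beta>}"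
    by (rule has_sum_cong_neutral) (auto simp: e_basis_orthogonal[OF \<omega>] moment_complex)
  finally show ?thesis
    by (simp add: has_sum_finite_iff)
qed

lemma radial_weight_polycyl:
  "radial_weight (\<chi> j. 1) (\<chi> j. 1) (indicator (polycyl (\<chi> j. 1)) :: complex ^ 'd \<Rightarrow> real)"
proof -
  have "indicator (polycyl (\<chi> j. 1)) z =
      (\<lambda>x :: real ^ 'd. if \<forall>j. x $ j \<le> 1 then 1 else 0 :: real) (\<chi> j. norm (z $ j))" for z :: "complex ^ 'd"
    by (simp add: polycyl_def indicator_def)
  then have rad: "\<exists>f0. AE z :: complex ^ 'd in lebesgue. indicator (polycyl (\<chi> j. 1)) z = (f0 (\<chi> j. norm (z $ j)) :: real)"
    by (intro exI AE_I2)
  have m: "(polycyl (\<chi> j. 1) :: (complex ^ 'd) set) \<in> sets lebesgue"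
    using borel_closed[OF closed_polycyl[of "(\<chi> j. 1) :: real ^ 'd"]] by simp
  have sub: "polydisc r \<subseteq> polycyl r" for r :: "real ^ 'd"
    using polydisc_subset_polycyl closure_subset by blast
  show ?thesis
    unfolding radial_weight_def
  proof (intro conjI rad)
    show "\<exists>C. AE z in lebesgue. \<bar>indicator (polycyl (\<chi> j. 1)) (z :: complex ^ 'd)\<bar> \<le> (C :: real)"
      by (intro exI[of _ 1] AE_I2) (simp add: indicator_def)
    show "\<exists>c>0. AE z :: complex ^ 'd in lebesgue. z \<in> polydisc (\<chi> j. 1) \<longrightarrow> c \<le> (indicator (polycyl (\<chi> j. 1)) z :: real)"
      using sub by (intro exI[of _ 1] conjI AE_I2) (auto simp: indicator_def)
  qed (use m in \<open>auto simp: pos_vecs_def\<close>)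
qed

text \<open>Integration against \<open>cnj (e_basis \<beta>)\<close> isolates one coefficient times
  a positive moment. This justifies the description operator in \<open>coeff_of\<close>.\<close>

lemma has_coeffs_unique:
  assumes "has_coeffs F c" "has_coeffs F c'"
  shows "c = c'"
proof
  fix \<beta>
  show "c \<beta> = c' \<beta>"
    using coeff_integral[OF radial_weight_polycyl assms(1), of \<beta>]
      coeff_integral[OF radial_weight_polycyl assms(2), of \<beta>] moment_pos[OF radial_weight_polycyl, of \<beta>]
    by simp
qed

lemma coeff_of_eq: "has_coeffs F c \<Longrightarrow> coeff_of F = c"
  unfolding coeff_of_def using has_coeffs_unique by blast

lemma power_series_iff: "power_series F \<longleftrightarrow> (\<exists>c. has_coeffs F c)"
  unfolding power_series_def using coeff_of_eq by blast

section \<open>The exponential kernel and the projection\<close>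

lemma has_coeffs_exp_herm: "has_coeffs (\<lambda>w. exp (herm w z)) (\<lambda>\<beta>. cnj (e_basis \<beta> z))"
  unfolding has_coeffs_def
proof
  fix w :: "complex ^ 'a"
  have s: "summable (\<lambda>n. norm ((w $ j * cnj (z $ j)) ^ n / fact n))"
    "(\<lambda>n. (w $ j * cnj (z $ j)) ^ n / fact n) sums exp (w $ j * cnj (z $ j))" for j
    using summable_norm_exp[of "w $ j * cnj (z $ j)"] exp_converges[of "w $ j * cnj (z $ j)"]
    by (simp_all add: scaleR_conv_of_real divide_inverse_commute)
  have "((\<lambda>\<alpha> :: nat ^ 'a. \<Prod>j\<in>UNIV. (w $ j * cnj (z $ j)) ^ (\<alpha> $ j) / fact (\<alpha> $ j)) has_sum
      (\<Prod>j\<in>UNIV. exp (w $ j * cnj (z $ j)))) UNIV"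
    by (rule has_sum_prod_vec) (rule s)+
  moreover have "(\<Prod>j\<in>UNIV. (w $ j * cnj (z $ j)) ^ (\<alpha> $ j) / fact (\<alpha> $ j)) = cnj (e_basis \<alpha> z) * e_basis \<alpha> w" for \<alpha>
  proof -
    have "complex_of_real (sqrt (mfact \<alpha>)) * of_real (sqrt (mfact \<alpha>)) = of_real (mfact \<alpha>)"
      using mfact_pos[of \<alpha>] by (simp flip: of_real_mult)
    also have "\<dots> = (\<Prod>j\<in>UNIV. fact (\<alpha> $ j))"
      by (simp add: mfact_def)
    finally have "cnj (e_basis \<alpha> z) * e_basis \<alpha> w = mpow w \<alpha> * cnj (mpow z \<alpha>) / (\<Prod>j\<in>UNIV. fact (\<alpha> $ j))"
      by (simp add: e_basis_def mult.commute)
    then show ?thesis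
      by (simp add: mpow_def prod_dividef prod.distrib power_mult_distrib)
  qed
  ultimately show "((\<lambda>\<alpha>. cnj (e_basis \<alpha> z) * e_basis \<alpha> w) has_sum exp (herm w z)) UNIV"
    by (simp add: herm_def exp_sum)
qed

lemma herm_cnj: "cnj (herm w z) = herm z w"
  by (simp add: herm_def mult.commute)

lemma continuous_on_herm: "continuous_on UNIV (\<lambda>w. exp (herm z w))"
  unfolding herm_def by (intro continuous_intros)

text \<open>The kernel exp (z, w) is antiholomorphic in \<open>w\<close>. Conjugating the integrand
  makes it a power series in \<open>w\<close> and turns \<open>e_basis \<alpha>\<close> into the
  test function, so one coefficient of the kernel is extracted.\<close>

lemma integral_e_basis_exp_herm:
  fixes \<omega> :: "complex ^ 'd \<Rightarrow> real"
  assumes \<omega>: "radial_weight t1 t2 \<omega>"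
  shows "(LINT w|lebesgue. e_basis \<alpha> w * exp (herm z w) * of_real (\<omega> w)) = of_real (moment \<omega> \<alpha>) * e_basis \<alpha> z"
proof -
  have "(LINT w|lebesgue. e_basis \<alpha> w * exp (herm z w) * of_real (\<omega> w))
      = (LINT w|lebesgue. cnj (exp (herm w z) * cnj (e_basis \<alpha> w) * of_real (\<omega> w)))"
    by (simp add: exp_cnj herm_cnj mult_ac)
  also have "\<dots> = cnj (LINT w|lebesgue. exp (herm w z) * cnj (e_basis \<alpha> w) * of_real (\<omega> w))"
    by (rule Bochner_Integration.integral_cnj)
  also have "\<dots> = of_real (moment \<omega> \<alpha>) * e_basis \<alpha> z"
    unfolding coeff_integral[OF \<omega> has_coeffs_exp_herm] by simp
  finally show ?thesis .
qed

text \<open>The Gaussian depends on the moduli only, is at most 1, and is bounded below on the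
  bounded set \<open>polydisc t1\<close>, so it preserves all conditions on the cutoff.\<close>

lemma R_inf_radial_weight:
  fixes cut :: "complex ^ 'd \<Rightarrow> real"
  assumes "cut \<in> R_inf"
  obtains t1 t2 where "radial_weight t1 t2 (\<lambda>w. cut w * exp (- (norm w)\<^sup>2))"
proof -
  from assms obtain t1 t2 where t: "t1 \<in> pos_vecs" "t2 \<in> pos_vecs" and cut: "cut \<in> R_inf_between t1 t2"
    unfolding R_inf_def by auto
  from cut have m: "cut \<in> borel_measurable lebesgue" and nn: "AE z in lebesgue. 0 \<le> cut z"
    and supp: "AE z in lebesgue. z \<notin> closure (polydisc t2) \<longrightarrow> cut z = 0"
    unfolding R_inf_between_def by auto
  from cut obtain C f0 c where C: "AE z in lebesgue. \<bar>cut z\<bar> \<le> C"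
    and f0: "AE z in lebesgue. cut z = f0 (\<chi> j. norm (z $ j))"
    and c: "0 < c" "AE z in lebesgue. z \<in> polydisc t1 \<longrightarrow> c \<le> cut z"
    unfolding R_inf_between_def by auto
  let ?\<omega> = "\<lambda>w. cut w * exp (- (norm w)\<^sup>2)"
  have "radial_weight t1 t2 ?\<omega>"
    unfolding radial_weight_def
  proof (intro conjI t)
    show "?\<omega> \<in> borel_measurable lebesgue"
      by (intro borel_measurable_times m continuous_borel_lebesgue continuous_intros)
    show "\<exists>C. AE z in lebesgue. \<bar>?\<omega> z\<bar> \<le> C"
    proof
      show "AE z in lebesgue. \<bar>?\<omega> z\<bar> \<le> C"
        using C
      proof eventually_elim
        case (elim z)
        have "\<bar>?\<omega> z\<bar> \<le> \<bar>cut z\<bar> * 1"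
          unfolding abs_mult by (intro mult_left_mono) auto
        then show ?case using elim by linarith
      qed
    qed
    show "AE z in lebesgue. 0 \<le> ?\<omega> z"
      using nn by eventually_elim simp
    show "AE z in lebesgue. z \<notin> polycyl t2 \<longrightarrow> ?\<omega> z = 0"
      using supp by eventually_elim (use polydisc_subset_polycyl[of t2] in auto)
    show "\<exists>f0. AE z in lebesgue. ?\<omega> z = f0 (\<chi> j. norm (z $ j))"
    proof
      have "norm (\<chi> j. norm (z $ j)) = norm z" for z :: "complex ^ 'd"
        by (simp add: norm_vec_def)
      then show "AE z in lebesgue. ?\<omega> z = (\<lambda>x. f0 x * exp (- (norm x)\<^sup>2)) (\<chi> j. norm (z $ j))"
        using f0 by simp
    qed
    obtain B where B: "\<And>z. z \<in> polycyl t1 \<Longrightarrow> norm z \<le> B"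
      using bounded_polycyl[of t1] unfolding bounded_iff by blast
    show "\<exists>c>0. AE z in lebesgue. z \<in> polydisc t1 \<longrightarrow> c \<le> ?\<omega> z"
    proof (intro exI conjI)
      show "0 < c * exp (- B\<^sup>2)" using c by simp
      show "AE z in lebesgue. z \<in> polydisc t1 \<longrightarrow> c * exp (- B\<^sup>2) \<le> ?\<omega> z"
        using c(2)
      proof eventually_elim
        case (elim z)
        show ?case
        proof
          assume z: "z \<in> polydisc t1"
          then have "norm z \<le> B"
            using polydisc_subset_polycyl[of t1] closure_subset[of "polydisc t1"] by (intro B) blast
          then have "(norm z)\<^sup>2 \<le> B\<^sup>2"
            by (intro power_mono) auto
          then show "c * exp (- B\<^sup>2) \<le> ?\<omega> z"
            using elim z c(1) by (intro mult_mono) auto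
        qed
      qed
    qed
  qed
  then show thesis by (rule that)
qed

theorem Pi_A_coeffs:
  fixes cut :: "complex ^ 'd \<Rightarrow> real"
  assumes \<omega>: "radial_weight t1 t2 (\<lambda>w. cut w * exp (- (norm w)\<^sup>2))" and F: "has_coeffs F c"
  shows "has_coeffs (Pi_A (\<lambda>w. F w * of_real (cut w)))
    (\<lambda>\<alpha>. of_real (moment (\<lambda>w. cut w * exp (- (norm w)\<^sup>2)) \<alpha> / pi ^ CARD('d)) * c \<alpha>)"
  unfolding has_coeffs_def
proof
  fix z :: "complex ^ 'd"
  let ?\<omega> = "\<lambda>w. cut w * exp (- (norm w)\<^sup>2)"
  have "((\<lambda>\<alpha>. c \<alpha> * (of_real (moment ?\<omega> \<alpha>) * e_basis \<alpha> z)) has_sum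
      (LINT w|lebesgue. F w * exp (herm z w) * of_real (?\<omega> w))) UNIV"
    using has_sum_weighted[OF \<omega> F continuous_on_herm[of z]] unfolding integral_e_basis_exp_herm[OF \<omega>] .
  then have "((\<lambda>\<alpha>. of_real (inverse (pi ^ CARD('d))) * (c \<alpha> * (of_real (moment ?\<omega> \<alpha>) * e_basis \<alpha> z))) has_sum
      of_real (inverse (pi ^ CARD('d))) * (LINT w|lebesgue. F w * exp (herm z w) * of_real (?\<omega> w))) UNIV"
    by (rule has_sum_cmult_right)
  moreover have "F w * exp (herm z w) * of_real (?\<omega> w)
      = F w * of_real (cut w) * exp (herm z w - of_real ((norm w)\<^sup>2))" for w
  proof -
    have "exp (herm z w - of_real ((norm w)\<^sup>2)) = exp (herm z w) * of_real (exp (- (norm w)\<^sup>2))"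
      by (simp only: diff_conv_add_uminus exp_add exp_of_real of_real_minus[symmetric])
    then show ?thesis by (simp only: of_real_mult mult_ac)
  qed
  ultimately have "((\<lambda>\<alpha>. of_real (inverse (pi ^ CARD('d))) * (c \<alpha> * (of_real (moment ?\<omega> \<alpha>) * e_basis \<alpha> z))) has_sum
      Pi_A (\<lambda>w. F w * of_real (cut w)) z) UNIV"
    by (simp only: Pi_A_def)
  moreover have "of_real (inverse (pi ^ CARD('d))) * (c \<alpha> * (of_real (moment ?\<omega> \<alpha>) * e_basis \<alpha> z))
      = of_real (moment ?\<omega> \<alpha> / pi ^ CARD('d)) * c \<alpha> * e_basis \<alpha> z" for \<alpha>
    by (simp only: divide_inverse of_real_mult mult_ac)
  ultimately show "((\<lambda>\<alpha>. of_real (moment ?\<omega> \<alpha> / pi ^ CARD('d)) * c \<alpha> * e_basis \<alpha> z) has_sum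
      Pi_A (\<lambda>w. F w * of_real (cut w)) z) UNIV"
    by (simp only:)
qed

section \<open>Topologies and coefficient multipliers\<close>

text \<open>Replaces the extended supremum by termwise real bounds. The value \<open>B = 0\<close>
  is included, as it gives distance zero between equal functions.\<close>

lemma coeff_norm_le_iff:
  assumes r: "r \<in> pos_vecs" and "0 \<le> B"
  shows "coeff_norm \<sigma> r c \<le> ennreal B \<longleftrightarrow>
    (\<forall>\<alpha>. norm (c \<alpha>) \<le> B * (mpow r \<alpha> * mfact \<alpha> powr (- 1 / (2 * \<sigma>))))"
proof -
  have "norm (c \<alpha>) * inverse (mpow r \<alpha>) * mfact \<alpha> powr (1 / (2 * \<sigma>)) \<le> B \<longleftrightarrow>
      norm (c \<alpha>) \<le> B * (mpow r \<alpha> * mfact \<alpha> powr (- 1 / (2 * \<sigma>)))" for \<alpha>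
  proof -
    have m: "0 < mpow r \<alpha>" "0 < mfact \<alpha> powr (1 / (2 * \<sigma>))"
      using mpow_pos[OF r] mfact_pos[of \<alpha>] by auto
    have "mfact \<alpha> powr (- 1 / (2 * \<sigma>)) = inverse (mfact \<alpha> powr (1 / (2 * \<sigma>)))"
      by (metis minus_divide_left powr_minus)
    moreover have "x * inverse y * w \<le> B \<longleftrightarrow> x \<le> B * (y * inverse w)" if "0 < y" "0 < w" for x y w :: real
      using that by (simp add: field_simps)
    ultimately show ?thesis
      using m by simp
  qed
  then show ?thesis
    unfolding coeff_norm_def SUP_le_iff using \<open>0 \<le> B\<close> by (simp add: ennreal_le_iff)
qed

lemma coeff_norm_finite_iff:
  assumes r: "r \<in> pos_vecs"
  shows "coeff_norm \<sigma> r c < \<infinity> \<longleftrightarrow>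
    (\<exists>C>0. \<forall>\<alpha>. norm (c \<alpha>) \<le> C * (mpow r \<alpha> * mfact \<alpha> powr (- 1 / (2 * \<sigma>))))"
proof
  assume "coeff_norm \<sigma> r c < \<infinity>"
  then have "coeff_norm \<sigma> r c = ennreal (enn2real (coeff_norm \<sigma> r c))"
    by (simp add: less_top)
  also have "\<dots> \<le> ennreal (enn2real (coeff_norm \<sigma> r c) + 1)"
    by (intro ennreal_leI) simp
  finally have "\<forall>\<alpha>. norm (c \<alpha>) \<le> (enn2real (coeff_norm \<sigma> r c) + 1) * (mpow r \<alpha> * mfact \<alpha> powr (- 1 / (2 * \<sigma>)))"
    by (subst (asm) coeff_norm_le_iff[OF r]) auto
  moreover have "0 < enn2real (coeff_norm \<sigma> r c) + 1"
    by (simp add: add_nonneg_pos)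
  ultimately show "\<exists>C>0. \<forall>\<alpha>. norm (c \<alpha>) \<le> C * (mpow r \<alpha> * mfact \<alpha> powr (- 1 / (2 * \<sigma>)))"
    by blast
next
  assume "\<exists>C>0. \<forall>\<alpha>. norm (c \<alpha>) \<le> C * (mpow r \<alpha> * mfact \<alpha> powr (- 1 / (2 * \<sigma>)))"
  then obtain C where "0 < C" "coeff_norm \<sigma> r c \<le> ennreal C"
    using coeff_norm_le_iff[OF r, of _ \<sigma> c] less_imp_le by blast
  then show "coeff_norm \<sigma> r c < \<infinity>"
    using ennreal_less_top le_less_trans by (metis infinity_ennreal_def)
qed

lemma flat_banach_iff:
  "r \<in> pos_vecs \<Longrightarrow> F \<in> flat_banach \<sigma> r \<longleftrightarrow> power_series F \<and> flat_bound \<sigma> r F"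
  unfolding flat_banach_def flat_bound_def by (simp only: mem_Collect_eq coeff_norm_finite_iff)

section \<open>Linear and metric structure of the spaces\<close>

lemma A_flat_eq: "A_flat \<sigma> = (\<Union>r\<in>pos_vecs. flat_banach \<sigma> r)"
  unfolding A_flat_def by (auto simp: flat_banach_iff)

lemma A0_flat_eq: "A0_flat \<sigma> = {F. power_series F \<and> (\<forall>r\<in>pos_vecs. F \<in> flat_banach \<sigma> r)}"
  unfolding A0_flat_def by (auto simp: flat_banach_iff)

lemma one_pos_vecs: "(\<chi> j. 1) \<in> pos_vecs"
  by (simp add: pos_vecs_def)

lemma A0_flat_subset: "A0_flat \<sigma> \<subseteq> A_flat \<sigma>"
  unfolding A_flat_def A0_flat_def using one_pos_vecs by blast

lemma has_coeffs_coeff_of: "power_series F \<Longrightarrow> has_coeffs F (coeff_of F)"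
  by (simp add: power_series_def)

lemma has_coeffs_lincomb:
  assumes "has_coeffs F c" "has_coeffs G d"
  shows "has_coeffs (\<lambda>x. a * F x + b * G x) (\<lambda>\<alpha>. a * c \<alpha> + b * d \<alpha>)"
  unfolding has_coeffs_def
proof
  fix z
  have "((\<lambda>\<alpha>. a * (c \<alpha> * e_basis \<alpha> z) + b * (d \<alpha> * e_basis \<alpha> z)) has_sum (a * F z + b * G z)) UNIV"
    using assms unfolding has_coeffs_def by (intro has_sum_add has_sum_cmult_right) auto
  then show "((\<lambda>\<alpha>. (a * c \<alpha> + b * d \<alpha>) * e_basis \<alpha> z) has_sum (a * F z + b * G z)) UNIV"
    by (simp add: algebra_simps)
qed

lemma mpow_mono: "r \<in> pos_vecs \<Longrightarrow> (\<And>j. r $ j \<le> s $ j) \<Longrightarrow> mpow r \<alpha> \<le> mpow s \<alpha>"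
  unfolding mpow_def by (intro prod_mono) (auto simp: pos_vecs_def less_imp_le intro!: power_mono)

lemma flat_bound_mono:
  assumes "flat_bound \<sigma> r F" "r \<in> pos_vecs" "\<And>j. r $ j \<le> s $ j"
  shows "flat_bound \<sigma> s F"
proof -
  obtain C where "0 < C" and C: "\<And>\<alpha>. norm (coeff_of F \<alpha>) \<le> C * (mpow r \<alpha> * mfact \<alpha> powr (- 1 / (2 * \<sigma>)))"
    using assms(1) unfolding flat_bound_def by blast
  have "norm (coeff_of F \<alpha>) \<le> C * (mpow s \<alpha> * mfact \<alpha> powr (- 1 / (2 * \<sigma>)))" for \<alpha>
    by (rule order_trans[OF C]) (use assms \<open>0 < C\<close> in \<open>auto intro!: mult_left_mono mult_right_mono mpow_mono\<close>)
  then show ?thesis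
    unfolding flat_bound_def using \<open>0 < C\<close> by blast
qed

lemma flat_bound_lincomb:
  assumes "power_series F" "flat_bound \<sigma> r F" "power_series G" "flat_bound \<sigma> r G"
  shows "flat_bound \<sigma> r (\<lambda>x. a * F x + b * G x)"
proof -
  obtain C D where "0 < C" "0 < D"
    and C: "\<And>\<alpha>. norm (coeff_of F \<alpha>) \<le> C * (mpow r \<alpha> * mfact \<alpha> powr (- 1 / (2 * \<sigma>)))"
    and D: "\<And>\<alpha>. norm (coeff_of G \<alpha>) \<le> D * (mpow r \<alpha> * mfact \<alpha> powr (- 1 / (2 * \<sigma>)))"
    using assms unfolding flat_bound_def by blast
  \<comment> \<open>The summand 1 keeps the constant positive when both scalars vanish.\<close>
  let ?E = "norm a * C + norm b * D + 1"
  have "norm (a * coeff_of F \<alpha> + b * coeff_of G \<alpha>) \<le> ?E * (mpow r \<alpha> * mfact \<alpha> powr (- 1 / (2 * \<sigma>)))" for \<alpha>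
  proof -
    let ?w = "mpow r \<alpha> * mfact \<alpha> powr (- 1 / (2 * \<sigma>))"
    have "0 \<le> ?w"
      using C[of \<alpha>] \<open>0 < C\<close> by (metis norm_ge_zero order_trans zero_le_mult_iff less_le_not_le)
    have "norm (a * coeff_of F \<alpha> + b * coeff_of G \<alpha>) \<le> norm a * norm (coeff_of F \<alpha>) + norm b * norm (coeff_of G \<alpha>)"
      by (metis norm_mult norm_triangle_ineq)
    also have "\<dots> \<le> norm a * (C * ?w) + norm b * (D * ?w)"
      by (intro add_mono mult_left_mono C D) auto
    also have "\<dots> \<le> norm a * (C * ?w) + norm b * (D * ?w) + ?w"
      using \<open>0 \<le> ?w\<close> by simp
    also have "\<dots> = ?E * ?w"
      by (simp only: distrib_right mult.assoc mult_1)
    finally show ?thesis .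
  qed
  moreover have "coeff_of (\<lambda>x. a * F x + b * G x) = (\<lambda>\<alpha>. a * coeff_of F \<alpha> + b * coeff_of G \<alpha>)"
    by (rule coeff_of_eq has_coeffs_lincomb has_coeffs_coeff_of assms)+
  moreover have "0 < ?E"
    using \<open>0 < C\<close> \<open>0 < D\<close> by (intro add_nonneg_pos add_nonneg_nonneg mult_nonneg_nonneg) auto
  ultimately show ?thesis
    unfolding flat_bound_def by auto
qed

lemma power_series_lincomb:
  "power_series F \<Longrightarrow> power_series G \<Longrightarrow> power_series (\<lambda>x. a * F x + b * G x)"
  using has_coeffs_lincomb unfolding power_series_iff by blast

lemma A_flat_lincomb:
  assumes "F \<in> A_flat \<sigma>" "G \<in> A_flat \<sigma>"
  shows "(\<lambda>x. a * F x + b * G x) \<in> A_flat \<sigma>"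
proof -
  obtain r s where r: "r \<in> pos_vecs" "flat_bound \<sigma> r F" and s: "s \<in> pos_vecs" "flat_bound \<sigma> s G"
    and ps: "power_series F" "power_series G"
    using assms unfolding A_flat_def by auto
  \<comment> \<open>The two functions come with possibly different radii; the coordinatewise maximum
    serves both.\<close>
  define t where "t = (\<chi> j. max (r $ j) (s $ j))"
  have t: "t \<in> pos_vecs"
    using r s by (auto simp: t_def pos_vecs_def less_max_iff_disj)
  have "flat_bound \<sigma> t F" "flat_bound \<sigma> t G"
    by (rule flat_bound_mono[OF r(2,1)] flat_bound_mono[OF s(2,1)]; simp add: t_def)+
  then show ?thesis
    using t ps flat_bound_lincomb power_series_lincomb unfolding A_flat_def by blast
qed

lemma zero_in_A_flat: "(\<lambda>x :: complex ^ 'd. 0) \<in> A_flat \<sigma>"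
proof -
  have z: "has_coeffs (\<lambda>x :: complex ^ 'd. 0) (\<lambda>\<alpha>. 0)"
    by (simp add: has_coeffs_def)
  have "0 \<le> mpow (\<chi> j. 1) \<alpha> * mfact \<alpha> powr (- 1 / (2 * \<sigma>))" for \<alpha> :: "nat ^ 'd"
    using mpow_pos[OF one_pos_vecs, of \<alpha>] by simp
  then have "flat_bound \<sigma> (\<chi> j. 1) (\<lambda>x :: complex ^ 'd. 0)"
    unfolding flat_bound_def coeff_of_eq[OF z] by (intro exI[of _ 1]) simp
  then show ?thesis
    using z one_pos_vecs unfolding A_flat_def power_series_iff by blast
qed

text \<open>\<open>enn2real\<close> sends infinity to 0, so the distance controls coefficients only
  once the supremum is known to be finite. It is, because the difference lies in the same Banach
  space.\<close>

lemma coeff_diff_le_flat_dist: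
  assumes r: "r \<in> pos_vecs" and F: "F \<in> flat_banach \<sigma> r" and G: "G \<in> flat_banach \<sigma> r"
  shows "norm (coeff_of F \<alpha> - coeff_of G \<alpha>) \<le> flat_dist \<sigma> r F G * (mpow r \<alpha> * mfact \<alpha> powr (- 1 / (2 * \<sigma>)))"
proof -
  have ps: "power_series F" "power_series G" "flat_bound \<sigma> r F" "flat_bound \<sigma> r G"
    using F G by (auto simp: flat_banach_iff[OF r])
  have "coeff_of (\<lambda>x. 1 * F x + (- 1) * G x) = (\<lambda>\<alpha>. 1 * coeff_of F \<alpha> + (- 1) * coeff_of G \<alpha>)"
    by (rule coeff_of_eq has_coeffs_lincomb has_coeffs_coeff_of ps)+
  moreover have "flat_bound \<sigma> r (\<lambda>x. 1 * F x + (- 1) * G x)"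
    by (rule flat_bound_lincomb ps)+
  ultimately have "coeff_norm \<sigma> r (\<lambda>\<alpha>. coeff_of F \<alpha> - coeff_of G \<alpha>) < \<infinity>"
    unfolding coeff_norm_finite_iff[OF r] flat_bound_def by simp
  then have "coeff_norm \<sigma> r (\<lambda>\<alpha>. coeff_of F \<alpha> - coeff_of G \<alpha>) \<le> ennreal (flat_dist \<sigma> r F G)"
    unfolding flat_dist_def by (simp add: less_top)
  then show ?thesis
    by (subst (asm) coeff_norm_le_iff[OF r]) (auto simp: flat_dist_def)
qed

lemma flat_dist_le:
  assumes "r \<in> pos_vecs" "0 \<le> B"
    and "\<And>\<alpha>. norm (coeff_of F \<alpha> - coeff_of G \<alpha>) \<le> B * (mpow r \<alpha> * mfact \<alpha> powr (- 1 / (2 * \<sigma>)))"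
  shows "flat_dist \<sigma> r F G \<le> B"
  unfolding flat_dist_def using assms coeff_norm_le_iff[OF assms(1,2), of \<sigma> "\<lambda>\<alpha>. coeff_of F \<alpha> - coeff_of G \<alpha>"]
  by (intro enn2real_leI) auto

lemma Metric_space_flat_banach:
  assumes r: "r \<in> pos_vecs"
  shows "Metric_space (flat_banach \<sigma> r) (flat_dist \<sigma> r)"
proof
  show "0 \<le> flat_dist \<sigma> r F G" for F G
    by (simp add: flat_dist_def)
  show "flat_dist \<sigma> r F G = flat_dist \<sigma> r G F" for F G
    unfolding flat_dist_def coeff_norm_def by (simp only: norm_minus_commute)
  fix F G assume FG: "F \<in> flat_banach \<sigma> r" "G \<in> flat_banach \<sigma> r"
  show "flat_dist \<sigma> r F G = 0 \<longleftrightarrow> F = G"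
  proof
    assume "flat_dist \<sigma> r F G = 0"
    then have eq: "coeff_of F = coeff_of G"
      using coeff_diff_le_flat_dist[OF r FG] by (intro ext) simp
    have "has_coeffs F (coeff_of F)" "has_coeffs G (coeff_of F)"
      using FG has_coeffs_coeff_of[of F] has_coeffs_coeff_of[of G] eq by (auto simp: flat_banach_def)
    then show "F = G"
      unfolding has_coeffs_def using has_sum_unique by blast
  next
    assume "F = G"
    then have "flat_dist \<sigma> r F G \<le> 0"
      by (intro flat_dist_le[OF r]) auto
    then show "flat_dist \<sigma> r F G = 0"
      by (simp add: flat_dist_def antisym)
  qed
  fix H assume H: "H \<in> flat_banach \<sigma> r"
  show "flat_dist \<sigma> r F H \<le> flat_dist \<sigma> r F G + flat_dist \<sigma> r G H"
  proof (rule flat_dist_le[OF r])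
    show "0 \<le> flat_dist \<sigma> r F G + flat_dist \<sigma> r G H"
      by (simp add: flat_dist_def)
    fix \<alpha>
    have "norm (coeff_of F \<alpha> - coeff_of H \<alpha>) \<le> norm (coeff_of F \<alpha> - coeff_of G \<alpha>) + norm (coeff_of G \<alpha> - coeff_of H \<alpha>)"
      using norm_triangle_ineq[of "coeff_of F \<alpha> - coeff_of G \<alpha>" "coeff_of G \<alpha> - coeff_of H \<alpha>"] by simp
    also have "\<dots> \<le> (flat_dist \<sigma> r F G + flat_dist \<sigma> r G H) * (mpow r \<alpha> * mfact \<alpha> powr (- 1 / (2 * \<sigma>)))"
      unfolding distrib_right by (intro add_mono coeff_diff_le_flat_dist[OF r] FG H)
    finally show "norm (coeff_of F \<alpha> - coeff_of H \<alpha>) \<le>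
      (flat_dist \<sigma> r F G + flat_dist \<sigma> r G H) * (mpow r \<alpha> * mfact \<alpha> powr (- 1 / (2 * \<sigma>)))" .
  qed
qed

lemma topspace_flat_banach [simp]:
  "r \<in> pos_vecs \<Longrightarrow> topspace (flat_banach_topology \<sigma> r) = flat_banach \<sigma> r"
  unfolding flat_banach_topology_def
  by (rule Metric_space.topspace_mtopology[OF Metric_space_flat_banach])

section \<open>Coefficient multipliers\<close>

definition multiplier :: "real \<Rightarrow> real ^ 'd \<Rightarrow> (nat ^ 'd \<Rightarrow> complex) \<Rightarrow> bool"
  where "multiplier \<kappa> t m \<longleftrightarrow> t \<in> pos_vecs \<and> (\<exists>C>0. \<forall>\<alpha>. norm (m \<alpha>) \<le> C * (mpow t \<alpha> * mfact \<alpha> powr \<kappa>))"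

lemma mpow_times: "mpow t \<alpha> * mpow r \<alpha> = mpow (t * r) \<alpha>"
  by (simp add: mpow_def power_mult_distrib prod.distrib)

lemma pos_vecs_times: "t \<in> pos_vecs \<Longrightarrow> r \<in> pos_vecs \<Longrightarrow> t * r \<in> pos_vecs"
  by (simp add: pos_vecs_def)

lemma multiplier_bound:
  assumes m: "norm m \<le> C * (mpow t \<alpha> * mfact \<alpha> powr (1 / (2 * \<sigma>1) - 1 / (2 * \<sigma>2)))"
    and c: "norm c \<le> D * (mpow r \<alpha> * mfact \<alpha> powr (- 1 / (2 * \<sigma>1)))"
  shows "norm (m * c :: complex) \<le> C * D * (mpow (t * r) \<alpha> * mfact \<alpha> powr (- 1 / (2 * \<sigma>2)))"
proof -
  have "norm (m * c) \<le> (C * (mpow t \<alpha> * mfact \<alpha> powr (1 / (2 * \<sigma>1) - 1 / (2 * \<sigma>2)))) *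
      (D * (mpow r \<alpha> * mfact \<alpha> powr (- 1 / (2 * \<sigma>1))))"
    unfolding norm_mult using m c norm_ge_zero order_trans by (intro mult_mono) blast+
  also have "\<dots> = C * D * (mpow t \<alpha> * mpow r \<alpha> *
      (mfact \<alpha> powr (1 / (2 * \<sigma>1) - 1 / (2 * \<sigma>2)) * mfact \<alpha> powr (- 1 / (2 * \<sigma>1))))"
    by (simp only: mult_ac)
  also have "mfact \<alpha> powr (1 / (2 * \<sigma>1) - 1 / (2 * \<sigma>2)) * mfact \<alpha> powr (- 1 / (2 * \<sigma>1)) = mfact \<alpha> powr (- 1 / (2 * \<sigma>2))"
    unfolding powr_add[symmetric] by (rule arg_cong[where f = "\<lambda>x. _ powr x"]) simp
  finally show ?thesis
    unfolding mpow_times .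
qed

text \<open>Only the coefficients of the image are prescribed, so the integral operator and its
  inverse given by a series fall under the same lemmas.\<close>

definition acts_by :: "(nat ^ 'd \<Rightarrow> complex) \<Rightarrow> (complex ^ 'd \<Rightarrow> complex) set \<Rightarrow>
    ((complex ^ 'd \<Rightarrow> complex) \<Rightarrow> (complex ^ 'd \<Rightarrow> complex)) \<Rightarrow> bool"
  where "acts_by m A T \<longleftrightarrow> (\<forall>F\<in>A. has_coeffs (T F) (\<lambda>\<alpha>. m \<alpha> * coeff_of F \<alpha>))"

context
  fixes \<sigma>1 \<sigma>2 :: real and m :: "nat ^ 'd \<Rightarrow> complex" and t :: "real ^ 'd"
    and T :: "(complex ^ 'd \<Rightarrow> complex) \<Rightarrow> complex ^ 'd \<Rightarrow> complex"
  assumes m: "multiplier (1 / (2 * \<sigma>1) - 1 / (2 * \<sigma>2)) t m"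
    and T: "acts_by m (A_flat \<sigma>1) T"
begin

text \<open>One constant works for all radii, and the radius changes by the fixed factor
  \<open>t\<close> in each coordinate, because the geometric factors of multiplier and coefficient
  multiply.\<close>

lemma multiplier_Lipschitz:
  obtains C where "0 < C"
    "\<And>r F. r \<in> pos_vecs \<Longrightarrow> F \<in> flat_banach \<sigma>1 r \<Longrightarrow> T F \<in> flat_banach \<sigma>2 (t * r)"
    "\<And>r F G. r \<in> pos_vecs \<Longrightarrow> F \<in> flat_banach \<sigma>1 r \<Longrightarrow> G \<in> flat_banach \<sigma>1 r \<Longrightarrow>
      flat_dist \<sigma>2 (t * r) (T F) (T G) \<le> C * flat_dist \<sigma>1 r F G"
proof -
  obtain C where t: "t \<in> pos_vecs" and "0 < C"
    and C: "\<And>\<alpha>. norm (m \<alpha>) \<le> C * (mpow t \<alpha> * mfact \<alpha> powr (1 / (2 * \<sigma>1) - 1 / (2 * \<sigma>2)))"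
    using m unfolding multiplier_def by blast
  have TF: "has_coeffs (T F) (\<lambda>\<alpha>. m \<alpha> * coeff_of F \<alpha>)" if "F \<in> flat_banach \<sigma>1 r" "r \<in> pos_vecs" for F r
    using T that unfolding acts_by_def A_flat_eq by blast
  show thesis
  proof (rule that[OF \<open>0 < C\<close>])
    fix r :: "real ^ 'd" and F assume r: "r \<in> pos_vecs" and F: "F \<in> flat_banach \<sigma>1 r"
    obtain D where "0 < D" and D: "\<And>\<alpha>. norm (coeff_of F \<alpha>) \<le> D * (mpow r \<alpha> * mfact \<alpha> powr (- 1 / (2 * \<sigma>1)))"
      using F unfolding flat_banach_iff[OF r] flat_bound_def by blast
    have "flat_bound \<sigma>2 (t * r) (T F)"
      unfolding flat_bound_def coeff_of_eq[OF TF[OF F r]]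
      using multiplier_bound[OF C D] \<open>0 < C\<close> \<open>0 < D\<close> by (intro exI[of _ "C * D"]) auto
    then show "T F \<in> flat_banach \<sigma>2 (t * r)"
      unfolding flat_banach_iff[OF pos_vecs_times[OF t r]] power_series_iff using TF[OF F r] by blast
  next
    fix r :: "real ^ 'd" and F G assume r: "r \<in> pos_vecs" and F: "F \<in> flat_banach \<sigma>1 r" and G: "G \<in> flat_banach \<sigma>1 r"
    show "flat_dist \<sigma>2 (t * r) (T F) (T G) \<le> C * flat_dist \<sigma>1 r F G"
    proof (rule flat_dist_le[OF pos_vecs_times[OF t r]])
      show "0 \<le> C * flat_dist \<sigma>1 r F G"
        using \<open>0 < C\<close> by (simp add: flat_dist_def)
      show "norm (coeff_of (T F) \<alpha> - coeff_of (T G) \<alpha>) \<le>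
          C * flat_dist \<sigma>1 r F G * (mpow (t * r) \<alpha> * mfact \<alpha> powr (- 1 / (2 * \<sigma>2)))" for \<alpha>
        unfolding coeff_of_eq[OF TF[OF F r]] coeff_of_eq[OF TF[OF G r]] right_diff_distrib[symmetric]
        by (rule multiplier_bound[OF C coeff_diff_le_flat_dist[OF r F G]])
    qed
  qed
qed

lemma multiplier_continuous_flat_banach:
  assumes r: "r \<in> pos_vecs"
  shows "continuous_map (flat_banach_topology \<sigma>1 r) (flat_banach_topology \<sigma>2 (t * r)) T"
proof -
  have tr: "t * r \<in> pos_vecs"
    using m r by (simp add: multiplier_def pos_vecs_times)
  obtain C where "0 < C"
    and 1: "\<And>F. F \<in> flat_banach \<sigma>1 r \<Longrightarrow> T F \<in> flat_banach \<sigma>2 (t * r)"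
    and 2: "\<And>F G. F \<in> flat_banach \<sigma>1 r \<Longrightarrow> G \<in> flat_banach \<sigma>1 r \<Longrightarrow>
      flat_dist \<sigma>2 (t * r) (T F) (T G) \<le> C * flat_dist \<sigma>1 r F G"
    using multiplier_Lipschitz r by metis
  show ?thesis
    unfolding flat_banach_topology_def
      Metric_space.metric_continuous_map[OF Metric_space_flat_banach[OF r] Metric_space_flat_banach[OF tr]]
  proof (intro conjI ballI allI impI)
    show "T ` flat_banach \<sigma>1 r \<subseteq> flat_banach \<sigma>2 (t * r)"
      using 1 by blast
    fix F and \<epsilon> :: real assume F: "F \<in> flat_banach \<sigma>1 r" and "0 < \<epsilon>"
    have "flat_dist \<sigma>2 (t * r) (T F) (T G) < \<epsilon>" if "G \<in> flat_banach \<sigma>1 r" "flat_dist \<sigma>1 r F G < \<epsilon> / C" for G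
      using 2[OF F that(1)] that(2) \<open>0 < C\<close> by (simp add: field_simps)
    then show "\<exists>\<delta>>0. \<forall>G. G \<in> flat_banach \<sigma>1 r \<and> flat_dist \<sigma>1 r F G < \<delta> \<longrightarrow> flat_dist \<sigma>2 (t * r) (T F) (T G) < \<epsilon>"
      using \<open>0 < \<epsilon>\<close> \<open>0 < C\<close> by (intro exI[of _ "\<epsilon> / C"]) auto
  qed
qed

lemma multiplier_A_flat: "F \<in> A_flat \<sigma>1 \<Longrightarrow> T F \<in> A_flat \<sigma>2"
proof -
  assume "F \<in> A_flat \<sigma>1"
  then obtain r where r: "r \<in> pos_vecs" "F \<in> flat_banach \<sigma>1 r"
    by (auto simp: A_flat_eq)
  moreover have "t * r \<in> pos_vecs"
    using m r by (simp add: multiplier_def pos_vecs_times)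
  ultimately show "T F \<in> A_flat \<sigma>2"
    unfolding A_flat_eq using multiplier_Lipschitz by blast
qed

text \<open>Every target radius \<open>s\<close> has the form \<open>t * r\<close> with
  \<open>r = s / t\<close> coordinatewise, so a condition for all radii is inherited.\<close>

lemma multiplier_A0_flat:
  assumes F: "F \<in> A0_flat \<sigma>1"
  shows "T F \<in> A0_flat \<sigma>2"
proof -
  have t: "\<And>j. 0 < t $ j"
    using m by (simp add: multiplier_def pos_vecs_def)
  have "T F \<in> flat_banach \<sigma>2 s" if s: "s \<in> pos_vecs" for s
  proof -
    define r where "r = (\<chi> j. s $ j / t $ j)"
    have r: "r \<in> pos_vecs"
      using s t by (simp add: r_def pos_vecs_def)
    have "t * r = s"
      using t by (simp add: r_def vec_eq_iff less_imp_neq[THEN not_sym])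
    moreover have "F \<in> flat_banach \<sigma>1 r"
      using F r by (simp add: A0_flat_eq)
    ultimately show ?thesis
      using multiplier_Lipschitz r by metis
  qed
  moreover from this[OF one_pos_vecs] have "power_series (T F)"
    by (simp add: flat_banach_def)
  ultimately show ?thesis
    by (simp add: A0_flat_eq)
qed

lemma multiplier_continuous_A0_flat:
  "continuous_map (A0_flat_topology \<sigma>1) (A0_flat_topology \<sigma>2) T"
proof -
  have t: "\<And>j. 0 < t $ j"
    using m by (simp add: multiplier_def pos_vecs_def)
  have top: "topspace (A0_flat_topology \<sigma>) = (A0_flat \<sigma> :: (complex ^ 'd \<Rightarrow> complex) set)" for \<sigma>
  proof -
    have "openin (flat_banach_topology \<sigma> (\<chi> j. 1)) (flat_banach \<sigma> (\<chi> j. 1) :: (complex ^ 'd \<Rightarrow> complex) set)"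
      by (metis one_pos_vecs openin_topspace topspace_flat_banach)
    moreover have "A0_flat \<sigma> \<inter> flat_banach \<sigma> (\<chi> j. 1) = (A0_flat \<sigma> :: (complex ^ 'd \<Rightarrow> complex) set)"
      using one_pos_vecs by (auto simp: A0_flat_eq)
    ultimately show ?thesis
      unfolding A0_flat_topology_def topology_generated_by_topspace using one_pos_vecs by blast
  qed
  show ?thesis
    unfolding A0_flat_topology_def[of \<sigma>2]
  proof (rule continuous_on_generated_topo)
    show "T ` topspace (A0_flat_topology \<sigma>1) \<subseteq>
        \<Union> {A0_flat \<sigma>2 \<inter> W |r W. r \<in> pos_vecs \<and> openin (flat_banach_topology \<sigma>2 r) W}"
      using multiplier_A0_flat top[of \<sigma>2] unfolding top[of \<sigma>1] A0_flat_topology_def[of \<sigma>2] topology_generated_by_topspace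
      by blast
    fix U :: "(complex ^ 'd \<Rightarrow> complex) set" assume "U \<in> {A0_flat \<sigma>2 \<inter> W |r W. r \<in> pos_vecs \<and> openin (flat_banach_topology \<sigma>2 r) W}"
    then obtain s W where U: "U = A0_flat \<sigma>2 \<inter> W" and s: "s \<in> pos_vecs" and W: "openin (flat_banach_topology \<sigma>2 s) W"
      by blast
    \<comment> \<open>The radius on the source side for which \<open>T\<close> maps continuously
      into the given target Banach space.\<close>
    define r where "r = (\<chi> j. s $ j / t $ j)"
    have r: "r \<in> pos_vecs"
      using s t by (simp add: r_def pos_vecs_def)
    have "t * r = s"
      using t by (simp add: r_def vec_eq_iff less_imp_neq[THEN not_sym])
    then have W': "openin (flat_banach_topology \<sigma>1 r) {F \<in> flat_banach \<sigma>1 r. T F \<in> W}"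
      using multiplier_continuous_flat_banach[OF r] W r by (auto simp: continuous_map_def)
    have "T -` U \<inter> topspace (A0_flat_topology \<sigma>1) = A0_flat \<sigma>1 \<inter> {F \<in> flat_banach \<sigma>1 r. T F \<in> W}"
      unfolding top U using multiplier_A0_flat r by (auto simp: A0_flat_eq)
    then show "openin (A0_flat_topology \<sigma>1) (T -` U \<inter> topspace (A0_flat_topology \<sigma>1))"
      unfolding A0_flat_topology_def[of \<sigma>1] using W' r by (auto intro!: topology_generated_by_Basis)
  qed
qed

text \<open>Both sides are sums of series with the same coefficients; no formula for
  \<open>T\<close> enters.\<close>

lemma multiplier_lincomb:
  assumes "F \<in> A_flat \<sigma>1" "G \<in> A_flat \<sigma>1"
  shows "T (\<lambda>x. a * F x + b * G x) = (\<lambda>x. a * T F x + b * T G x)"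
proof -
  have ps: "power_series F" "power_series G"
    using assms by (auto simp: A_flat_def)
  have TF: "has_coeffs (T F) (\<lambda>\<alpha>. m \<alpha> * coeff_of F \<alpha>)" "has_coeffs (T G) (\<lambda>\<alpha>. m \<alpha> * coeff_of G \<alpha>)"
    using T assms by (auto simp: acts_by_def)
  have "coeff_of (\<lambda>x. a * F x + b * G x) = (\<lambda>\<alpha>. a * coeff_of F \<alpha> + b * coeff_of G \<alpha>)"
    by (rule coeff_of_eq has_coeffs_lincomb has_coeffs_coeff_of ps)+
  then have "has_coeffs (T (\<lambda>x. a * F x + b * G x)) (\<lambda>\<alpha>. m \<alpha> * (a * coeff_of F \<alpha> + b * coeff_of G \<alpha>))"
    using bspec[OF T[unfolded acts_by_def] A_flat_lincomb[OF assms, of a b]] by (simp only:)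
  moreover have "has_coeffs (\<lambda>x. a * T F x + b * T G x) (\<lambda>\<alpha>. m \<alpha> * (a * coeff_of F \<alpha> + b * coeff_of G \<alpha>))"
  proof -
    have "a * (m \<alpha> * x) + b * (m \<alpha> * y) = m \<alpha> * (a * x + b * y)" for \<alpha> x y
      by (simp add: algebra_simps)
    then show ?thesis
      using has_coeffs_lincomb[OF TF, of a b] by (simp only:)
  qed
  ultimately show ?thesis
    unfolding has_coeffs_def using has_sum_unique by blast
qed

text \<open>The initial topology along a linear map inherits continuity of the operations and convex
  neighbourhoods of 0 from the target. It is the candidate topology on the source side when
  continuity of \<open>T\<close> between inductive limits is tested.\<close>

lemma locally_convex_pullback:
  assumes lc: "locally_convex_topology X" and X: "topspace X = A_flat \<sigma>2"
  shows "locally_convex_topology (pullback_topology (A_flat \<sigma>1) T X)"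
    and "topspace (pullback_topology (A_flat \<sigma>1) T X) = A_flat \<sigma>1"
proof -
  let ?P = "pullback_topology (A_flat \<sigma>1) T X"
  show top: "topspace ?P = A_flat \<sigma>1"
    unfolding topspace_pullback_topology X using multiplier_A_flat by auto
  have TP: "continuous_map ?P X T"
    using continuous_map_pullback[OF continuous_map_id, of "A_flat \<sigma>1" T X] by simp
  have T0: "T (\<lambda>x. 0) = (\<lambda>x. 0)"
    using multiplier_lincomb[OF zero_in_A_flat zero_in_A_flat, of 0 0] by simp
  show "locally_convex_topology ?P"
    unfolding locally_convex_topology_def
  proof (intro conjI allI impI)
    show "(\<lambda>x. 0) \<in> topspace ?P"
      unfolding top by (rule zero_in_A_flat)
    have X_add: "continuous_map (prod_topology X X) X (\<lambda>(F, G). \<lambda>x. F x + G x)"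
      and X_mult: "continuous_map (prod_topology euclidean X) X (\<lambda>(c, F). \<lambda>x. c * F x)"
      using lc unfolding locally_convex_topology_def by auto
    show "continuous_map (prod_topology ?P ?P) ?P (\<lambda>(F, G). \<lambda>x. F x + G x)"
    proof (rule continuous_map_pullback')
      have "continuous_map (prod_topology ?P ?P) X ((\<lambda>(F, G). \<lambda>x. F x + G x) \<circ> (\<lambda>(F, G). (T F, T G)))"
        by (rule continuous_map_compose[OF _ X_add])
          (auto intro!: continuous_map_prod_top[THEN iffD2] simp: TP)
      then show "continuous_map (prod_topology ?P ?P) X (T \<circ> (\<lambda>(F, G). \<lambda>x. F x + G x))"
        by (rule continuous_map_eq) (use multiplier_lincomb[of _ _ 1 1] in \<open>auto simp: top\<close>)
      show "topspace (prod_topology ?P ?P) \<subseteq> (\<lambda>(F, G). \<lambda>x. F x + G x) -` A_flat \<sigma>1"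
        using A_flat_lincomb[of _ \<sigma>1 _ 1 1] by (auto simp: top)
    qed
    show "continuous_map (prod_topology euclidean ?P) ?P (\<lambda>(c, F). \<lambda>x. c * F x)"
    proof (rule continuous_map_pullback')
      have "continuous_map (prod_topology euclidean ?P) X ((\<lambda>(c, F). \<lambda>x. c * F x) \<circ> (\<lambda>(c, F). (c, T F)))"
        by (rule continuous_map_compose[OF _ X_mult])
          (auto intro!: continuous_map_prod_top[THEN iffD2] simp: TP)
      then show "continuous_map (prod_topology euclidean ?P) X (T \<circ> (\<lambda>(c, F). \<lambda>x. c * F x))"
        \<comment> \<open>Scalar multiplication is read as a linear combination with the zero
          function.\<close>
        by (rule continuous_map_eq) (use multiplier_lincomb[OF _ zero_in_A_flat, of _ _ 0] in \<open>auto simp: top\<close>)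
      show "topspace (prod_topology euclidean ?P) \<subseteq> (\<lambda>(c, F). \<lambda>x. c * F x) -` A_flat \<sigma>1"
        using A_flat_lincomb[OF _ zero_in_A_flat, of _ \<sigma>1 _ 0] by (auto simp: top)
    qed
    fix U assume "openin ?P U \<and> (\<lambda>x. 0) \<in> U"
    then obtain W where W: "openin X W" "U = T -` W \<inter> A_flat \<sigma>1" "(\<lambda>x. 0) \<in> W"
      unfolding openin_pullback_topology using T0 by auto
    then obtain V where V: "openin X V" "(\<lambda>x. 0) \<in> V" "V \<subseteq> W"
      "\<And>F G u. F \<in> V \<Longrightarrow> G \<in> V \<Longrightarrow> u \<in> {0..1} \<Longrightarrow> (\<lambda>x. of_real u * F x + of_real (1 - u) * G x) \<in> V"
      using lc unfolding locally_convex_topology_def by meson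
    show "\<exists>V. openin ?P V \<and> (\<lambda>x. 0) \<in> V \<and> V \<subseteq> U \<and>
        (\<forall>F\<in>V. \<forall>G\<in>V. \<forall>u\<in>{0..1}. (\<lambda>x. of_real u * F x + of_real (1 - u) * G x) \<in> V)"
    proof (intro exI conjI ballI)
      show "openin ?P (T -` V \<inter> A_flat \<sigma>1)"
        unfolding openin_pullback_topology using V(1) by blast
      show "(\<lambda>x. 0) \<in> T -` V \<inter> A_flat \<sigma>1"
        using V(2) zero_in_A_flat T0 by simp
      show "T -` V \<inter> A_flat \<sigma>1 \<subseteq> U"
        using V(3) W(2) by blast
      fix F G and u :: real
      assume "F \<in> T -` V \<inter> A_flat \<sigma>1" "G \<in> T -` V \<inter> A_flat \<sigma>1" "u \<in> {0..1}"
      then show "(\<lambda>x. of_real u * F x + of_real (1 - u) * G x) \<in> T -` V \<inter> A_flat \<sigma>1"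
        using V(4)[of "T F" "T G" u] multiplier_lincomb[of F G "of_real u" "of_real (1 - u)"]
          A_flat_lincomb[of F \<sigma>1 G "of_real u" "of_real (1 - u)"] by auto
    qed
  qed
qed

end

section \<open>The inductive limit topology\<close>

text \<open>Written as the pullback of the one-point space, so that continuity into it follows from
  the general facts on pullbacks.\<close>

definition indiscrete :: "'a set \<Rightarrow> 'a topology"
  where "indiscrete A = pullback_topology A (\<lambda>_. ()) (discrete_topology UNIV)"

lemma topspace_indiscrete [simp]: "topspace (indiscrete A) = A"
  by (simp add: indiscrete_def topspace_pullback_topology)

lemma openin_indiscrete: "openin (indiscrete A) U \<longleftrightarrow> U = {} \<or> U = A"
proof
  show "openin (indiscrete A) U \<Longrightarrow> U = {} \<or> U = A"
    unfolding indiscrete_def openin_pullback_topology by (auto split: if_splits)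
  show "U = {} \<or> U = A \<Longrightarrow> openin (indiscrete A) U"
    by (metis openin_empty openin_topspace topspace_indiscrete)
qed

lemma continuous_map_indiscrete: "f \<in> topspace Y \<rightarrow> A \<Longrightarrow> continuous_map Y (indiscrete A) f"
  unfolding indiscrete_def by (rule continuous_map_pullback') (auto simp: o_def)

text \<open>Needed because the inductive limit topology is a supremum, whose carrier would be empty
  without at least one admissible topology.\<close>

lemma locally_convex_indiscrete: "locally_convex_topology (indiscrete (A_flat \<sigma>))"
  unfolding locally_convex_topology_def
proof (intro conjI allI impI)
  show "(\<lambda>x. 0) \<in> topspace (indiscrete (A_flat \<sigma>))"
    by (simp add: zero_in_A_flat)
  show "continuous_map (prod_topology (indiscrete (A_flat \<sigma>)) (indiscrete (A_flat \<sigma>))) (indiscrete (A_flat \<sigma>))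
      (\<lambda>(F, G). \<lambda>x. F x + G x)"
    using A_flat_lincomb[of _ \<sigma> _ 1 1] by (intro continuous_map_indiscrete) auto
  show "continuous_map (prod_topology euclidean (indiscrete (A_flat \<sigma>))) (indiscrete (A_flat \<sigma>))
      (\<lambda>(c, F). \<lambda>x. c * F x)"
    using A_flat_lincomb[OF _ zero_in_A_flat, of _ \<sigma> _ 0] by (intro continuous_map_indiscrete) auto
  fix U assume "openin (indiscrete (A_flat \<sigma>)) U \<and> (\<lambda>x. 0) \<in> U"
  then have "openin (indiscrete (A_flat \<sigma>)) U" "U = A_flat \<sigma>"
    by (auto simp: openin_indiscrete)
  then show "\<exists>V. openin (indiscrete (A_flat \<sigma>)) V \<and> (\<lambda>x. 0) \<in> V \<and> V \<subseteq> U \<and>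
      (\<forall>F\<in>V. \<forall>G\<in>V. \<forall>u\<in>{0..1}. (\<lambda>x. of_real u * F x + of_real (1 - u) * G x) \<in> V)"
    using zero_in_A_flat A_flat_lincomb by (intro exI[of _ U]) blast
qed

lemma topspace_A_flat_topology:
  "topspace (A_flat_topology \<sigma>) = (A_flat \<sigma> :: (complex ^ 'd \<Rightarrow> complex) set)"
proof -
  let ?X = "indiscrete (A_flat \<sigma> :: (complex ^ 'd \<Rightarrow> complex) set)"
  have "continuous_map (flat_banach_topology \<sigma> r) ?X (\<lambda>F. F)" if "r \<in> pos_vecs" for r
    using that by (intro continuous_map_indiscrete) (auto simp: A_flat_eq)
  then have "A_flat \<sigma> \<in> {U. \<exists>T. openin T U \<and> topspace T = (A_flat \<sigma> :: (complex ^ 'd \<Rightarrow> complex) set) \<and> locally_convex_topology T \<and>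
      (\<forall>r\<in>pos_vecs. continuous_map (flat_banach_topology \<sigma> r) T (\<lambda>F. F))}"
    using locally_convex_indiscrete by (intro CollectI exI[of _ ?X]) (simp add: openin_indiscrete)
  then show ?thesis
    unfolding A_flat_topology_def topology_generated_by_topspace using openin_subset by fast
qed

text \<open>A generator \<open>U\<close> is open in some admissible \<open>X\<close> for
  \<open>\<sigma>2\<close>. The pullback of \<open>X\<close> along \<open>T\<close> is admissible
  for \<open>\<sigma>1\<close>: on each Banach space the inclusion followed by \<open>T\<close>
  passes through the Banach space of radius \<open>t * r\<close>, on which \<open>X\<close> is
  continuous by assumption. The preimage of \<open>U\<close> is thus itself a generator.\<close>

lemma multiplier_continuous_A_flat:
  fixes T :: "(complex ^ 'd \<Rightarrow> complex) \<Rightarrow> complex ^ 'd \<Rightarrow> complex"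
  assumes m: "multiplier (1 / (2 * \<sigma>1) - 1 / (2 * \<sigma>2)) t m"
    and T: "acts_by m (A_flat \<sigma>1) T"
  shows "continuous_map (A_flat_topology \<sigma>1) (A_flat_topology \<sigma>2) T"
  unfolding A_flat_topology_def[of \<sigma>2]
proof (rule continuous_on_generated_topo)
  have gen: "\<Union> {U. \<exists>X. openin X U \<and> topspace X = A_flat \<sigma>2 \<and>
      locally_convex_topology X \<and> (\<forall>r\<in>pos_vecs. continuous_map (flat_banach_topology \<sigma>2 r) X (\<lambda>F. F))}
      = (A_flat \<sigma>2 :: (complex ^ 'd \<Rightarrow> complex) set)"
    by (rule topspace_A_flat_topology[unfolded A_flat_topology_def topology_generated_by_topspace])
  show "T ` topspace (A_flat_topology \<sigma>1) \<subseteq> \<Union> {U. \<exists>X. openin X U \<and> topspace X = A_flat \<sigma>2 \<and>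
      locally_convex_topology X \<and> (\<forall>r\<in>pos_vecs. continuous_map (flat_banach_topology \<sigma>2 r) X (\<lambda>F. F))}"
    unfolding gen topspace_A_flat_topology using multiplier_A_flat[OF m T] by (rule image_subsetI)
  fix U :: "(complex ^ 'd \<Rightarrow> complex) set"
  assume "U \<in> {U. \<exists>X. openin X U \<and> topspace X = A_flat \<sigma>2 \<and>
      locally_convex_topology X \<and> (\<forall>r\<in>pos_vecs. continuous_map (flat_banach_topology \<sigma>2 r) X (\<lambda>F. F))}"
  then obtain X where X: "openin X U" "topspace X = A_flat \<sigma>2" "locally_convex_topology X"
    "\<And>r. r \<in> pos_vecs \<Longrightarrow> continuous_map (flat_banach_topology \<sigma>2 r) X (\<lambda>F. F)"
    by blast
  let ?P = "pullback_topology (A_flat \<sigma>1) T X"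
  have "continuous_map (flat_banach_topology \<sigma>1 r) ?P (\<lambda>F. F)" if r: "r \<in> pos_vecs" for r
  proof (rule continuous_map_pullback')
    have "t * r \<in> pos_vecs"
      using m r by (simp add: multiplier_def pos_vecs_times)
    then show "continuous_map (flat_banach_topology \<sigma>1 r) X (T \<circ> (\<lambda>F. F))"
      using continuous_map_compose[OF multiplier_continuous_flat_banach[OF m T r] X(4)] by (simp add: o_def)
    show "topspace (flat_banach_topology \<sigma>1 r) \<subseteq> (\<lambda>F. F) -` A_flat \<sigma>1"
      using r by (auto simp: A_flat_eq)
  qed
  moreover have "openin ?P (T -` U \<inter> A_flat \<sigma>1)"
    unfolding openin_pullback_topology using X(1) by blast
  ultimately show "openin (A_flat_topology \<sigma>1) (T -` U \<inter> topspace (A_flat_topology \<sigma>1))"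
    unfolding topspace_A_flat_topology
    unfolding A_flat_topology_def[of \<sigma>1]
    using locally_convex_pullback[OF m T X(3,2)]
    by (intro topology_generated_by_Basis CollectI exI[of _ ?P] conjI ballI)
qed

lemma multiplier_homeomorphic:
  fixes T :: "(complex ^ 'd \<Rightarrow> complex) \<Rightarrow> complex ^ 'd \<Rightarrow> complex"
  assumes m: "multiplier (1 / (2 * \<sigma>1) - 1 / (2 * \<sigma>2)) t m"
    and m': "multiplier (1 / (2 * \<sigma>2) - 1 / (2 * \<sigma>1)) t' m'"
    and inv: "\<And>\<alpha>. m \<alpha> * m' \<alpha> = 1"
    and T: "acts_by m (A_flat \<sigma>1) T" and S: "acts_by m' (A_flat \<sigma>2) S"
  shows "homeomorphic_maps (A_flat_topology \<sigma>1) (A_flat_topology \<sigma>2) T S"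
    and "homeomorphic_maps (A0_flat_topology \<sigma>1) (A0_flat_topology \<sigma>2) T S"
proof -
  \<comment> \<open>Stated for arbitrary multipliers and parameters so that the same argument gives
    both compositions.\<close>
  have ST: "S (T F) = F" if "F \<in> A_flat \<sigma>1" "acts_by m (A_flat \<sigma>1) T" "acts_by m' (A_flat \<sigma>2) S"
      "T F \<in> A_flat \<sigma>2" "\<And>\<alpha>. m \<alpha> * m' \<alpha> = 1" for F \<sigma>1 \<sigma>2 m m' and T S :: "(complex ^ 'd \<Rightarrow> complex) \<Rightarrow> complex ^ 'd \<Rightarrow> complex"
  proof -
    have "has_coeffs (S (T F)) (\<lambda>\<alpha>. m' \<alpha> * coeff_of (T F) \<alpha>)"
      using that(3,4) by (simp add: acts_by_def)
    moreover have "coeff_of (T F) = (\<lambda>\<alpha>. m \<alpha> * coeff_of F \<alpha>)"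
      using that(1,2) by (intro coeff_of_eq) (simp add: acts_by_def)
    moreover have "m' \<alpha> * (m \<alpha> * x) = x" for \<alpha> x
      proof -
      have "m' \<alpha> * (m \<alpha> * x) = (m \<alpha> * m' \<alpha>) * x"
        by (simp only: mult_ac)
      then show ?thesis by (simp add: that(5))
    qed
    ultimately have "has_coeffs (S (T F)) (coeff_of F)"
      by simp
    moreover have "has_coeffs F (coeff_of F)"
      using that(1) has_coeffs_coeff_of by (auto simp: A_flat_def)
    ultimately show ?thesis
      unfolding has_coeffs_def using has_sum_unique by blast
  qed
  have inv': "m' \<alpha> * m \<alpha> = 1" for \<alpha>
    using inv[of \<alpha>] by (simp add: mult.commute)
  have 1: "S (T F) = F" if "F \<in> A_flat \<sigma>1" for F
    by (rule ST[OF that T S multiplier_A_flat[OF m T that] inv])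
  have 2: "T (S F) = F" if "F \<in> A_flat \<sigma>2" for F
    by (rule ST[OF that S T multiplier_A_flat[OF m' S that] inv'])
  show "homeomorphic_maps (A_flat_topology \<sigma>1) (A_flat_topology \<sigma>2) T S"
    unfolding homeomorphic_maps_def topspace_A_flat_topology
    using 1 2 multiplier_continuous_A_flat[OF m T] multiplier_continuous_A_flat[OF m' S] by blast
  have top: "topspace (A0_flat_topology \<sigma>) \<subseteq> (A_flat \<sigma> :: (complex ^ 'd \<Rightarrow> complex) set)" for \<sigma>
    unfolding A0_flat_topology_def topology_generated_by_topspace using A0_flat_subset by blast
  show "homeomorphic_maps (A0_flat_topology \<sigma>1) (A0_flat_topology \<sigma>2) T S"
    unfolding homeomorphic_maps_def
    using 1 2 top multiplier_continuous_A0_flat[OF m T] multiplier_continuous_A0_flat[OF m' S] by blast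
qed

section \<open>Moments as multipliers and the growth characterisations\<close>

lemma pos_vecs_lambda: "(\<And>j. 0 < f j) \<Longrightarrow> (\<chi> j. f j) \<in> pos_vecs"
  by (simp add: pos_vecs_def)

lemma pos_powr: "0 < x \<Longrightarrow> 0 < x powr (a :: real)" for x :: real
  by simp

text \<open>The two-sided moment estimate in multiplier form: the moment has factorial exponent -1
  and its reciprocal +1. The scalar \<open>k\<close> stands for the power of pi in the
  projection.\<close>

lemma moment_multiplier:
  fixes \<omega> :: "complex ^ 'd \<Rightarrow> real"
  assumes \<omega>: "radial_weight t1 t2 \<omega>" and "0 < k"
  shows "multiplier (- 1) (\<chi> j. (t2 $ j)\<^sup>2) (\<lambda>\<alpha>. of_real (moment \<omega> \<alpha> / k))"
    and "multiplier 1 (\<chi> j. inverse ((t1 $ j / 2)\<^sup>2)) (\<lambda>\<alpha>. of_real (k / moment \<omega> \<alpha>))"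
proof -
  have t: "\<And>j. 0 < t1 $ j" "\<And>j. 0 < t2 $ j"
    using \<omega> by (auto simp: radial_weight_def pos_vecs_def)
  obtain C where "0 < C" and C: "\<And>\<alpha>. moment \<omega> \<alpha> \<le> C * (mpow (\<chi> j. (t2 $ j)\<^sup>2) \<alpha> / mfact \<alpha>)"
    using moment_le[OF \<omega>] by blast
  have "norm (of_real (moment \<omega> \<alpha> / k) :: complex) \<le> C / k * (mpow (\<chi> j. (t2 $ j)\<^sup>2) \<alpha> * mfact \<alpha> powr (- 1))" for \<alpha>
  proof -
    have "norm (of_real (moment \<omega> \<alpha> / k) :: complex) = moment \<omega> \<alpha> / k"
      using moment_pos[OF \<omega>, of \<alpha>] \<open>0 < k\<close> unfolding norm_of_real by simp
    also have "\<dots> \<le> C * (mpow (\<chi> j. (t2 $ j)\<^sup>2) \<alpha> / mfact \<alpha>) / k"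
      using \<open>0 < k\<close> by (intro divide_right_mono C) simp
    also have "\<dots> = C / k * (mpow (\<chi> j. (t2 $ j)\<^sup>2) \<alpha> * mfact \<alpha> powr (- 1))"
      using mfact_pos[of \<alpha>] by (simp add: powr_neg_one)
    finally show ?thesis .
  qed
  then show "multiplier (- 1) (\<chi> j. (t2 $ j)\<^sup>2) (\<lambda>\<alpha>. of_real (moment \<omega> \<alpha> / k))"
    unfolding multiplier_def using t \<open>0 < C\<close> \<open>0 < k\<close>
    by (intro conjI exI[of _ "C / k"] pos_vecs_lambda zero_less_power allI divide_pos_pos)
  obtain D where "0 < D" and D: "\<And>\<alpha>. D * (mpow (\<chi> j. (t1 $ j / 2)\<^sup>2) \<alpha> / mfact \<alpha>) \<le> moment \<omega> \<alpha>"
    using moment_ge[OF \<omega>] by blast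
  have "norm (of_real (k / moment \<omega> \<alpha>) :: complex) \<le> k / D * (mpow (\<chi> j. inverse ((t1 $ j / 2)\<^sup>2)) \<alpha> * mfact \<alpha> powr 1)" for \<alpha>
  proof -
    have "(\<chi> j. (t1 $ j / 2)\<^sup>2) \<in> pos_vecs"
      using t by (intro pos_vecs_lambda zero_less_power) simp
    then have m: "0 < mpow (\<chi> j. (t1 $ j / 2)\<^sup>2) \<alpha>"
      by (rule mpow_pos)
    have inv: "mpow (\<chi> j. inverse ((t1 $ j / 2)\<^sup>2)) \<alpha> = inverse (mpow (\<chi> j. (t1 $ j / 2)\<^sup>2) \<alpha>)"
      unfolding mpow_def vec_lambda_beta power_inverse by (rule prod_inversef[unfolded o_def])
    have "norm (of_real (k / moment \<omega> \<alpha>) :: complex) = k / moment \<omega> \<alpha>"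
      using moment_pos[OF \<omega>, of \<alpha>] \<open>0 < k\<close> unfolding norm_of_real by simp
    also have "\<dots> \<le> k / (D * (mpow (\<chi> j. (t1 $ j / 2)\<^sup>2) \<alpha> / mfact \<alpha>))"
    proof (rule divide_left_mono[OF D])
      show "0 \<le> k" using \<open>0 < k\<close> by simp
      show "0 < moment \<omega> \<alpha> * (D * (mpow (\<chi> j. (t1 $ j / 2)\<^sup>2) \<alpha> / mfact \<alpha>))"
        by (intro mult_pos_pos divide_pos_pos moment_pos[OF \<omega>] m mfact_pos \<open>0 < D\<close>)
    qed
    also have "\<dots> = k / D * (mpow (\<chi> j. inverse ((t1 $ j / 2)\<^sup>2)) \<alpha> * mfact \<alpha>)"
      unfolding inv by (simp only: divide_inverse inverse_mult_distrib inverse_inverse_eq mult.assoc)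
    also have "mfact \<alpha> = mfact \<alpha> powr 1"
      by (rule powr_one[symmetric]) (rule less_imp_le[OF mfact_pos])
    finally show ?thesis .
  qed
  then show "multiplier 1 (\<chi> j. inverse ((t1 $ j / 2)\<^sup>2)) (\<lambda>\<alpha>. of_real (k / moment \<omega> \<alpha>))"
    unfolding multiplier_def using t \<open>0 < D\<close> \<open>0 < k\<close>
    by (intro conjI exI[of _ "k / D"] pos_vecs_lambda zero_less_power positive_imp_inverse_positive allI divide_pos_pos)
      (simp_all only: zero_less_numeral)
qed

lemma acts_by_series:
  fixes m :: "nat ^ 'd \<Rightarrow> complex"
  assumes m: "multiplier (1 / (2 * \<sigma>1) - 1 / (2 * \<sigma>2)) t m" and "0 < \<sigma>2"
  shows "acts_by m (A_flat \<sigma>1) (\<lambda>F z. \<Sum>\<^sub>\<infinity>\<alpha>. m \<alpha> * coeff_of F \<alpha> * e_basis \<alpha> z)"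
  unfolding acts_by_def
proof
  fix F :: "complex ^ 'd \<Rightarrow> complex" assume "F \<in> A_flat \<sigma>1"
  then obtain r D where r: "r \<in> pos_vecs"
    and D: "\<And>\<alpha>. norm (coeff_of F \<alpha>) \<le> D * (mpow r \<alpha> * mfact \<alpha> powr (- 1 / (2 * \<sigma>1)))"
    unfolding A_flat_def flat_bound_def by blast
  obtain C where t: "t \<in> pos_vecs"
    and C: "\<And>\<alpha>. norm (m \<alpha>) \<le> C * (mpow t \<alpha> * mfact \<alpha> powr (1 / (2 * \<sigma>1) - 1 / (2 * \<sigma>2)))"
    using m unfolding multiplier_def by blast
  show "has_coeffs (\<lambda>z. \<Sum>\<^sub>\<infinity>\<alpha>. m \<alpha> * coeff_of F \<alpha> * e_basis \<alpha> z) (\<lambda>\<alpha>. m \<alpha> * coeff_of F \<alpha>)"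
    by (rule has_coeffs_of_bound[OF pos_vecs_times[OF t r] \<open>0 < \<sigma>2\<close>]) (rule multiplier_bound[OF C D])
qed

lemma A_flat_iff_growth:
  fixes F :: "complex ^ 'd \<Rightarrow> complex"
  assumes F: "entire F" and \<sigma>: "0 < \<sigma>" "\<sigma> \<le> 1"
  shows "F \<in> A_flat \<sigma> \<longleftrightarrow> (\<exists>r\<in>pos_vecs. \<exists>C>0. \<forall>z. norm (F z) \<le>
    C * exp (\<Sum>j\<in>UNIV. r $ j * norm (z $ j) powr (2 * \<sigma> / (\<sigma> + 1))))" (is "?L \<longleftrightarrow> ?R")
proof
  define s where "s = 2 * \<sigma> / (\<sigma> + 1)"
  have s: "0 < s" using \<sigma> by (simp add: s_def)
  {
    assume ?L
    then obtain r C where r: "r \<in> pos_vecs" and "0 < C" and ps: "power_series F"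
      and C: "\<And>\<alpha>. norm (coeff_of F \<alpha>) \<le> C * (mpow r \<alpha> * mfact \<alpha> powr (- 1 / (2 * \<sigma>)))"
      unfolding A_flat_def flat_bound_def by blast
    have "(\<chi> j. r $ j powr s / s) \<in> pos_vecs"
      using r s by (intro pos_vecs_lambda divide_pos_pos pos_powr) (auto simp: pos_vecs_def)
    moreover have "norm (F z) \<le> C * exp (\<Sum>j\<in>UNIV. (\<chi> j. r $ j powr s / s) $ j * norm (z $ j) powr s)" for z
      using growth_of_coeffs[OF has_coeffs_coeff_of[OF ps] r \<sigma> less_imp_le[OF \<open>0 < C\<close>] C] by (simp add: s_def)
    ultimately show ?R
      using \<open>0 < C\<close> unfolding s_def by blast
  next
    assume ?R
    then obtain r C where r: "r \<in> pos_vecs" and "0 < C"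
      and bd: "\<And>z. norm (F z) \<le> C * exp (\<Sum>j\<in>UNIV. r $ j * norm (z $ j) powr s)"
      unfolding s_def by blast
    obtain c where c: "has_coeffs F c" and cb: "\<And>\<alpha>. norm (c \<alpha>) \<le> C * exp 1 ^ CARD('d) *
        (mpow (\<chi> j. exp 1 * r $ j powr (1 / s)) \<alpha> * mfact \<alpha> powr (- 1 / (2 * \<sigma>)))"
      using coeffs_of_growth[OF F r \<sigma>(1) \<open>0 < C\<close> bd s_def] by blast
    have "(\<chi> j. exp 1 * r $ j powr (1 / s)) \<in> pos_vecs"
      using r by (intro pos_vecs_lambda mult_pos_pos pos_powr) (auto simp: pos_vecs_def)
    moreover have "flat_bound \<sigma> (\<chi> j. exp 1 * r $ j powr (1 / s)) F"
      unfolding flat_bound_def coeff_of_eq[OF c] using cb \<open>0 < C\<close> by (intro exI[of _ "C * exp 1 ^ CARD('d)"]) simp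
    ultimately show ?L
      using c unfolding A_flat_def power_series_iff by blast
  }
qed

text \<open>The same two estimates as for the inductive limit, but the radius is now prescribed at
  the end, so both changes of radius have to be solved for the initial one.\<close>

lemma A0_flat_iff_growth:
  fixes F :: "complex ^ 'd \<Rightarrow> complex"
  assumes F: "entire F" and \<sigma>: "0 < \<sigma>" "\<sigma> \<le> 1"
  shows "F \<in> A0_flat \<sigma> \<longleftrightarrow> (\<forall>r\<in>pos_vecs. \<exists>C>0. \<forall>z. norm (F z) \<le>
    C * exp (\<Sum>j\<in>UNIV. r $ j * norm (z $ j) powr (2 * \<sigma> / (\<sigma> + 1))))" (is "?L \<longleftrightarrow> ?R")
proof
  define s where "s = 2 * \<sigma> / (\<sigma> + 1)"
  have s: "0 < s" using \<sigma> by (simp add: s_def)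
  {
    assume L: ?L
    show ?R
    proof
      fix q :: "real ^ 'd" assume q: "q \<in> pos_vecs"
      then have q0: "0 < q $ j" for j by (simp add: pos_vecs_def)
      \<comment> \<open>Solves r^s / s = q, the radius produced by the growth estimate.\<close>
      define r where "r = (\<chi> j. (s * q $ j) powr (1 / s))"
      have sq: "0 < s * q $ j" for j using s q0 by simp
      have r: "r \<in> pos_vecs"
        unfolding r_def by (intro pos_vecs_lambda pos_powr sq)
      have rq: "r $ j powr s / s = q $ j" for j
        using s sq[of j] by (simp add: r_def powr_powr)
      obtain C where "0 < C" and ps: "power_series F"
        and C: "\<And>\<alpha>. norm (coeff_of F \<alpha>) \<le> C * (mpow r \<alpha> * mfact \<alpha> powr (- 1 / (2 * \<sigma>)))"
        using L r unfolding A0_flat_def flat_bound_def by blast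
      have "norm (F z) \<le> C * exp (\<Sum>j\<in>UNIV. q $ j * norm (z $ j) powr s)" for z
        using growth_of_coeffs[OF has_coeffs_coeff_of[OF ps] r \<sigma> less_imp_le[OF \<open>0 < C\<close>] C, folded s_def]
        unfolding rq .
      then show "\<exists>C>0. \<forall>z. norm (F z) \<le> C * exp (\<Sum>j\<in>UNIV. q $ j * norm (z $ j) powr (2 * \<sigma> / (\<sigma> + 1)))"
        using \<open>0 < C\<close> unfolding s_def by blast
    qed
  next
    assume R: ?R
    have fb: "power_series F \<and> flat_bound \<sigma> q F" if q: "q \<in> pos_vecs" for q
    proof -
      have q0: "0 < q $ j" for j using q by (simp add: pos_vecs_def)
      \<comment> \<open>Solves e r^(1/s) = q, the radius produced by Cauchy's estimates.\<close>
      define r where "r = (\<chi> j. (q $ j / exp 1) powr s)"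
      have r: "r \<in> pos_vecs"
        unfolding r_def by (intro pos_vecs_lambda pos_powr divide_pos_pos q0) simp
      have rq: "(\<chi> j. exp 1 * r $ j powr (1 / s)) = q"
        using s q0 by (simp add: r_def powr_powr vec_eq_iff less_imp_le)
      obtain C where "0 < C" and bd: "\<And>z. norm (F z) \<le> C * exp (\<Sum>j\<in>UNIV. r $ j * norm (z $ j) powr s)"
        using R r unfolding s_def by blast
      obtain c where c: "has_coeffs F c" and cb: "\<And>\<alpha>. norm (c \<alpha>) \<le> C * exp 1 ^ CARD('d) *
          (mpow (\<chi> j. exp 1 * r $ j powr (1 / s)) \<alpha> * mfact \<alpha> powr (- 1 / (2 * \<sigma>)))"
        using coeffs_of_growth[OF F r \<sigma>(1) \<open>0 < C\<close> bd s_def] by blast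
      have "flat_bound \<sigma> q F"
        unfolding flat_bound_def coeff_of_eq[OF c] using cb[unfolded rq] \<open>0 < C\<close>
        by (intro exI[of _ "C * exp 1 ^ CARD('d)"]) simp
      then show ?thesis
        using c unfolding power_series_iff by blast
    qed
    then show ?L
      unfolding A0_flat_def using one_pos_vecs by blast
  }
qed

theorem theorem3p7:
  fixes cut :: "complex ^ 'd \<Rightarrow> real" and \<sigma> \<sigma>0 :: real
  assumes cut: "cut \<in> R_inf"
    and \<sigma>: "0 < \<sigma>" "\<sigma> < 1 / 2"
    and \<sigma>0: "\<sigma>0 = \<sigma> / (1 - 2 * \<sigma>)"
  shows
    "(\<forall>F. entire F \<longrightarrow>
        (F \<in> A_flat \<sigma> \<longleftrightarrow>
          (\<exists>r\<in>pos_vecs. \<exists>C>0. \<forall>z :: complex ^ 'd. norm (F z) \<le>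
            C * exp (\<Sum>j\<in>UNIV. r $ j * norm (z $ j) powr (2 * \<sigma> / (\<sigma> + 1))))) \<and>
        (F \<in> A_flat \<sigma> \<longleftrightarrow>
          (\<exists>F0\<in>A_flat \<sigma>0. F = Pi_A (\<lambda>w. F0 w * of_real (cut w)))))
     \<and>
     (\<forall>F. entire F \<longrightarrow>
        (F \<in> A0_flat \<sigma> \<longleftrightarrow>
          (\<forall>r\<in>pos_vecs. \<exists>C>0. \<forall>z :: complex ^ 'd. norm (F z) \<le>
            C * exp (\<Sum>j\<in>UNIV. r $ j * norm (z $ j) powr (2 * \<sigma> / (\<sigma> + 1))))) \<and>
        (F \<in> A0_flat \<sigma> \<longleftrightarrow>
          (\<exists>F0\<in>A0_flat \<sigma>0. F = Pi_A (\<lambda>w. F0 w * of_real (cut w)))))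
     \<and>
     homeomorphic_map (A_flat_topology \<sigma>0 :: (complex ^ 'd \<Rightarrow> complex) topology) (A_flat_topology \<sigma>)
       (\<lambda>F. Pi_A (\<lambda>w. F w * of_real (cut w)))
     \<and>
     homeomorphic_map (A0_flat_topology \<sigma>0 :: (complex ^ 'd \<Rightarrow> complex) topology) (A0_flat_topology \<sigma>)
       (\<lambda>F. Pi_A (\<lambda>w. F w * of_real (cut w)))"
proof -
  define T where "T = (\<lambda>F :: complex ^ 'd \<Rightarrow> complex. Pi_A (\<lambda>w. F w * of_real (cut w)))"
  obtain t1 t2 where \<omega>: "radial_weight t1 t2 (\<lambda>w. cut w * exp (- (norm w)\<^sup>2))"
    by (rule R_inf_radial_weight[OF cut])
  define k where "k = pi ^ CARD('d)"
  have k: "0 < k" by (simp add: k_def)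
  define m :: "nat ^ 'd \<Rightarrow> complex" where "m \<alpha> = of_real (moment (\<lambda>w. cut w * exp (- (norm w)\<^sup>2)) \<alpha> / k)" for \<alpha>
  define m' :: "nat ^ 'd \<Rightarrow> complex" where "m' \<alpha> = of_real (k / moment (\<lambda>w. cut w * exp (- (norm w)\<^sup>2)) \<alpha>)" for \<alpha>
  \<comment> \<open>The inverse is the termwise series with the reciprocal multiplier.\<close>
  define S where "S = (\<lambda>F z. \<Sum>\<^sub>\<infinity>\<alpha>. m' \<alpha> * coeff_of F \<alpha> * e_basis \<alpha> z)"
  have inv: "m \<alpha> * m' \<alpha> = 1" for \<alpha>
    unfolding m_def m'_def of_real_mult[symmetric] using moment_pos[OF \<omega>, of \<alpha>] k by simp
  \<comment> \<open>Here \<sigma> < 1 / 2 enters; positivity makes the series defining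
    \<open>S\<close> converge everywhere.\<close>
  have \<sigma>0_pos: "0 < \<sigma>0"
    using \<sigma> by (simp add: \<sigma>0)
  have "1 / (2 * \<sigma>0) = (1 - 2 * \<sigma>) / (2 * \<sigma>)"
    by (simp add: \<sigma>0)
  then have \<kappa>: "1 / (2 * \<sigma>0) - 1 / (2 * \<sigma>) = - 1" "1 / (2 * \<sigma>) - 1 / (2 * \<sigma>0) = 1"
    using \<sigma> by (simp_all add: diff_divide_distrib)
  have m: "multiplier (1 / (2 * \<sigma>0) - 1 / (2 * \<sigma>)) (\<chi> j. (t2 $ j)\<^sup>2) m"
    unfolding \<kappa> m_def[abs_def] by (rule moment_multiplier(1)[OF \<omega> k])
  have m': "multiplier (1 / (2 * \<sigma>) - 1 / (2 * \<sigma>0)) (\<chi> j. inverse ((t1 $ j / 2)\<^sup>2)) m'"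
    unfolding \<kappa> m'_def[abs_def] by (rule moment_multiplier(2)[OF \<omega> k])
  have T: "acts_by m (A_flat \<sigma>0) T"
    unfolding acts_by_def T_def m_def k_def using Pi_A_coeffs[OF \<omega>] has_coeffs_coeff_of
    by (auto simp: A_flat_def)
  have S: "acts_by m' (A_flat \<sigma>) S"
    unfolding S_def by (rule acts_by_series[OF m' \<sigma>0_pos])
  note homeo = multiplier_homeomorphic[OF m m' inv T S]
  have TS: "T (S F) = F" if "F \<in> A_flat \<sigma>" for F
    using homeo(1) that by (simp add: homeomorphic_maps_def topspace_A_flat_topology)
  have A: "F \<in> A_flat \<sigma> \<longleftrightarrow> (\<exists>F0\<in>A_flat \<sigma>0. F = T F0)" for F
    using multiplier_A_flat[OF m T] multiplier_A_flat[OF m' S] TS by metis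
  have A0: "F \<in> A0_flat \<sigma> \<longleftrightarrow> (\<exists>F0\<in>A0_flat \<sigma>0. F = T F0)" for F
    using multiplier_A0_flat[OF m T] multiplier_A0_flat[OF m' S] TS A0_flat_subset by (metis subsetD)
  have \<sigma>1: "\<sigma> \<le> 1"
    using \<sigma> by simp
  show ?thesis
    using homeo unfolding T_def homeomorphic_map_maps
    by (intro conjI allI impI A[unfolded T_def] A0[unfolded T_def] A_flat_iff_growth[OF _ \<sigma>(1) \<sigma>1] A0_flat_iff_growth[OF _ \<sigma>(1) \<sigma>1] exI[of _ S])
qed

end
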